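(* Let $a>-1$ be fixed, and consider for $b>-1$ with $a+b>-1$ the Meijer-G two-level determinantal random point field on $\mathbb R_+\sqcup\mathbb R_+$ with parameters $a,b$ and kernels $R^{(\pm\pm)}$ (see context). In the limit $b\to+\infty$, under the rescaling $\zeta\mapsto\frac b4\zeta$ of the points: (i) the $+$ field becomes the Bessel determinantal random point field with parameter $a$: for every $r\ge1$ and $\zeta_1,\dots,\zeta_r>0$, $$\lim_{b\to+\infty}\Big(\frac b4\Big)^{r}\det\Big[R^{(++)}\Big(\frac b4\zeta_i,\frac b4\zeta_j\Big)\Big]_{i,j=1}^r=\det\big[K_{B,a}(\zeta_i,\zeta_j)\big]_{i,j=1}^r;$$ (ii) the points of the $-$ field almost surely do not occupy any bounded set: all rescaled correlation functions involving at least one point of the $-$ field tend to $0$ uniformly on compact subsets of the (rescaled) variables in $(0,\infty)$, and for every bounded Borel set $A\subset\mathbb R_+$ the probability that the rescaled $-$ field has a point in $A$ tends to $0$ as $b\to+\infty$.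
   Context: Let $\alpha=a+b$. For $c\in\{a,b\}$ let $$H_c(\zeta)=\int_\gamma\frac{du}{2\pi i}\frac{\Gamma(u+c)}{\Gamma(1-u)\Gamma(\alpha-c+1-u)}\zeta^{-u},\qquad \widetilde H_c(\zeta)=\int_\gamma\frac{du}{2\pi i}\frac{\Gamma(u)\Gamma(u+c)}{\Gamma(\alpha-c+1-u)}\zeta^{-u},$$ where $\gamma$ originates at $-\infty$ in the lower half-plane, returns to $-\infty$ in the upper half-plane and encloses all poles of the numerator. The Meijer-G random point field is the two-level determinantal random point field on $\mathbb R_+\sqcup\mathbb R_+$ with kernels $$R^{(++)}(\zeta,\xi)=\int_0^1H_a(t\zeta)\widetilde H_b(t\xi)dt,\qquad R^{(+-)}(\zeta,\xi)=\int_0^1H_a(t\zeta)H_b(t\xi)dt,$$ $$R^{(-+)}(\zeta,\xi)=\int_0^1\widetilde H_a(t\zeta)\widetilde H_b(t\xi)dt-\frac1{\zeta+\xi},\qquad R^{(--)}(\zeta,\xi)=\int_0^1\widetilde H_a(t\zeta)H_b(t\xi)dt,$$ meaning that its correlation functions ($r$ points $\zeta_i$ in the first copy of $\mathbb R_+$, the $+$ field, and $s$ points $\xi_j$ in the second copy, the $-$ field) are $$\rho_{(r,s)}(\zeta_1,\dots,\zeta_r;\xi_1,\dots,\xi_s)=\det\begin{bmatrix}[R^{(++)}(\zeta_i,\zeta_j)]&[R^{(+-)}(\zeta_i,\xi_j)]\\ [R^{(-+)}(\xi_i,\zeta_j)]&[R^{(--)}(\xi_i,\xi_j)]\end{bmatrix}.$$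 The rescaled correlation functions are $(b/4)^{r+s}\rho_{(r,s)}(\tfrac b4\zeta_1,\dots,\tfrac b4\zeta_r;\tfrac b4\xi_1,\dots,\tfrac b4\xi_s)$. The Bessel kernel with parameter $a$ is $$K_{B,a}(x,y)=\frac{J_a(\sqrt x)\sqrt y\,J_a'(\sqrt y)-J_a(\sqrt y)\sqrt x\,J_a'(\sqrt x)}{2(x-y)}=\frac14\int_0^1J_a(\sqrt{xt})J_a(\sqrt{yt})\,dt,$$ with $J_a$ the Bessel function of the first kind; the Bessel random point field has correlation functions $\det[K_{B,a}(\zeta_i,\zeta_j)]$. *)

theory Defs
  imports
    "HOL-Complex_Analysis.Complex_Analysis"
    "HOL-Probability.Probability"
    "Jordan_Normal_Form.Determinant"
begin

section \<open>Meijer-G functions and kernels\<close>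

text \<open>
  The contour \<open>\<gamma>\<close> is the loop that comes in from \<open>-\<infinity>\<close> along \<open>Im u = -1\<close>, crosses the real
  axis at \<open>1 + \<bar>c\<bar>\<close> and goes back to \<open>-\<infinity>\<close> along \<open>Im u = 1\<close>. All numerator poles
  (\<open>u = -n\<close> and \<open>u = -c - n\<close>, \<open>n \<ge> 0\<close>) lie inside it; by Cauchy's theorem any other admissible
  contour gives the same integral. The path below is the loop cut off at \<open>Re u = -T\<close>, and the
  integral over \<open>\<gamma>\<close> is the limit \<open>T \<rightarrow> \<infinity>\<close>.
\<close>

definition loop_path :: "real \<Rightarrow> real \<Rightarrow> real \<Rightarrow> complex" where
  "loop_path c T =
     linepath (Complex (-T) (-1)) (Complex (1 + \<bar>c\<bar>) (-1)) +++
     linepath (Complex (1 + \<bar>c\<bar>) (-1)) (Complex (1 + \<bar>c\<bar>) 1) +++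
     linepath (Complex (1 + \<bar>c\<bar>) 1) (Complex (-T) 1)"

definition loop_integral :: "real \<Rightarrow> (complex \<Rightarrow> complex) \<Rightarrow> complex" where
  "loop_integral c f = Lim at_top (\<lambda>T. contour_integral (loop_path c T) f)"

text \<open>
  The functions \<open>H\<^sub>c\<close> and \<open>\<tilde>H\<^sub>c\<close>, with \<open>\<alpha> = a + b\<close> as a parameter. The library sets \<open>Gamma\<close> to \<open>0\<close>
  at its poles, so \<open>1 / Gamma\<close> is the entire function \<open>rGamma\<close>.
\<close>

definition meijer_H :: "real \<Rightarrow> real \<Rightarrow> real \<Rightarrow> complex" where
  "meijer_H \<alpha> c \<zeta> = 1 / (2 * of_real pi * \<i>) * loop_integral c
     (\<lambda>u. Gamma (u + of_real c) / (Gamma (1 - u) * Gamma (of_real (\<alpha> - c + 1) - u))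
          * of_real \<zeta> powr (-u))"

definition meijer_H_tilde :: "real \<Rightarrow> real \<Rightarrow> real \<Rightarrow> complex" where
  "meijer_H_tilde \<alpha> c \<zeta> = 1 / (2 * of_real pi * \<i>) * loop_integral c
     (\<lambda>u. Gamma u * Gamma (u + of_real c) / Gamma (of_real (\<alpha> - c + 1) - u)
          * of_real \<zeta> powr (-u))"

definition R_pp :: "real \<Rightarrow> real \<Rightarrow> real \<Rightarrow> real \<Rightarrow> complex" where
  "R_pp a b \<zeta> \<xi> =
     (LBINT t:{0<..<1}. meijer_H (a + b) a (t * \<zeta>) * meijer_H_tilde (a + b) b (t * \<xi>))"

definition R_pm :: "real \<Rightarrow> real \<Rightarrow> real \<Rightarrow> real \<Rightarrow> complex" where
  "R_pm a b \<zeta> \<xi> =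
     (LBINT t:{0<..<1}. meijer_H (a + b) a (t * \<zeta>) * meijer_H (a + b) b (t * \<xi>))"

definition R_mp :: "real \<Rightarrow> real \<Rightarrow> real \<Rightarrow> real \<Rightarrow> complex" where
  "R_mp a b \<zeta> \<xi> =
     (LBINT t:{0<..<1}. meijer_H_tilde (a + b) a (t * \<zeta>) * meijer_H_tilde (a + b) b (t * \<xi>))
     - of_real (1 / (\<zeta> + \<xi>))"

definition R_mm :: "real \<Rightarrow> real \<Rightarrow> real \<Rightarrow> real \<Rightarrow> complex" where
  "R_mm a b \<zeta> \<xi> =
     (LBINT t:{0<..<1}. meijer_H_tilde (a + b) a (t * \<zeta>) * meijer_H (a + b) b (t * \<xi>))"

text \<open>
  Points are indexed from \<open>0\<close>: only the coordinates \<open>\<zeta> i\<close> with \<open>i < r\<close> and \<open>\<xi> j\<close> with \<open>j < s\<close>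
  matter in \<open>meijer_rho a b r s \<zeta> \<xi>\<close>.
\<close>

definition meijer_rho ::
  "real \<Rightarrow> real \<Rightarrow> nat \<Rightarrow> nat \<Rightarrow> (nat \<Rightarrow> real) \<Rightarrow> (nat \<Rightarrow> real) \<Rightarrow> complex" where
  "meijer_rho a b r s \<zeta> \<xi> = Determinant.det (four_block_mat
     (Matrix.mat r r (\<lambda>(i, j). R_pp a b (\<zeta> i) (\<zeta> j)))
     (Matrix.mat r s (\<lambda>(i, j). R_pm a b (\<zeta> i) (\<xi> j)))
     (Matrix.mat s r (\<lambda>(i, j). R_mp a b (\<xi> i) (\<zeta> j)))
     (Matrix.mat s s (\<lambda>(i, j). R_mm a b (\<xi> i) (\<xi> j))))"

definition rescaled_meijer_rho ::
  "real \<Rightarrow> real \<Rightarrow> nat \<Rightarrow> nat \<Rightarrow> (nat \<Rightarrow> real) \<Rightarrow> (nat \<Rightarrow> real) \<Rightarrow> complex" where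
  "rescaled_meijer_rho a b r s \<zeta> \<xi> =
     of_real ((b / 4) ^ (r + s)) *
     meijer_rho a b r s (\<lambda>i. b / 4 * \<zeta> i) (\<lambda>j. b / 4 * \<xi> j)"


section \<open>The Bessel kernel\<close>

definition bessel_J :: "real \<Rightarrow> real \<Rightarrow> real" where
  "bessel_J a x =
     (\<Sum>n. (-1) ^ n / (fact n * Gamma (a + real n + 1)) * (x / 2) powr (2 * real n + a))"

text \<open>
  The integral form of the kernel also covers the diagonal \<open>x = y\<close>, where the quotient
  \<open>(J\<^sub>a(\<surd>x) \<surd>y J\<^sub>a'(\<surd>y) - J\<^sub>a(\<surd>y) \<surd>x J\<^sub>a'(\<surd>x)) / (2(x - y))\<close> has to be read as a limit.
\<close>

definition bessel_kernel :: "real \<Rightarrow> real \<Rightarrow> real \<Rightarrow> real" where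
  "bessel_kernel a x y =
     1 / 4 * (LBINT t:{0<..<1}. bessel_J a (sqrt (x * t)) * bessel_J a (sqrt (y * t)))"


section \<open>Two-level random point fields\<close>

text \<open>
  A (simple) random point configuration on the open half-line \<open>(0, \<infinity>)\<close>, finite in every bounded
  set (in particular near \<open>0\<close>).
\<close>

definition random_configuration :: "'w measure \<Rightarrow> ('w \<Rightarrow> real set) \<Rightarrow> bool" where
  "random_configuration M X \<longleftrightarrow>
     (\<forall>\<omega>\<in>space M. X \<omega> \<subseteq> {0<..} \<and> (\<forall>A. bounded A \<longrightarrow> finite (X \<omega> \<inter> A))) \<and>
     (\<forall>A\<in>sets borel. bounded A \<longrightarrow> (\<lambda>\<omega>. card (X \<omega> \<inter> A)) \<in> measurable M (count_space UNIV))"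

text \<open>
  A two-level field lives on the disjoint union of two copies of the half-line; the first
  configuration is the \<open>+\<close> field, the second one the \<open>-\<close> field.
\<close>

definition two_level_field ::
  "'w measure \<Rightarrow> ('w \<Rightarrow> real set) \<Rightarrow> ('w \<Rightarrow> real set) \<Rightarrow> bool" where
  "two_level_field M X Y \<longleftrightarrow>
     prob_space M \<and> random_configuration M X \<and> random_configuration M Y"

definition distinct_tuples :: "nat \<Rightarrow> real set \<Rightarrow> (nat \<Rightarrow> real set) \<Rightarrow> (nat \<Rightarrow> real) set" where
  "distinct_tuples r S A = {x \<in> (\<Pi>\<^sub>E i\<in>{..<r}. S \<inter> A i). inj_on x {..<r}}"

text \<open>
  \<open>\<rho> r s\<close> is the density of the factorial moment measure of order \<open>(r, s)\<close> with respect to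
  Lebesgue measure: its integral over a box is the expected number of pairs consisting of an
  \<open>r\<close>-tuple of distinct points of \<open>X\<close> and an \<open>s\<close>-tuple of distinct points of \<open>Y\<close> that lie in the
  box.
\<close>

definition has_correlation_functions ::
  "'w measure \<Rightarrow> ('w \<Rightarrow> real set) \<Rightarrow> ('w \<Rightarrow> real set) \<Rightarrow>
   (nat \<Rightarrow> nat \<Rightarrow> (nat \<Rightarrow> real) \<Rightarrow> (nat \<Rightarrow> real) \<Rightarrow> complex) \<Rightarrow> bool" where
  "has_correlation_functions M X Y \<rho> \<longleftrightarrow>
     (\<forall>r s A B.
        (\<forall>i<r. A i \<in> sets borel \<and> bounded (A i) \<and> A i \<subseteq> {0<..}) \<longrightarrow>
        (\<forall>j<s. B j \<in> sets borel \<and> bounded (B j) \<and> B j \<subseteq> {0<..}) \<longrightarrow>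
        (let P = (\<Pi>\<^sub>M i\<in>{..<r}. lborel) \<Otimes>\<^sub>M (\<Pi>\<^sub>M j\<in>{..<s}. lborel);
             D = (\<Pi>\<^sub>E i\<in>{..<r}. A i) \<times> (\<Pi>\<^sub>E j\<in>{..<s}. B j)
         in set_integrable P D (\<lambda>(x, y). \<rho> r s x y) \<and>
            has_bochner_integral M
              (\<lambda>\<omega>. of_nat (card (distinct_tuples r (X \<omega>) A) * card (distinct_tuples s (Y \<omega>) B)))
              (set_lebesgue_integral P D (\<lambda>(x, y). \<rho> r s x y))))"

definition meijer_G_field ::
  "real \<Rightarrow> real \<Rightarrow> 'w measure \<Rightarrow> ('w \<Rightarrow> real set) \<Rightarrow> ('w \<Rightarrow> real set) \<Rightarrow> bool" where
  "meijer_G_field a b M X Y \<longleftrightarrow>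
     two_level_field M X Y \<and> has_correlation_functions M X Y (meijer_rho a b)"

text \<open>A point \<open>\<zeta>\<close> of the rescaled configuration is a point \<open>c * \<zeta>\<close> of the original one.\<close>

definition rescale :: "real \<Rightarrow> real set \<Rightarrow> real set" where
  "rescale c S = (\<lambda>x. x / c) ` S"

end

theory Submission
  imports Defs "HOL-Real_Asymp.Real_Asymp"
begin

text \<open>
  Write \<open>c\<^sub>a(x) = \<Sum>\<^sub>n (-1)\<^sup>n x\<^sup>n / (n! \<Gamma>(a + 1 + n))\<close>, so that \<open>J\<^sub>a(2 \<surd>x) = x\<^sup>a\<^sup>/\<^sup>2 c\<^sub>a(x)\<close>. The theorem rests on
  the size of the four functions \<open>H\<^sub>a, H\<^sub>b, \<tilde>H\<^sub>a, \<tilde>H\<^sub>b\<close> at the point \<open>b x\<close> as \<open>b \<rightarrow> \<infinity>\<close>.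

  \<^item> \<open>H\<^sub>a\<close> is the sum of its residues, and \<open>\<Gamma>(b + 1 + a + n) \<sim> \<Gamma>(b + 1) b\<^sup>a\<^sup>+\<^sup>n\<close> turns the series of
    \<open>\<Gamma>(b + 1) H\<^sub>a(b x)\<close> term by term into that of \<open>x\<^sup>a c\<^sub>a(x)\<close> (\<open>tendsto_meijer_H_a\<close>).
  \<^item> \<open>\<tilde>H\<^sub>b\<close> has double poles when \<open>b\<close> is an integer. For \<open>b\<close> near an integer its residues to the left of
    \<open>-b\<close> come in large pairs that nearly cancel, so they give no uniform estimate. Instead the loop is opened up to the
    vertical line \<open>Re u = -3/2\<close>, at the cost of the residues at \<open>0\<close> and \<open>-1\<close>. On that line
    \<open>\<Gamma>(u + b) / (\<Gamma>(b) b\<^sup>u)\<close> tends to \<open>1\<close> and is dominated by its value at \<open>Re u\<close>, while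
    \<open>\<Gamma>(u) / \<Gamma>(a + 1 - u)\<close> is integrable. As \<open>c\<^sub>a\<close> has the same representation with \<open>\<Gamma>(u + b)\<close>
    left out, \<open>\<tilde>H\<^sub>b(b x) / \<Gamma>(b)\<close> tends to \<open>c\<^sub>a(x)\<close> (\<open>tendsto_meijer_H_tilde_b\<close>).
  \<^item> \<open>\<tilde>H\<^sub>a(b x)\<close> is \<open>O(x\<^sup>-\<^sup>s / \<Gamma>(b + 1))\<close> for each \<open>s\<close> strictly between \<open>max(0, -a)\<close> and \<open>1\<close>: the line
    \<open>Re u = s\<close> lies to the right of all poles (\<open>meijer_H_tilde_a_rescaled_bound\<close>).
  \<^item> \<open>H\<^sub>b(b x)\<close> is at most \<open>(e x)\<^sup>b e\<^sup>x / \<Gamma>(a + b + 1)\<close>, which is superexponentially small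
    (\<open>meijer_H_b_bound\<close>).

  In \<open>(b/4) R\<^sup>+\<^sup>+\<close> the factors \<open>b \<Gamma>(b) / \<Gamma>(b + 1)\<close> cancel, and dominated convergence gives the limit
  \<open>(\<zeta>/\<xi>)\<^sup>a\<^sup>/\<^sup>2 K\<^sub>B(\<zeta>, \<xi>)\<close> (\<open>tendsto_R_pp\<close>). The prefactor is a conjugation by a diagonal matrix, which no
  determinant sees. By the same count \<open>(b/4) R\<^sup>-\<^sup>+\<close> stays bounded, and \<open>(b/4) R\<^sup>+\<^sup>-\<close>, \<open>(b/4) R\<^sup>-\<^sup>-\<close> tend to
  \<open>0\<close> because they contain \<open>H\<^sub>b\<close> (\<open>eventually_rescaled_kernel_bounds\<close>). So every column that belongs
  to a point of the \<open>-\<close> field is small and the other columns are bounded; a determinant with a small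
  column is small. Finally the probability of a point of the \<open>-\<close> field in a bounded set is at most
  the expected number of such points, the integral of \<open>R\<^sup>-\<^sup>-\<close> over the diagonal. There the
  singularity \<open>x\<^sup>-\<^sup>s\<close> at the origin is compensated by the factor \<open>x\<^sup>b\<close> of \<open>H\<^sub>b\<close>.
\<close>


section \<open>Estimates for the Gamma function\<close>

lemma norm_Gamma_series_complex:
  fixes w :: complex
  shows "norm (Gamma_series w n) =
    fact n * exp (Re w * ln (real n)) / norm (pochhammer w (n+1))"
proof -
  have "norm (exp (w * of_real (ln (of_nat n)))) = exp (Re w * ln (real n))"
    by (simp add: norm_exp_eq_Re)
  then show ?thesis
    unfolding Gamma_series_def
    by (simp add: norm_mult norm_divide)
qed

lemma norm_Gamma_le_Gamma_Re:
  fixes w :: complex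
  assumes "Re w > 0"
  shows "norm (Gamma w) \<le> Gamma (Re w)"
proof (rule LIMSEQ_le)
  show "(\<lambda>n. norm (Gamma_series w n)) \<longlonglongrightarrow> norm (Gamma w)"
    by (intro tendsto_norm Gamma_series_LIMSEQ)
  show "Gamma_series (Re w) \<longlonglongrightarrow> Gamma (Re w)"
    by (rule Gamma_series_LIMSEQ)
  have "norm (Gamma_series w n) \<le> Gamma_series (Re w) n" for n
  proof -
    have p: "pochhammer (Re w) (n+1) > 0"
      using assms by (intro pochhammer_pos)
    have "pochhammer (Re w) (n+1) \<le> norm (pochhammer w (n+1))"
      unfolding pochhammer_prod prod_norm[symmetric]
    proof (intro prod_mono conjI)
      fix k
      show "0 \<le> Re w + real k" using assms by simp
      show "Re w + real k \<le> norm (w + of_nat k)"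
        using complex_Re_le_cmod[of "w + of_nat k"] by simp
    qed
    then show ?thesis
      unfolding norm_Gamma_series_complex using p
      by (auto simp: Gamma_series_def intro!: divide_left_mono mult_pos_pos)
  qed
  then show "\<exists>N. \<forall>n\<ge>N. norm (Gamma_series w n) \<le> Gamma_series (Re w) n" by blast
qed

text \<open>
  On a horizontal line \<open>\<bar>\<Gamma>(x + iy)\<bar> / \<Gamma>(x)\<close> is nondecreasing in \<open>x\<close>: by Gauss's limit formula it is a limit
  of products of the factors \<open>(x + k) / \<bar>x + k + iy\<bar>\<close>, each of which is nondecreasing. Quotients of Gamma functions with
  equal imaginary parts are thus bounded by their values on the real axis.
\<close>

lemma norm_Gamma_quotient_mono:
  fixes w :: complex
  assumes w: "Re w > 0" and r: "r \<ge> 0"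
  shows "norm (Gamma w) * Gamma (Re w + r) \<le> Gamma (Re w) * norm (Gamma (w + of_real r))"
proof (rule LIMSEQ_le)
  show "(\<lambda>n. norm (Gamma_series w n) * Gamma_series (Re w + r) n) \<longlonglongrightarrow>
          norm (Gamma w) * Gamma (Re w + r)"
    by (intro tendsto_intros Gamma_series_LIMSEQ)
  show "(\<lambda>n. Gamma_series (Re w) n * norm (Gamma_series (w + of_real r) n)) \<longlonglongrightarrow>
          Gamma (Re w) * norm (Gamma (w + of_real r))"
    by (intro tendsto_intros Gamma_series_LIMSEQ)
  have "norm (Gamma_series w n) * Gamma_series (Re w + r) n
      \<le> Gamma_series (Re w) n * norm (Gamma_series (w + of_real r) n)" for n
  proof -
    define A where "A = norm (pochhammer w (n+1)) * pochhammer (Re w + r) (n+1)"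
    define B where "B = pochhammer (Re w) (n+1) * norm (pochhammer (w + of_real r) (n+1))"
    have pos: "pochhammer (Re w) (n+1) > 0"
      using assms by (intro pochhammer_pos) auto
    have "w + of_real r \<noteq> - of_nat k" for k
      using w r by (auto simp: complex_eq_iff)
    then have "pochhammer (w + of_real r) (n+1) \<noteq> 0"
      by (auto simp: pochhammer_eq_0_iff)
    then have B: "B > 0" unfolding B_def using pos by simp
    have "B \<le> A"
      unfolding A_def B_def pochhammer_prod prod_norm[symmetric] prod.distrib[symmetric]
    proof (intro prod_mono conjI)
      fix k
      define p where "p = Re w + real k"
      define y where "y = Im w"
      have p: "p > 0" using w by (simp add: p_def)
      show "0 \<le> (Re w + real k) * norm (w + complex_of_real r + of_nat k)"
        using w by simp
      have n1: "norm (w + complex_of_real r + of_nat k) = sqrt ((p+r)^2 + y^2)"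
        by (simp add: cmod_def p_def y_def algebra_simps)
      have n2: "norm (w + of_nat k) = sqrt (p^2 + y^2)"
        by (simp add: cmod_def p_def y_def)
      have "p^2 \<le> (p+r)^2" using p r by (intro power_mono) auto
      then have "p^2 * ((p+r)^2 + y^2) \<le> (p^2 + y^2) * (p+r)^2"
        using mult_left_mono[of "p^2" "(p+r)^2" "y^2"] by (simp add: algebra_simps)
      then have "sqrt (p^2 * ((p+r)^2 + y^2)) \<le> sqrt ((p^2 + y^2) * (p+r)^2)"
        by (rule real_sqrt_le_mono)
      then have "p * sqrt ((p+r)^2 + y^2) \<le> sqrt (p^2 + y^2) * (p + r)"
        using p r by (simp add: real_sqrt_mult)
      then show "(Re w + real k) * norm (w + complex_of_real r + of_nat k)
          \<le> norm (w + of_nat k) * (Re w + r + real k)"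
        unfolding n1 n2 by (simp add: p_def algebra_simps)
    qed
    with B have "1 / A \<le> 1 / B" by (intro divide_left_mono) auto
    then have "(fact n * exp (Re w * ln (real n))) * (fact n * exp ((Re w + r) * ln (real n))) * (1 / A)
       \<le> (fact n * exp (Re w * ln (real n))) * (fact n * exp ((Re w + r) * ln (real n))) * (1 / B)"
      by (intro mult_left_mono) auto
    then show ?thesis
      unfolding norm_Gamma_series_complex
      by (simp add: Gamma_series_def A_def B_def)
  qed
  then show "\<exists>N. \<forall>n\<ge>N. norm (Gamma_series w n) * Gamma_series (Re w + r) n
      \<le> Gamma_series (Re w) n * norm (Gamma_series (w + of_real r) n)" by blast
qed

text \<open>
  Keep only the part \<open>t \<ge> A\<close> of the integral for \<open>\<Gamma>(x + 1)\<close>. Since \<open>A\<close> is free, \<open>\<Gamma>\<close> outgrows every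
  exponential.
\<close>

lemma Gamma_real_lower_bound:
  fixes x A :: real
  assumes "x > 0" "A > 0"
  shows "A powr x * exp (-A) \<le> x * Gamma x"
proof -
  have 1: "((\<lambda>t. t powr x / exp t) has_integral Gamma (x + 1)) {0..}"
    using Gamma_integral_real[of "x + 1"] assms by simp
  have "((\<lambda>t. exp (- 1 * t)) has_integral exp (- 1 * A) / 1) {A..}"
    by (rule has_integral_exp_minus_to_infinity) simp
  then have "((\<lambda>t. A powr x * exp (- t)) has_integral A powr x * exp (-A)) {A..}"
    by (intro has_integral_mult_right) simp
  then have 2: "((\<lambda>t. if t \<in> {A..} then A powr x * exp (- t) else 0) has_integral
      A powr x * exp (-A)) {0..}"
    using assms by (subst has_integral_restrict) auto
  have "A powr x * exp (-A) \<le> Gamma (x + 1)"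
  proof (rule has_integral_le[OF 2 1])
    fix t :: real
    assume t: "t \<in> {0..}"
    show "(if t \<in> {A..} then A powr x * exp (- t) else 0) \<le> t powr x / exp t"
      using assms by (auto simp: exp_minus divide_simps powr_mono2)
  qed
  moreover have "Gamma (x + 1) = x * Gamma x"
    using assms by (intro Gamma_plus1) (auto elim!: nonpos_Ints_cases)
  ultimately show ?thesis by simp
qed

lemma Gamma_real_bounded:
  assumes "m > (0::real)"
  obtains C where "C > 0" "\<And>x. m \<le> x \<Longrightarrow> x \<le> M \<Longrightarrow> Gamma x \<le> C"
proof -
  have "compact (Gamma ` {m..M})"
    using assms by (intro compact_continuous_image continuous_on_Gamma)
      (auto elim!: nonpos_Ints_cases)
  then have "bounded (Gamma ` {m..M})" by (rule compact_imp_bounded)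
  then obtain C where "C > 0" "\<And>y. y \<in> Gamma ` {m..M} \<Longrightarrow> norm y \<le> C"
    by (auto simp: bounded_pos)
  then show ?thesis by (intro that[of C]) (force simp: image_iff)+
qed

text \<open>
  The recursion \<open>\<Gamma>(u + k) = u (u + 1) \<dots> (u + k - 1) \<Gamma>(u)\<close> moves \<open>u\<close> into a fixed vertical strip. All
  factors have modulus at least \<open>\<bar>Im u\<bar> \<ge> 1\<close>, and at least two of them are present, whence the
  denominator.
\<close>

lemma norm_Gamma_shift:
  fixes u :: complex
  assumes "\<bar>Im u\<bar> \<ge> 1" "Re u \<le> X"
  obtains k :: nat where "Re u + real k \<ge> 1/2" "Re u + real k \<le> max (3/2) (X + 2)"
    "norm (Gamma u) \<le> norm (Gamma (u + of_nat k)) / (Im u)\<^sup>2"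
proof -
  define k where "k = max 2 (nat \<lceil>1/2 - Re u\<rceil>)"
  have k1: "Re u + real k \<ge> 1/2" unfolding k_def by linarith
  have k2: "Re u + real k \<le> max (3/2) (X + 2)"
    using assms unfolding k_def by linarith
  have "u \<notin> \<int>\<^sub>\<le>\<^sub>0" using assms by (auto elim!: nonpos_Ints_cases)
  then have G: "pochhammer u k * Gamma u = Gamma (u + of_nat k)"
    using pochhammer_Gamma[of u k] Gamma_nonzero[of u] by simp
  have ge: "norm (u + of_nat j) \<ge> \<bar>Im u\<bar>" for j
    using abs_Im_le_cmod[of "u + of_nat j"] by simp
  obtain l where l: "k = Suc (Suc l)"
    using k_def by (metis Suc_le_D max.cobounded1 numeral_2_eq_2 Suc_le_mono)
  have "(Im u)\<^sup>2 * 1 \<le> (norm (u + of_nat 0) * norm (u + of_nat 1)) * norm (pochhammer (u + 2) l)"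
  proof (intro mult_mono)
    show "(Im u)\<^sup>2 \<le> norm (u + of_nat 0) * norm (u + of_nat 1)"
      using mult_mono[OF ge[of 0] ge[of 1]] by (simp add: power2_eq_square)
    show "1 \<le> norm (pochhammer (u + 2) l)"
      unfolding pochhammer_prod prod_norm[symmetric]
    proof (rule prod_ge_1)
      fix i
      show "1 \<le> norm (u + 2 + of_nat i)"
        using ge[of "i+2"] assms by (simp add: algebra_simps)
    qed
  qed auto
  also have "\<dots> = norm (pochhammer u k)"
    by (simp add: l pochhammer_rec norm_mult mult.assoc add.assoc)
  finally have "(Im u)\<^sup>2 * norm (Gamma u) \<le> norm (pochhammer u k) * norm (Gamma u)"
    by (intro mult_right_mono) auto
  also have "\<dots> = norm (Gamma (u + of_nat k))" by (simp flip: G add: norm_mult)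
  finally have "norm (Gamma u) \<le> norm (Gamma (u + of_nat k)) / (Im u)\<^sup>2"
    using assms by (subst pos_le_divide_eq) (auto simp: mult.commute)
  with k1 k2 show ?thesis by (rule that)
qed

lemma norm_Gamma_decay:
  obtains C where "C > 0"
    "\<And>u. Re u \<le> X \<Longrightarrow> \<bar>Im u\<bar> \<ge> 1 \<Longrightarrow> norm (Gamma u) \<le> C / (Im u)\<^sup>2"
proof -
  obtain C where C: "C > 0" "\<And>x::real. 1/2 \<le> x \<Longrightarrow> x \<le> max (3/2) (X+2) \<Longrightarrow> Gamma x \<le> C"
    by (rule Gamma_real_bounded[of "1/2" "max (3/2) (X+2)"]) auto
  show ?thesis
  proof (rule that[OF C(1)])
    fix u :: complex
    assume u: "Re u \<le> X" "\<bar>Im u\<bar> \<ge> 1"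
    obtain k where k: "Re u + real k \<ge> 1/2" "Re u + real k \<le> max (3/2) (X + 2)"
      "norm (Gamma u) \<le> norm (Gamma (u + of_nat k)) / (Im u)\<^sup>2"
      using norm_Gamma_shift[OF u(2,1)] .
    have "norm (Gamma (u + of_nat k)) \<le> C"
      using norm_Gamma_le_Gamma_Re[of "u + of_nat k"] C(2)[OF k(1,2)] k(1) by simp
    then have "norm (Gamma (u + of_nat k)) / (Im u)\<^sup>2 \<le> C / (Im u)\<^sup>2"
      by (intro divide_right_mono) auto
    with k(3) show "norm (Gamma u) \<le> C / (Im u)\<^sup>2" by linarith
  qed
qed

text \<open>
  The shifted point \<open>u + k\<close> and the conjugate of \<open>d - u\<close> have the same imaginary part, and the
  hypothesis on \<open>d\<close> says that the former lies to the left of the latter. So their quotient is bounded by its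
  value on the real axis.
\<close>

lemma norm_Gamma_rGamma_decay:
  assumes d: "d \<ge> X + max (3/2) (X + 2)"
  obtains C where "C > 0"
    "\<And>u. Re u \<le> X \<Longrightarrow> \<bar>Im u\<bar> \<ge> 1 \<Longrightarrow>
       norm (Gamma u * rGamma (of_real d - u)) \<le> C / ((Im u)\<^sup>2 * Gamma (d - Re u))"
proof -
  obtain C where C: "C > 0" "\<And>x::real. 1/2 \<le> x \<Longrightarrow> x \<le> max (3/2) (X+2) \<Longrightarrow> Gamma x \<le> C"
    by (rule Gamma_real_bounded[of "1/2" "max (3/2) (X+2)"]) auto
  show ?thesis
  proof (rule that[OF C(1)])
    fix u :: complex
    assume u: "Re u \<le> X" "\<bar>Im u\<bar> \<ge> 1"
    obtain k where k: "Re u + real k \<ge> 1/2" "Re u + real k \<le> max (3/2) (X + 2)"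
      "norm (Gamma u) \<le> norm (Gamma (u + of_nat k)) / (Im u)\<^sup>2"
      using norm_Gamma_shift[OF u(2,1)] .
    define w where "w = u + of_nat k"
    define r where "r = d - Re u - Re w"
    have r: "r \<ge> 0" using d u k by (simp add: r_def w_def)
    have w: "Re w > 0" "Gamma (Re w) \<le> C" using k C(2)[of "Re w"] by (auto simp: w_def)
    have dp: "Gamma (d - Re u) > 0" using r w by (intro Gamma_real_pos) (simp add: r_def)
    have wr: "w + of_real r = cnj (of_real d - u)"
      by (simp add: complex_eq_iff w_def r_def)
    have "norm (Gamma w) * Gamma (Re w + r) \<le> Gamma (Re w) * norm (Gamma (w + of_real r))"
      using w r by (intro norm_Gamma_quotient_mono)
    also have "norm (Gamma (w + of_real r)) = norm (Gamma (of_real d - u))"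
      unfolding wr cnj_Gamma[symmetric] by (rule complex_mod_cnj)
    also have "Re w + r = d - Re u" by (simp add: r_def)
    also have "Gamma (Re w) * norm (Gamma (of_real d - u)) \<le> C * norm (Gamma (of_real d - u))"
      using w by (intro mult_right_mono) auto
    finally have 1: "norm (Gamma w) * Gamma (d - Re u) \<le> C * norm (Gamma (of_real d - u))" .
    have nz: "Gamma (of_real d - u) \<noteq> 0"
      using u by (intro Gamma_nonzero) (auto elim!: nonpos_Ints_cases simp: complex_eq_iff)
    have "norm (Gamma w) / norm (Gamma (of_real d - u)) \<le> C / Gamma (d - Re u)"
      using 1 dp nz by (simp add: field_simps)
    then have 2: "norm (Gamma w) / norm (Gamma (of_real d - u)) / (Im u)\<^sup>2 \<le> C / Gamma (d - Re u) / (Im u)\<^sup>2"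
      by (intro divide_right_mono) auto
    have "norm (Gamma u * rGamma (of_real d - u)) = norm (Gamma u) / norm (Gamma (of_real d - u))"
      by (simp add: rGamma_inverse_Gamma norm_mult norm_inverse divide_inverse)
    also have "\<dots> \<le> norm (Gamma w) / (Im u)\<^sup>2 / norm (Gamma (of_real d - u))"
      using k(3) unfolding w_def by (intro divide_right_mono) auto
    also have "\<dots> = norm (Gamma w) / norm (Gamma (of_real d - u)) / (Im u)\<^sup>2" by simp
    also note 2
    finally show "norm (Gamma u * rGamma (of_real d - u)) \<le> C / ((Im u)\<^sup>2 * Gamma (d - Re u))"
      by (simp add: mult.commute)
  qed
qed

text \<open>
  This makes the integrands decay at the left end of the loop, with a weight that is convenient for
  the estimates over rectangles.
\<close>

lemma powr_over_Gamma_decay: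
  fixes z d X :: real
  assumes z: "z > 0" and d: "d - X > 0"
  obtains C where "C > 0" "\<And>x. x \<le> X \<Longrightarrow> z powr (-x) / Gamma (d - x) \<le> C / (1 + x\<^sup>2)"
proof -
  define F where "F = (\<lambda>x::real. (1 + x\<^sup>2) * (d - x) * exp x)"
  have "(F \<longlongrightarrow> 0) at_bot" unfolding F_def by real_asymp
  then have "eventually (\<lambda>x. F x < 1) at_bot" by (rule order_tendstoD) simp
  then obtain N where N: "\<And>x. x \<le> N \<Longrightarrow> F x < 1" by (auto simp: eventually_at_bot_linorder)
  have "compact (F ` {N..X})"
    unfolding F_def by (intro compact_continuous_image continuous_intros) auto
  then obtain B where B: "\<And>x. N \<le> x \<Longrightarrow> x \<le> X \<Longrightarrow> F x \<le> B" "B > 0"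
    using compact_imp_bounded[of "F ` {N..X}"] by (force simp: bounded_pos)
  have F: "F x \<le> 1 + B" if "x \<le> X" for x
    using N[of x] B(1)[of x] B(2) that by (cases "x \<le> N") auto
  \<comment> \<open>With this choice the powers of \<open>z\<close> cancel and a factor \<open>e\<^sup>x\<close> remains.\<close>
  define A where "A = z * exp 1"
  define K where "K = exp A * A powr (-d)"
  have A: "A > 0" and K: "K > 0" using z by (auto simp: A_def K_def)
  show ?thesis
  proof (rule that[of "K * (1 + B)"])
    show "K * (1 + B) > 0" using K B by simp
    fix x :: real
    assume x: "x \<le> X"
    have s: "d - x > 0" using x d by simp
    then have G: "Gamma (d - x) > 0" by simp
    have "A powr (d - x) * exp (-A) \<le> (d - x) * Gamma (d - x)"
      using s A by (rule Gamma_real_lower_bound)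
    then have "1 \<le> (d - x) * Gamma (d - x) * (A powr (x - d) * exp A)"
      using A by (simp add: powr_diff exp_minus field_simps)
    then have "1 / Gamma (d - x) \<le> (d - x) * (A powr (x - d) * exp A)"
      using G by (simp add: field_simps)
    then have "z powr (-x) * (1 / Gamma (d - x)) \<le> z powr (-x) * ((d - x) * (A powr (x - d) * exp A))"
      by (intro mult_left_mono) auto
    also have "A powr (x - d) = A powr (-d) * (z powr x * exp x)"
    proof -
      have "exp 1 powr x = exp x" for x :: real by (simp add: powr_def)
      then show ?thesis
        using z by (simp add: A_def powr_diff powr_minus powr_mult field_simps)
    qed
    also have "z powr (-x) * ((d - x) * (A powr (-d) * (z powr x * exp x) * exp A)) = K * ((d - x) * exp x)"
      using z by (simp add: K_def powr_minus)
    also have "(d - x) * exp x = F x / (1 + x\<^sup>2)"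
      unfolding F_def by (simp add: field_simps add_nonneg_eq_0_iff)
    also have "K * (F x / (1 + x\<^sup>2)) \<le> K * ((1 + B) / (1 + x\<^sup>2))"
      using K F[OF x] by (intro mult_left_mono divide_right_mono) auto
    finally show "z powr (-x) / Gamma (d - x) \<le> K * (1 + B) / (1 + x\<^sup>2)" by simp
  qed
qed

text \<open>
  Compare \<open>\<Gamma>(x + iy)\<close> with \<open>\<Gamma>(1 + iy)\<close>, which is bounded away from \<open>0\<close> for \<open>\<bar>y\<bar> \<le> 1\<close>.
\<close>

lemma norm_rGamma_strip:
  obtains C where "C > 0"
    "\<And>z. Re z \<ge> 1 \<Longrightarrow> \<bar>Im z\<bar> \<le> 1 \<Longrightarrow> norm (rGamma z) \<le> C / Gamma (Re z)"
proof -
  have "compact ((\<lambda>y. rGamma (Complex 1 y)) ` {-1..1})"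
    by (intro compact_continuous_image continuous_on_compose2[OF continuous_on_rGamma[of UNIV]])
      (auto simp: Complex_eq intro!: continuous_intros)
  then obtain C where C: "\<And>y. \<bar>y\<bar> \<le> 1 \<Longrightarrow> norm (rGamma (Complex 1 y)) \<le> C" "C > 0"
    using compact_imp_bounded[of "(\<lambda>y. rGamma (Complex 1 y)) ` {-1..1}"]
    by (force simp: bounded_pos)
  show ?thesis
  proof (rule that[OF C(2)])
    fix z :: complex
    assume z: "Re z \<ge> 1" "\<bar>Im z\<bar> \<le> 1"
    define w where "w = Complex 1 (Im z)"
    have wz: "w + of_real (Re z - 1) = z" by (simp add: w_def complex_eq_iff)
    have nz: "Gamma z \<noteq> 0" "Gamma w \<noteq> 0"
      using z by (auto simp: Gamma_eq_zero_iff w_def dest!: arg_cong[of _ _ Re] elim!: nonpos_Ints_cases)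
    have "norm (Gamma w) * Gamma (Re w + (Re z - 1)) \<le> Gamma (Re w) * norm (Gamma (w + of_real (Re z - 1)))"
      using z by (intro norm_Gamma_quotient_mono) (auto simp: w_def)
    then have "norm (Gamma w) * Gamma (Re z) \<le> norm (Gamma z)"
      unfolding wz by (simp add: w_def)
    then have "norm (rGamma z) \<le> norm (rGamma w) / Gamma (Re z)"
      using nz z unfolding rGamma_inverse_Gamma norm_inverse
      by (simp add: field_simps del: norm_inverse)
    also have "\<dots> \<le> C / Gamma (Re z)"
      using C(1)[of "Im z"] z by (intro divide_right_mono) (auto simp: w_def)
    finally show "norm (rGamma z) \<le> C / Gamma (Re z)" .
  qed
qed

section \<open>Loop integrals as integrals over vertical lines\<close>

text \<open>
  The residue theorem with the four sides kept apart, so that rectangles can be glued along sides.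
\<close>

lemma rectangle_residues:
  assumes "open S" "convex S" and sub: "cbox p q \<subseteq> S"
    and less: "Re p < Re q" "Im p < Im q"
    and P: "finite P" "P \<subseteq> box p q"
    and hol: "f holomorphic_on S - P"
  shows "contour_integral (linepath p (Complex (Re q) (Im p))) f
       + contour_integral (linepath (Complex (Re q) (Im p)) q) f
       + contour_integral (linepath q (Complex (Re p) (Im q))) f
       + contour_integral (linepath (Complex (Re p) (Im q)) p) f
       = 2 * of_real pi * \<i> * (\<Sum>z\<in>P. residue f z)"
proof -
  define a2 where "a2 = Complex (Re q) (Im p)"
  define a4 where "a4 = Complex (Re p) (Im q)"
  have im: "path_image (rectpath p q) \<subseteq> S - P"
    using sub P path_image_rectpath_cbox_minus_box[of p q] less by auto
  have "path_image (rectpath p q) = closed_segment p a2 \<union> closed_segment a2 q \<union>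
                  closed_segment q a4 \<union> closed_segment a4 p"
    by (simp add: rectpath_def Let_def path_image_join a2_def a4_def Un_assoc)
  with im have segs: "closed_segment p a2 \<subseteq> S - P" "closed_segment a2 q \<subseteq> S - P"
    "closed_segment q a4 \<subseteq> S - P" "closed_segment a4 p \<subseteq> S - P" by auto
  have con: "f contour_integrable_on linepath x y" if "closed_segment x y \<subseteq> S - P" for x y
    using that hol
    by (intro contour_integrable_continuous_linepath)
       (meson continuous_on_subset holomorphic_on_imp_continuous_on)
  have "contour_integral (rectpath p q) f =
     contour_integral (linepath p a2) f + contour_integral (linepath a2 q) f
     + contour_integral (linepath q a4) f + contour_integral (linepath a4 p) f"
    using segs[THEN con]
    by (simp add: rectpath_def Let_def flip: a2_def a4_def)
  moreover have "contour_integral (rectpath p q) f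
      = 2 * pi * \<i> * (\<Sum>z\<in>P. winding_number (rectpath p q) z * residue f z)"
  proof (rule Residue_theorem[OF assms(1) _ P(1) hol _ _ im])
    show "connected S" using \<open>convex S\<close> by (rule convex_connected)
    show "\<forall>z. z \<notin> S \<longrightarrow> winding_number (rectpath p q) z = 0"
      using sub less by (auto intro!: winding_number_rectpath_outside)
  qed auto
  moreover have "(\<Sum>z\<in>P. winding_number (rectpath p q) z * residue f z) = (\<Sum>z\<in>P. residue f z)"
    using P(2) by (intro sum.cong refl) (auto simp: winding_number_rectpath)
  ultimately show ?thesis by (simp add: a2_def a4_def)
qed

lemma contour_integral_loop_path:
  assumes cont: "continuous_on {z. Im z \<noteq> 0 \<or> Re z = 1 + \<bar>c\<bar>} f"
  shows "contour_integral (loop_path c T) f =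
      contour_integral (linepath (Complex (-T) (-1)) (Complex (1 + \<bar>c\<bar>) (-1))) f
    + contour_integral (linepath (Complex (1 + \<bar>c\<bar>) (-1)) (Complex (1 + \<bar>c\<bar>) 1)) f
    + contour_integral (linepath (Complex (1 + \<bar>c\<bar>) 1) (Complex (-T) 1)) f"
proof -
  have [simp]: "f contour_integrable_on linepath x y"
    if "(Im x = Im y \<and> Im x \<noteq> 0) \<or> (Re x = Re y \<and> Re x = 1 + \<bar>c\<bar>)" for x y
    using that
    by (intro contour_integrable_continuous_linepath continuous_on_subset[OF cont])
       (auto simp: closed_segment_same_Im closed_segment_same_Re)
  show ?thesis
    by (simp add: loop_path_def contour_integrable_joinI add.assoc)
qed

lemma integrable_inverse_quadratic_bound:
  fixes g :: "real \<Rightarrow> complex"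
  assumes cont: "continuous_on UNIV g" and bound: "\<And>y. \<bar>y\<bar> \<ge> 1 \<Longrightarrow> norm (g y) \<le> C / y\<^sup>2"
  shows "integrable lborel g"
proof -
  have "bounded (g ` {-1..1})"
    by (intro compact_imp_bounded compact_continuous_image continuous_on_subset[OF cont]) auto
  then obtain B where B: "B > 0" "\<And>y. \<bar>y\<bar> \<le> 1 \<Longrightarrow> norm (g y) \<le> B"
    by (force simp: bounded_pos)
  define K where "K = max (2 * B) (2 * C)"
  have le: "norm (g y) \<le> norm (K * inverse (1 + y\<^sup>2))" for y
  proof (cases "\<bar>y\<bar> \<le> 1")
    case True
    then have y: "y\<^sup>2 \<le> 1" by (simp add: abs_square_le_1)
    have "norm (g y) \<le> 2 * B / 2" using B(2)[OF True] by simp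
    also have "\<dots> \<le> 2 * B / (1 + y\<^sup>2)"
      using y B(1) by (intro divide_left_mono mult_pos_pos add_pos_nonneg) auto
    also have "\<dots> \<le> K / (1 + y\<^sup>2)"
      by (intro divide_right_mono) (auto simp: K_def)
    also have "\<dots> \<le> norm (K * inverse (1 + y\<^sup>2))" by (simp add: divide_inverse)
    finally show ?thesis .
  next
    case False
    then have y: "1 \<le> y\<^sup>2" using abs_square_le_1[of y] by linarith
    have b: "norm (g y) \<le> C / y\<^sup>2" using False by (intro bound) auto
    have "0 \<le> C / y\<^sup>2" using b norm_ge_zero order_trans by blast
    moreover have "y\<^sup>2 > 0" using y by linarith
    ultimately have C: "C \<ge> 0" by (simp add: zero_le_divide_iff del: zero_less_power2)
    have "C / y\<^sup>2 = 2 * C / (2 * y\<^sup>2)" by simp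
    also have "\<dots> \<le> 2 * C / (1 + y\<^sup>2)"
      using y C by (intro divide_left_mono mult_pos_pos add_pos_nonneg) auto
    also have "\<dots> \<le> K / (1 + y\<^sup>2)"
      by (intro divide_right_mono) (auto simp: K_def)
    also have "\<dots> \<le> norm (K * inverse (1 + y\<^sup>2))" by (simp add: divide_inverse)
    finally show ?thesis using b by linarith
  qed
  have "integrable lborel (\<lambda>y::real. inverse (1 + y\<^sup>2))"
    using integrable_inverse_1_plus_square by (simp add: set_integrable_def)
  then have "integrable lborel (\<lambda>y::real. K * inverse (1 + y\<^sup>2))" by simp
  then show ?thesis
    by (rule Bochner_Integration.integrable_bound)
       (use le cont in \<open>auto intro!: borel_measurable_continuous_onI\<close>)
qed

lemma contour_integral_same_Re:
  assumes "S < T" and cont: "continuous_on {S..T} (\<lambda>y. f (Complex s y))"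
  shows "contour_integral (linepath (Complex s S) (Complex s T)) f
           = \<i> * (LBINT y:{S..T}. f (Complex s y))"
proof -
  have "set_integrable lborel {S..T} (\<lambda>y. f (Complex s y))"
    using cont by (rule borel_integrable_atLeastAtMost')
  then have "((\<lambda>y. f (Complex s y)) has_integral (LBINT y:{S..T}. f (Complex s y))) {S..T}"
    using set_borel_integral_eq_integral[of "{S..T}" "\<lambda>y. f (Complex s y)"]
    by (simp add: has_integral_integrable_integral)
  then have "(f has_contour_integral \<i> * (LBINT y:{S..T}. f (Complex s y)))
      (linepath (Complex s S) (Complex s T))"
    using assms
    by (subst has_contour_integral_linepath_same_Re_iff[where c = s and a = S and b = T])
       (simp_all add: mult.assoc[symmetric])
  then show ?thesis by (rule contour_integral_unique)
qed

lemma tendsto_LBINT_symmetric_interval: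
  fixes g :: "real \<Rightarrow> complex"
  assumes "integrable lborel g"
  shows "((\<lambda>T. LBINT y:{-T..T}. g y) \<longlongrightarrow> (LBINT y. g y)) at_top"
  unfolding set_lebesgue_integral_def
proof (rule integral_dominated_convergence_at_top)
  show "integrable lborel (\<lambda>y. norm (g y))" using assms by simp
  show "AE y in lborel. ((\<lambda>T. indicat_real {-T..T} y *\<^sub>R g y) \<longlongrightarrow> g y) at_top"
  proof (rule AE_I2)
    fix y :: real
    have "eventually (\<lambda>T. indicat_real {-T..T} y *\<^sub>R g y = g y) at_top"
      using eventually_ge_at_top[of "\<bar>y\<bar>"] by eventually_elim (auto simp: indicator_def)
    then show "((\<lambda>T. indicat_real {-T..T} y *\<^sub>R g y) \<longlongrightarrow> g y) at_top"
      by (rule tendsto_eventually)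
  qed
qed (use assms in \<open>auto intro!: always_eventually simp: indicator_def\<close>)

text \<open>
  The loop, cut off at \<open>Re u = -T\<close>, and the segment of the line \<open>Re u = s\<close> with \<open>\<bar>Im u\<bar> \<le> T\<close> differ by three
  rectangles. The middle one, \<open>[s, 1 + \<bar>c\<bar>] \<times> [-1, 1]\<close>, contributes the residues in \<open>P\<close>. The other two,
  \<open>[-T, s] \<times> [1, T]\<close> and its mirror image, contain no pole. Their outer sides have length of order \<open>T\<close> and
  carry an integrand of order \<open>1 / T\<^sup>2\<close>, so they disappear in the limit.
\<close>

lemma loop_integral_eq_vertical_integral:
  fixes f :: "complex \<Rightarrow> complex"
  assumes s: "s0 < s" "s < 1 + \<bar>c\<bar>"
    and P: "finite P" "P \<subseteq> of_real ` {s<..<1 + \<bar>c\<bar>}"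
    and hol: "f holomorphic_on {z. Im z \<noteq> 0 \<or> Re z > s0} - P"
    and decay: "\<And>u. Re u \<le> s \<Longrightarrow> \<bar>Im u\<bar> \<ge> 1 \<Longrightarrow>
                  norm (f u) \<le> C / ((1 + (Re u)\<^sup>2) * (Im u)\<^sup>2)"
  shows "integrable lborel (\<lambda>y. f (Complex s y))" (is ?thesis1)
    and "loop_integral c f =
           2 * of_real pi * \<i> * (\<Sum>p\<in>P. residue f p) + \<i> * (LBINT y. f (Complex s y))"
      (is ?thesis2)
proof -
  define X where "X = 1 + \<bar>c\<bar>"
  define L where "L = (\<lambda>p q. contour_integral (linepath p q) f)"
  define D where "D = {z. Im z \<noteq> 0 \<or> Re z > s0} - P"
  have PIm: "Im p = 0" "s < Re p" "Re p < X" if "p \<in> P" for p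
    using P that by (auto simp: X_def)
  have cont: "continuous_on D f"
    using hol unfolding D_def by (rule holomorphic_on_imp_continuous_on)
  have C: "C \<ge> 0"
  proof -
    have "norm (f (Complex s 1)) \<le> C / (1 + s\<^sup>2)"
      using decay[of "Complex s 1"] by simp
    then have "0 \<le> C / (1 + s\<^sup>2)" using norm_ge_zero order_trans by blast
    moreover have "0 < 1 + s\<^sup>2" by (simp add: add_pos_nonneg)
    ultimately show ?thesis by (simp add: zero_le_divide_iff)
  qed
  have D_Im: "u \<in> D" if "Im u \<noteq> 0" for u
    using that by (auto simp: D_def dest: PIm(1))
  have D_left: "u \<in> D" if "s0 < Re u" "Re u \<le> s" for u
    using that by (auto simp: D_def dest: PIm(2))
  have D_right: "u \<in> D" if "Re u = X" for u
    using that s by (auto simp: D_def X_def dest: PIm(3))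
  have line_D: "Complex s y \<in> D" for y using s by (intro D_left) auto
  have line_cont: "continuous_on A (\<lambda>y. f (Complex s y))" for A
    by (rule continuous_on_compose2[OF cont])
       (use line_D in \<open>auto simp: Complex_eq intro!: continuous_intros\<close>)
  show ?thesis1
  proof (rule integrable_inverse_quadratic_bound[OF line_cont])
    fix y :: real
    assume y: "\<bar>y\<bar> \<ge> 1"
    have "norm (f (Complex s y)) \<le> C / ((1 + s\<^sup>2) * y\<^sup>2)" using decay[of "Complex s y"] y by simp
    also have "\<dots> \<le> C / (1 * y\<^sup>2)"
      using C y by (intro divide_left_mono mult_right_mono) (auto intro!: mult_pos_pos add_pos_nonneg)
    finally show "norm (f (Complex s y)) \<le> C / y\<^sup>2" by simp
  qed
  note int = this

  define E where "E = (\<lambda>T. L (Complex s T) (Complex (-T) T) + L (Complex (-T) T) (Complex (-T) 1)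
     + L (Complex (-T) (-T)) (Complex s (-T)) + L (Complex (-T) (-1)) (Complex (-T) (-T)))"
  have rev: "L p q = - L q p" if "closed_segment p q \<subseteq> D" for p q
    unfolding L_def using that
    by (intro contour_integral_reverse_linepath continuous_on_subset[OF cont])
  have split: "L p q = L p r + L r q" if "closed_segment p q \<subseteq> D" "r \<in> closed_segment p q" for p q r
    unfolding L_def using that
    by (intro contour_integral_split_linepath continuous_on_subset[OF cont])
  have segIm: "closed_segment p q \<subseteq> D" if "Im p = Im q" "Im p \<noteq> 0" for p q
    using that by (auto simp: closed_segment_same_Im intro!: D_Im)
  have segRe: "closed_segment p q \<subseteq> D" if "Re p = s" "Re q = s" for p q
    using that s by (auto simp: closed_segment_same_Re intro!: D_left)
  have mid: "L (Complex s (-1)) (Complex X (-1)) + L (Complex X (-1)) (Complex X 1)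
     + L (Complex X 1) (Complex s 1) + L (Complex s 1) (Complex s (-1))
     = 2 * of_real pi * \<i> * (\<Sum>p\<in>P. residue f p)"
    unfolding L_def
  proof (rule rectangle_residues[of "{z. Re z > s0}" "Complex s (-1)" "Complex X 1" P f, simplified complex.sel])
    show "f holomorphic_on {z. s0 < Re z} - P" by (rule holomorphic_on_subset[OF hol]) auto
  qed (use s P(1) PIm in \<open>auto simp: X_def subset_iff open_halfspace_Re_gt convex_halfspace_Re_gt in_cbox_complex_iff
        in_box_complex_iff\<close>)
  then have mid': "L (Complex s (-1)) (Complex X (-1)) + L (Complex X (-1)) (Complex X 1)
     + L (Complex X 1) (Complex s 1)
     = 2 * of_real pi * \<i> * (\<Sum>p\<in>P. residue f p) - L (Complex s 1) (Complex s (-1))"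
    by (simp add: eq_diff_eq)
  have main: "contour_integral (loop_path c T) f
      = 2 * of_real pi * \<i> * (\<Sum>p\<in>P. residue f p) + \<i> * (LBINT y:{-T..T}. f (Complex s y)) + E T"
    if T: "T > 1" "T > -s" for T
  proof -
    have up: "L (Complex (-T) 1) (Complex s 1) + L (Complex s 1) (Complex s T)
        + L (Complex s T) (Complex (-T) T) + L (Complex (-T) T) (Complex (-T) 1) = 0"
      unfolding L_def
    proof (rule rectangle_residues[of "{z. Im z > 0}" "Complex (-T) 1" "Complex s T" "{}" f, simplified complex.sel sum.empty mult_zero_right])
      show "f holomorphic_on {z. 0 < Im z} - {}" by (rule holomorphic_on_subset[OF hol]) (auto dest: PIm(1))
    qed (use T in \<open>auto simp: open_halfspace_Im_gt convex_halfspace_Im_gt in_cbox_complex_iff\<close>)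
    then have up': "- L (Complex (-T) 1) (Complex s 1) = L (Complex s 1) (Complex s T)
        + L (Complex s T) (Complex (-T) T) + L (Complex (-T) T) (Complex (-T) 1)"
      by (simp add: neg_eq_iff_add_eq_0 add.assoc)
    have down: "L (Complex (-T) (-T)) (Complex s (-T)) + L (Complex s (-T)) (Complex s (-1))
        + L (Complex s (-1)) (Complex (-T) (-1)) + L (Complex (-T) (-1)) (Complex (-T) (-T)) = 0"
      unfolding L_def
    proof (rule rectangle_residues[of "{z. Im z < 0}" "Complex (-T) (-T)" "Complex s (-1)" "{}" f, simplified complex.sel sum.empty mult_zero_right])
      show "f holomorphic_on {z. Im z < 0} - {}" by (rule holomorphic_on_subset[OF hol]) (auto dest: PIm(1))
    qed (use T in \<open>auto simp: open_halfspace_Im_lt convex_halfspace_Im_lt in_cbox_complex_iff\<close>)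
    then have down': "- L (Complex s (-1)) (Complex (-T) (-1)) = L (Complex (-T) (-T)) (Complex s (-T))
       + L (Complex s (-T)) (Complex s (-1)) + L (Complex (-T) (-1)) (Complex (-T) (-T))"
      by (simp add: neg_eq_iff_add_eq_0 add.assoc add.left_commute)
    have "contour_integral (loop_path c T) f = L (Complex (-T) (-1)) (Complex X (-1))
       + L (Complex X (-1)) (Complex X 1) + L (Complex X 1) (Complex (-T) 1)"
      unfolding L_def X_def
      by (rule contour_integral_loop_path, rule continuous_on_subset[OF cont])
         (use D_Im D_right in \<open>auto simp: X_def\<close>)
    also have "L (Complex (-T) (-1)) (Complex X (-1))
        = L (Complex (-T) (-1)) (Complex s (-1)) + L (Complex s (-1)) (Complex X (-1))"
      by (rule split[OF segIm]) (use T s in \<open>auto simp: closed_segment_same_Im closed_segment_eq_real_ivl X_def\<close>)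
    also have "L (Complex X 1) (Complex (-T) 1)
        = L (Complex X 1) (Complex s 1) + L (Complex s 1) (Complex (-T) 1)"
      by (rule split[OF segIm]) (use T s in \<open>auto simp: closed_segment_same_Im closed_segment_eq_real_ivl X_def\<close>)
    also have "L (Complex s 1) (Complex (-T) 1) = - L (Complex (-T) 1) (Complex s 1)"
      by (rule rev[OF segIm]) auto
    also have "L (Complex (-T) (-1)) (Complex s (-1)) = - L (Complex s (-1)) (Complex (-T) (-1))"
      by (rule rev[OF segIm]) auto
    finally have "contour_integral (loop_path c T) f
       = (L (Complex s (-1)) (Complex X (-1)) + L (Complex X (-1)) (Complex X 1)
     + L (Complex X 1) (Complex s 1)) + (- L (Complex s (-1)) (Complex (-T) (-1))) + (- L (Complex (-T) 1) (Complex s 1))"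
      by (simp add: add_ac)
    then have 1: "contour_integral (loop_path c T) f = 2 * of_real pi * \<i> * (\<Sum>p\<in>P. residue f p)
        + (- L (Complex s 1) (Complex s (-1)) + L (Complex s (-T)) (Complex s (-1))
           + L (Complex s 1) (Complex s T)) + E T"
      unfolding up' down' mid' E_def by (simp add: add_ac)
    have "L (Complex s (-T)) (Complex s T)
       = L (Complex s (-T)) (Complex s (-1)) + L (Complex s (-1)) (Complex s T)"
      by (rule split[OF segRe]) (use T in \<open>auto simp: closed_segment_same_Re closed_segment_eq_real_ivl\<close>)
    also have "L (Complex s (-1)) (Complex s T) = L (Complex s (-1)) (Complex s 1) + L (Complex s 1) (Complex s T)"
      by (rule split[OF segRe]) (use T in \<open>auto simp: closed_segment_same_Re closed_segment_eq_real_ivl\<close>)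
    also have "L (Complex s (-1)) (Complex s 1) = - L (Complex s 1) (Complex s (-1))"
      by (rule rev[OF segRe]) auto
    finally have 2: "- L (Complex s 1) (Complex s (-1)) + L (Complex s (-T)) (Complex s (-1))
           + L (Complex s 1) (Complex s T) = L (Complex s (-T)) (Complex s T)" by simp
    have "L (Complex s (-T)) (Complex s T) = \<i> * (LBINT y:{-T..T}. f (Complex s y))"
      unfolding L_def using T by (intro contour_integral_same_Re line_cont) auto
    with 1 2 show ?thesis by simp
  qed
  have segbound: "norm (L p q) \<le> B * norm (q - p)"
    if "closed_segment p q \<subseteq> D" "B \<ge> 0" "\<And>u. u \<in> closed_segment p q \<Longrightarrow> norm (f u) \<le> B" for p q B
    unfolding L_def using that
    by (intro contour_integral_bound_linepath contour_integrable_continuous_linepath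
        continuous_on_subset[OF cont]) auto
  have hor: "norm (L p q) \<le> C / T\<^sup>2 * (s + T)"
    if "T > 1" "T > - s" "Im p = Im q" "\<bar>Im p\<bar> = T"
      "(Re p = s \<and> Re q = -T) \<or> (Re p = -T \<and> Re q = s)" for p q T
  proof -
    have "norm (L p q) \<le> C / T\<^sup>2 * norm (q - p)"
    proof (rule segbound)
      show "closed_segment p q \<subseteq> D" using that by (intro segIm) auto
      show "C / T\<^sup>2 \<ge> 0" using C by simp
      fix u
      assume u: "u \<in> closed_segment p q"
      then have u': "Im u = Im p" "Re u \<le> s"
        using that by (auto simp: closed_segment_same_Im closed_segment_eq_real_ivl split: if_splits)
      have "norm (f u) \<le> C / ((1 + (Re u)\<^sup>2) * (Im u)\<^sup>2)"
        using that u' by (intro decay) auto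
      also have "\<dots> \<le> C / (1 * (Im u)\<^sup>2)"
        using C that u' by (intro divide_left_mono mult_right_mono) (auto intro!: mult_pos_pos add_pos_nonneg)
      also have "(Im u)\<^sup>2 = T\<^sup>2" using that u' by (metis power2_abs)
      finally show "norm (f u) \<le> C / T\<^sup>2" by simp
    qed
    also have "norm (q - p) = s + T"
      using that by (auto simp: cmod_def)
    finally show ?thesis .
  qed
  have ver: "norm (L p q) \<le> C / (1 + T\<^sup>2) * (T - 1)"
    if "T > 1" "T > - s" "Re p = -T" "Re q = -T"
      "(Im p = T \<and> Im q = 1) \<or> (Im p = -1 \<and> Im q = -T)" for p q T
  proof -
    have u': "Re u = -T" "\<bar>Im u\<bar> \<ge> 1" if "u \<in> closed_segment p q" for u
      using that \<open>Re p = -T\<close> \<open>Re q = -T\<close> \<open>(Im p = T \<and> Im q = 1) \<or> (Im p = -1 \<and> Im q = -T)\<close> \<open>T > 1\<close>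
      by (auto simp: closed_segment_same_Re closed_segment_eq_real_ivl split: if_splits)
    have "norm (L p q) \<le> C / (1 + T\<^sup>2) * norm (q - p)"
    proof (rule segbound)
      show "closed_segment p q \<subseteq> D" using u'(2) by (force intro!: D_Im)
      show "C / (1 + T\<^sup>2) \<ge> 0" using C by simp
      fix u
      assume u: "u \<in> closed_segment p q"
      have "norm (f u) \<le> C / ((1 + (Re u)\<^sup>2) * (Im u)\<^sup>2)"
        using that u'[OF u] by (intro decay) auto
      also have "\<dots> \<le> C / ((1 + (Re u)\<^sup>2) * 1)"
      proof (intro divide_left_mono mult_left_mono)
        show "1 \<le> (Im u)\<^sup>2" using u'(2)[OF u] by (metis one_le_power power2_abs)
        then show "0 < (1 + (Re u)\<^sup>2) * (Im u)\<^sup>2 * ((1 + (Re u)\<^sup>2) * 1)"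
          by (intro mult_pos_pos add_pos_nonneg) auto
      qed (use C in auto)
      finally show "norm (f u) \<le> C / (1 + T\<^sup>2)" using u'(1)[OF u] by simp
    qed
    also have "norm (q - p) = T - 1"
      using that by (auto simp: cmod_def)
    finally show ?thesis .
  qed
  have Ebound: "norm (E T) \<le> 2 * (C / T\<^sup>2 * (s + T)) + 2 * (C / (1 + T\<^sup>2) * (T - 1))"
    if T: "T > 1" "T > - s" for T
  proof -
    have tri: "norm (w + x + y + z) \<le> norm w + norm x + norm y + norm z" for w x y z :: complex
      using norm_triangle_ineq[of "w + x + y" z] norm_triangle_ineq[of "w + x" y] norm_triangle_ineq[of w x]
      by linarith
    have "norm (L (Complex s T) (Complex (-T) T)) \<le> C / T\<^sup>2 * (s + T)"
      by (rule hor) (use T in auto)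
    moreover have "norm (L (Complex (-T) T) (Complex (-T) 1)) \<le> C / (1 + T\<^sup>2) * (T - 1)"
      by (rule ver) (use T in auto)
    moreover have "norm (L (Complex (-T) (-T)) (Complex s (-T))) \<le> C / T\<^sup>2 * (s + T)"
      by (rule hor) (use T in auto)
    moreover have "norm (L (Complex (-T) (-1)) (Complex (-T) (-T))) \<le> C / (1 + T\<^sup>2) * (T - 1)"
      by (rule ver) (use T in auto)
    moreover note tri[of "L (Complex s T) (Complex (-T) T)" "L (Complex (-T) T) (Complex (-T) 1)"
      "L (Complex (-T) (-T)) (Complex s (-T))" "L (Complex (-T) (-1)) (Complex (-T) (-T))"]
    ultimately show ?thesis unfolding E_def by linarith
  qed
  have "eventually (\<lambda>T. norm (E T) \<le> 2 * (C / T\<^sup>2 * (s + T)) + 2 * (C / (1 + T\<^sup>2) * (T - 1))) at_top"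
    using eventually_gt_at_top[of 1] eventually_gt_at_top[of "-s"] by eventually_elim (rule Ebound)
  moreover have "((\<lambda>T. 2 * (C / T\<^sup>2 * (s + T)) + 2 * (C / (1 + T\<^sup>2) * (T - 1))) \<longlongrightarrow> 0) at_top"
  proof -
    have "((\<lambda>T. (s + T) / T\<^sup>2) \<longlongrightarrow> 0) at_top" by real_asymp
    moreover have "((\<lambda>T::real. (T - 1) / (1 + T\<^sup>2)) \<longlongrightarrow> 0) at_top" by real_asymp
    ultimately have "((\<lambda>T. 2 * (C * ((s + T) / T\<^sup>2)) + 2 * (C * ((T - 1) / (1 + T\<^sup>2)))) \<longlongrightarrow> 2 * (C * 0) + 2 * (C * 0)) at_top"
      by (intro tendsto_intros)
    then show ?thesis by simp
  qed
  ultimately have E0: "(E \<longlongrightarrow> 0) at_top"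
    by (rule Lim_null_comparison)
  have "((\<lambda>T. 2 * of_real pi * \<i> * (\<Sum>p\<in>P. residue f p) + \<i> * (LBINT y:{-T..T}. f (Complex s y)) + E T)
     \<longlongrightarrow> 2 * of_real pi * \<i> * (\<Sum>p\<in>P. residue f p) + \<i> * (LBINT y. f (Complex s y)) + 0) at_top"
    by (intro tendsto_intros tendsto_LBINT_symmetric_interval int E0)
  moreover have "eventually (\<lambda>T. 2 * of_real pi * \<i> * (\<Sum>p\<in>P. residue f p) + \<i> * (LBINT y:{-T..T}. f (Complex s y)) + E T
      = contour_integral (loop_path c T) f) at_top"
    using eventually_gt_at_top[of 1] eventually_gt_at_top[of "-s"] by eventually_elim (simp add: main)
  ultimately have "((\<lambda>T. contour_integral (loop_path c T) f)
     \<longlongrightarrow> 2 * of_real pi * \<i> * (\<Sum>p\<in>P. residue f p) + \<i> * (LBINT y. f (Complex s y)) + 0) at_top"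
    by (rule Lim_transform_eventually)
  then show ?thesis2
    unfolding loop_integral_def by (intro tendsto_Lim) auto
qed

section \<open>Loop integrals as sums of residues\<close>

lemma residue_Gamma_mult:
  fixes c :: complex
  assumes S: "open S" "- (c + of_nat n) \<in> S" and g: "g holomorphic_on S"
    and only: "\<And>m. m \<noteq> n \<Longrightarrow> - (c + of_nat m) \<notin> S"
  shows "residue (\<lambda>u. Gamma (u + c) * g u) (- (c + of_nat n)) = (-1) ^ n / fact n * g (- (c + of_nat n))"
proof -
  define z where "z = - (c + of_nat n)"
  show ?thesis
    unfolding z_def[symmetric]
  proof (rule residue_simple'[of S])
    show "open S" "z \<in> S" using S by (auto simp: z_def)
    have "u + c \<notin> \<int>\<^sub>\<le>\<^sub>0" if "u \<in> S - {z}" for u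
    proof
      assume "u + c \<in> \<int>\<^sub>\<le>\<^sub>0"
      then obtain m where "u + c = - of_nat m" by (elim nonpos_Ints_cases') 
      then have "u = - (c + of_nat m)" by (simp add: algebra_simps eq_neg_iff_add_eq_0)
      with that only[of m] show False by (cases "m = n") (auto simp: z_def)
    qed
    then show "(\<lambda>u. Gamma (u + c) * g u) holomorphic_on S - {z}"
      by (intro holomorphic_intros holomorphic_on_subset[OF g]) auto
    have "filterlim (\<lambda>w. w + c) (at (- of_nat n)) (at z)"
    proof (rule filterlim_atI)
      have "((\<lambda>w. w + c) \<longlongrightarrow> z + c) (at z)" by (intro tendsto_intros)
      then show "((\<lambda>w. w + c) \<longlongrightarrow> - of_nat n) (at z)" by (simp add: z_def)
      show "\<forall>\<^sub>F w in at z. w + c \<noteq> - of_nat n"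
        by (auto simp: eventually_at_filter z_def algebra_simps eq_neg_iff_add_eq_0)
    qed
    from filterlim_compose[OF Gamma_residues this]
    have "((\<lambda>w. Gamma (w + c) * (w + c + of_nat n)) \<longlongrightarrow> (-1) ^ n / fact n) (at z)" .
    moreover have "(g \<longlongrightarrow> g z) (at z)"
      using holomorphic_on_imp_continuous_on[OF g] S
      by (auto simp: z_def continuous_on_eq_continuous_at isCont_def)
    ultimately have "((\<lambda>w. Gamma (w + c) * (w + c + of_nat n) * g w) \<longlongrightarrow> (-1) ^ n / fact n * g z) (at z)"
      by (rule tendsto_mult)
    then show "((\<lambda>w. Gamma (w + c) * g w * (w - z)) \<longlongrightarrow> (-1) ^ n / fact n * g z) (at z)"
      by (simp add: z_def algebra_simps)
  qed
qed

text \<open>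
  Halfway between two poles the recursion divides by numbers of modulus at least \<open>1\<close>, except for the
  last step, where the modulus is at least \<open>1/2\<close>.
\<close>

lemma norm_Gamma_half_line:
  fixes z :: complex
  assumes "Re z = - real N - 1/2"
  shows "norm (Gamma z) \<le> 2 * Gamma (1/2)"
  using assms
proof (induction N arbitrary: z)
  case (0 z)
  have "z \<notin> \<int>\<^sub>\<le>\<^sub>0"
  proof
    assume "z \<in> \<int>\<^sub>\<le>\<^sub>0"
    then obtain m :: int where "z = of_int m" by (auto elim: nonpos_Ints_cases)
    with 0 have "real_of_int (2 * m) = real_of_int (- 1)" by simp
    then have "2 * m = - 1" by linarith
    then show False by presburger
  qed
  then have "norm z * norm (Gamma z) = norm (Gamma (z + 1))"
    by (simp add: Gamma_plus1 norm_mult)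
  also have "\<dots> \<le> Gamma (1/2)" using norm_Gamma_le_Gamma_Re[of "z + 1"] 0 by simp
  finally have "norm z * norm (Gamma z) \<le> Gamma (1/2)" .
  moreover have "1/2 * norm (Gamma z) \<le> norm z * norm (Gamma z)"
    using 0 abs_Re_le_cmod[of z] by (intro mult_right_mono) auto
  ultimately show ?case by simp
next
  case (Suc N z)
  have nz: "z \<notin> \<int>\<^sub>\<le>\<^sub>0"
  proof
    assume "z \<in> \<int>\<^sub>\<le>\<^sub>0"
    then obtain m :: int where "z = of_int m" by (auto elim: nonpos_Ints_cases)
    with Suc have "real_of_int (2 * m) = real_of_int (- 2 * int N - 3)" by simp
    then have "2 * m = - 2 * int N - 3" by linarith
    then show False by presburger
  qed
  have "1 * norm (Gamma z) \<le> norm z * norm (Gamma z)"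
    using Suc abs_Re_le_cmod[of z] by (intro mult_right_mono) auto
  also have "\<dots> = norm (Gamma (z + 1))"
    using nz by (simp add: Gamma_plus1 norm_mult)
  also have "\<dots> \<le> 2 * Gamma (1/2)"
    using Suc by (intro Suc.IH) auto
  finally show ?case by simp
qed

lemma summable_over_fact:
  fixes x :: "nat \<Rightarrow> complex"
  assumes "eventually (\<lambda>n. norm (x n) \<le> C) sequentially"
  shows "summable (\<lambda>n. (-1) ^ n / fact n * x n)"
proof (rule summable_comparison_test_ev)
  show "eventually (\<lambda>n. norm ((-1) ^ n / fact n * x n) \<le> C * (inverse (fact n) * 1 ^ n)) sequentially"
    using assms
  proof eventually_elim
    case (elim n)
    then show ?case by (simp add: norm_mult norm_divide norm_power divide_simps)
  qed
  show "summable (\<lambda>n. C * (inverse (fact n) * 1 ^ n))"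
    by (intro summable_mult summable_exp)
qed

text \<open>
  Closing the loop by a vertical segment halfway between two poles gives a rectangle, hence a partial
  sum of the residues, up to the integral over that segment, which tends to \<open>0\<close>. The loop integral is
  a limit over all real cut-offs. The cut-offs between two poles are reached by comparison with the nearest
  such segment on the right.
\<close>

lemma loop_integral_Gamma_sums:
  fixes h :: "complex \<Rightarrow> complex"
  assumes h: "h holomorphic_on UNIV"
    and decay: "\<And>u. Re u \<le> X0 \<Longrightarrow> \<bar>Im u\<bar> \<le> 1 \<Longrightarrow> norm (h u) \<le> C / (1 + (Re u)\<^sup>2)"
  shows "(\<lambda>n. (-1) ^ n / fact n * h (- (of_real c + of_nat n))) sums
     (1 / (2 * of_real pi * \<i>) * loop_integral c (\<lambda>u. Gamma (u + of_real c) * h u))"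
proof -
  define X where "X = 1 + \<bar>c\<bar>"
  define f where "f = (\<lambda>u. Gamma (u + of_real c) * h u)"
  define L where "L = (\<lambda>p q. contour_integral (linepath p q) f)"
  define F where "F = (\<lambda>T. contour_integral (loop_path c T) f)"
  define t where "t = (\<lambda>n. (-1) ^ n / fact n * h (- (of_real c + of_nat n)))"
  define \<tau> where "\<tau> = (\<lambda>N. c + real N + 1/2)"
  define D where "D = {u :: complex. \<forall>n::nat. u \<noteq> - (of_real c + of_nat n)}"
  have D_iff: "u \<in> D \<longleftrightarrow> u + of_real c \<notin> \<int>\<^sub>\<le>\<^sub>0" for u
  proof -
    have "(u = - (of_real c + of_nat n)) = (u + of_real c = - of_nat n)" for n
      by (auto simp: algebra_simps eq_neg_iff_add_eq_0)
    then show ?thesis unfolding D_def by (auto elim!: nonpos_Ints_cases')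
  qed
  have hol: "f holomorphic_on A" if "A \<subseteq> D" for A
    unfolding f_def using that D_iff
    by (intro holomorphic_intros holomorphic_on_subset[OF h]) auto
  have cont: "continuous_on A f" if "A \<subseteq> D" for A
    using hol[OF that] by (rule holomorphic_on_imp_continuous_on)
  have D_Im: "u \<in> D" if "Im u \<noteq> 0" for u
    using that by (auto simp: D_def)
  have D_Re: "u \<in> D" if "Re u = - \<tau> N" for u N
  proof -
    have False if "u = - (of_real c + of_nat n)" for n
    proof -
      from that \<open>Re u = - \<tau> N\<close> have "real (2 * n) = real (2 * N + 1)" by (simp add: \<tau>_def)
      then have "2 * n = 2 * N + 1" by linarith
      then show False by presburger
    qed
    then show ?thesis by (auto simp: D_def)
  qed
  have D_right: "u \<in> D" if "Re u > -c" for u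
    using that by (auto simp: D_def)
  have C: "C \<ge> 0"
  proof -
    have "norm (h (of_real X0)) \<le> C / (1 + X0\<^sup>2)" using decay[of "of_real X0"] by simp
    then have "0 \<le> C / (1 + X0\<^sup>2)" using norm_ge_zero order_trans by blast
    moreover have "0 < 1 + X0\<^sup>2" by (simp add: add_pos_nonneg)
    ultimately show ?thesis by (simp add: zero_le_divide_iff)
  qed
  obtain G where G: "G > 0" "\<And>u. Re u \<le> 0 \<Longrightarrow> \<bar>Im u\<bar> \<ge> 1 \<Longrightarrow> norm (Gamma u) \<le> G / (Im u)\<^sup>2"
    by (rule norm_Gamma_decay[of 0]) blast
  define K where "K = max G (2 * Gamma (1/2))"
  have K: "K > 0" using G by (simp add: K_def)
  define B where "B = (\<lambda>x::real. K * (C / (1 + x\<^sup>2)))"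
  have B: "B x \<ge> 0" for x using K C by (simp add: B_def)
  have f_hor: "norm (f u) \<le> B (Re u)" if "Re u \<le> X0" "Re u \<le> -c" "\<bar>Im u\<bar> = 1" for u
  proof -
    have Im2: "(Im u)\<^sup>2 = 1" using that by (metis one_power2 power2_abs)
    have "norm (Gamma (u + of_real c)) \<le> K"
      using G(2)[of "u + of_real c"] that Im2 by (simp add: K_def)
    then show ?thesis
      unfolding f_def norm_mult B_def using decay[of u] that K by (intro mult_mono) auto
  qed
  have f_ver: "norm (f u) \<le> B (Re u)" if "Re u = - \<tau> N" "Re u \<le> X0" "\<bar>Im u\<bar> \<le> 1" for u N
  proof -
    have "norm (Gamma (u + of_real c)) \<le> K"
      using norm_Gamma_half_line[of "u + of_real c" N] that by (auto simp: K_def \<tau>_def)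
    then show ?thesis
      unfolding f_def norm_mult B_def using decay[of u] that K by (intro mult_mono) auto
  qed
  have segbound: "norm (L p q) \<le> M * norm (q - p)"
    if "closed_segment p q \<subseteq> D" "M \<ge> 0" "\<And>u. u \<in> closed_segment p q \<Longrightarrow> norm (f u) \<le> M" for p q M
    unfolding L_def using that
    by (intro contour_integral_bound_linepath contour_integrable_continuous_linepath cont) auto
  have loop: "F T = L (Complex (-T) (-1)) (Complex X (-1)) + L (Complex X (-1)) (Complex X 1)
      + L (Complex X 1) (Complex (-T) 1)" for T
    unfolding F_def L_def X_def
    by (rule contour_integral_loop_path, rule cont) (use D_Im D_right in \<open>force simp: X_def\<close>)
  have X: "X > -c" by (simp add: X_def)

  \<comment> \<open>Cut-offs halfway between two poles: the loop closes up to a rectangle.\<close>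
  have closed: "F (\<tau> N) = 2 * of_real pi * \<i> * (\<Sum>n\<le>N. t n) - L (Complex (- \<tau> N) 1) (Complex (- \<tau> N) (-1))" for N
  proof -
    define P where "P = (\<lambda>n. - (of_real c + of_nat n) :: complex) ` {..N}"
    have less: "- \<tau> N < X" using X by (simp add: \<tau>_def)
    have "L (Complex (- \<tau> N) (-1)) (Complex X (-1)) + L (Complex X (-1)) (Complex X 1)
         + L (Complex X 1) (Complex (- \<tau> N) 1) + L (Complex (- \<tau> N) 1) (Complex (- \<tau> N) (-1))
         = 2 * of_real pi * \<i> * (\<Sum>z\<in>P. residue f z)"
      unfolding L_def
    proof (rule rectangle_residues[of "{u. Re u > - c - real N - 1}" "Complex (- \<tau> N) (-1)" "Complex X 1" P f, simplified complex.sel])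
      show "f holomorphic_on {u. - c - real N - 1 < Re u} - P"
      proof (rule hol, safe)
        fix u assume u: "- c - real N - 1 < Re u" "u \<notin> P"
        show "u \<in> D" unfolding D_def
        proof safe
          fix n assume eq: "u = - (complex_of_real c + of_nat n)"
          with u have "n \<le> N" by simp
          with u eq show False by (auto simp: P_def)
        qed
      qed
      show "P \<subseteq> box (Complex (- \<tau> N) (-1)) (Complex X 1)"
        using X by (auto simp: P_def in_box_complex_iff \<tau>_def)
      show "cbox (Complex (- \<tau> N) (-1)) (Complex X 1) \<subseteq> {u. - c - real N - 1 < Re u}"
        by (auto simp: in_cbox_complex_iff \<tau>_def)
      show "finite P" by (simp add: P_def)
    qed (use less in \<open>simp_all add: open_halfspace_Re_gt convex_halfspace_Re_gt\<close>)
    also have "(\<Sum>z\<in>P. residue f z) = (\<Sum>n\<le>N. t n)"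
      unfolding P_def
    proof (subst sum.reindex)
      show "inj_on (\<lambda>n. - (complex_of_real c + of_nat n)) {..N}" by (auto simp: inj_on_def)
      show "sum (residue f \<circ> (\<lambda>n. - (complex_of_real c + of_nat n))) {..N} = sum t {..N}"
      proof (rule sum.cong, goal_cases)
        case (2 n)
        show ?case
          unfolding o_def f_def t_def
        proof (rule residue_Gamma_mult[of "ball (- (of_real c + of_nat n)) 1"])
          fix m :: nat assume "m \<noteq> n"
          have "- (complex_of_real c + of_nat n) - (- (complex_of_real c + of_nat m)) = of_real (real m - real n)"
            by simp
          then have "dist (- (complex_of_real c + of_nat n)) (- (complex_of_real c + of_nat m)) = \<bar>real m - real n\<bar>"
            unfolding dist_norm by (simp only: norm_of_real real_norm_def)
          also have "\<dots> \<ge> 1" using \<open>m \<noteq> n\<close> by linarith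
          finally show "- (complex_of_real c + of_nat m) \<notin> ball (- (of_real c + of_nat n)) 1" by simp
        qed (auto intro!: holomorphic_on_subset[OF h])
      qed auto
    qed
    finally show ?thesis unfolding loop eq_diff_eq .
  qed
  have edge: "norm (L (Complex (- \<tau> N) 1) (Complex (- \<tau> N) (-1))) \<le> B (\<tau> N) * 2" if "- \<tau> N \<le> X0" for N
  proof -
    have u: "Re u = - \<tau> N" "\<bar>Im u\<bar> \<le> 1"
      if "u \<in> closed_segment (Complex (- \<tau> N) 1) (Complex (- \<tau> N) (-1))" for u
      using that by (auto simp: closed_segment_same_Re closed_segment_eq_real_ivl)
    have "norm (L (Complex (- \<tau> N) 1) (Complex (- \<tau> N) (-1))) \<le> B (\<tau> N) * norm (Complex (- \<tau> N) (-1) - Complex (- \<tau> N) 1)"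
    proof (rule segbound[OF _ B])
      show "closed_segment (Complex (- \<tau> N) 1) (Complex (- \<tau> N) (-1)) \<subseteq> D"
        using u(1) D_Re by blast
      fix u assume "u \<in> closed_segment (Complex (- \<tau> N) 1) (Complex (- \<tau> N) (-1))"
      from u[OF this] show "norm (f u) \<le> B (\<tau> N)"
        using f_ver[of u N] that by (simp add: B_def)
    qed
    also have "norm (Complex (- \<tau> N) (-1) - Complex (- \<tau> N) 1) = 2" by (simp add: cmod_def)
    finally show ?thesis .
  qed
  have Binf: "((\<lambda>x. B x) \<longlongrightarrow> 0) at_top" unfolding B_def by real_asymp
  have \<tau>: "filterlim \<tau> at_top sequentially" unfolding \<tau>_def by real_asymp
  have B\<tau>: "(\<lambda>N. B (\<tau> N) * 2) \<longlonglongrightarrow> 0"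
    using tendsto_mult[OF filterlim_compose[OF Binf \<tau>] tendsto_const[of 2]] by simp
  have "eventually (\<lambda>N. - \<tau> N \<le> X0) sequentially"
    using \<tau>[unfolded filterlim_at_top, rule_format, of "-X0"] by eventually_elim simp
  then have "(\<lambda>N. L (Complex (- \<tau> N) 1) (Complex (- \<tau> N) (-1))) \<longlonglongrightarrow> 0"
    by (intro Lim_null_comparison[OF _ B\<tau>]) (auto elim!: eventually_mono intro: edge)
  moreover have sum_t: "summable t"
    unfolding t_def
  proof (rule summable_over_fact)
    have "filterlim (\<lambda>n. c + real n) at_top sequentially" by real_asymp
    then have "eventually (\<lambda>n. c + real n \<ge> -X0) sequentially" by (simp add: filterlim_at_top)
    then show "eventually (\<lambda>n. norm (h (- (of_real c + of_nat n))) \<le> C) sequentially"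
    proof eventually_elim
      case (elim n)
      have "norm (h (- (of_real c + of_nat n))) \<le> C / (1 + (c + real n)\<^sup>2)"
        using decay[of "- (of_real c + of_nat n)"] elim by (simp add: power2_eq_square algebra_simps)
      also have "\<dots> \<le> C / 1" using C by (intro divide_left_mono) (auto intro!: mult_pos_pos add_pos_nonneg)
      finally show ?case by simp
    qed
  qed
  then have "(\<lambda>N. \<Sum>n\<le>N. t n) \<longlonglongrightarrow> suminf t" by (rule summable_LIMSEQ')
  ultimately have "(\<lambda>N. 2 * of_real pi * \<i> * (\<Sum>n\<le>N. t n) - L (Complex (- \<tau> N) 1) (Complex (- \<tau> N) (-1)))
      \<longlonglongrightarrow> 2 * of_real pi * \<i> * suminf t - 0"
    by (intro tendsto_intros)
  then have F\<tau>: "(\<lambda>N. F (\<tau> N)) \<longlonglongrightarrow> 2 * of_real pi * \<i> * suminf t"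
    unfolding closed by simp

  \<comment> \<open>Between two such cut-offs the loop integral hardly changes.\<close>
  define N where "N = (\<lambda>T. nat \<lfloor>T - c - 1/2\<rfloor>)"
  have N: "filterlim N at_top at_top"
  proof -
    have "filterlim (\<lambda>T. T - c - 1/2) at_top at_top" by real_asymp
    then have "filterlim (\<lambda>T. \<lfloor>T - c - 1/2\<rfloor>) at_top at_top"
      by (rule filterlim_compose[OF filterlim_floor_sequentially])
    then show ?thesis unfolding N_def by (rule filterlim_compose[OF filterlim_nat_sequentially])
  qed
  have diff: "norm (F T - F (\<tau> (N T))) \<le> B (\<tau> (N T)) * 2" if T: "T \<ge> c + 1/2" "- \<tau> (N T) \<le> X0" "\<tau> (N T) \<ge> c" "\<tau> (N T) \<ge> 0" for T
  proof -
    define S where "S = \<tau> (N T)"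
    have ST: "S \<le> T" "T \<le> S + 1"
      using T unfolding S_def \<tau>_def N_def by linarith+
    have seg: "closed_segment p q \<subseteq> D" if "Im p = Im q" "Im p \<noteq> 0" for p q
      using that by (auto simp: closed_segment_same_Im intro!: D_Im)
    have small: "norm (L p q) \<le> B S * 1"
      if "Im p = Im q" "\<bar>Im p\<bar> = 1" "(Re p = -T \<and> Re q = -S) \<or> (Re p = -S \<and> Re q = -T)" for p q
    proof -
      have "norm (L p q) \<le> B S * norm (q - p)"
      proof (rule segbound[OF _ B])
        show "closed_segment p q \<subseteq> D" using that by (intro seg) auto
        fix u assume u: "u \<in> closed_segment p q"
        then have u': "Im u = Im p" "Re u \<le> - S"
          using that ST by (auto simp: closed_segment_same_Im closed_segment_eq_real_ivl split: if_splits)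
        have "norm (f u) \<le> B (Re u)"
          using u' T that by (intro f_hor) (auto simp: S_def)
        also have "S\<^sup>2 \<le> (Re u)\<^sup>2"
          using u'(2) T(4) unfolding S_def by (intro abs_le_square_iff[THEN iffD1]) linarith
        then have "B (Re u) \<le> B S"
          unfolding B_def using K C
          by (intro mult_left_mono divide_left_mono mult_pos_pos add_pos_nonneg) auto
        finally show "norm (f u) \<le> B S" .
      qed
      also have "norm (q - p) \<le> 1"
        using that ST by (auto simp: cmod_def)
      then have "B S * norm (q - p) \<le> B S * 1" using B by (intro mult_left_mono) auto
      finally show ?thesis .
    qed
    have SX: "-S < X" using T X by (simp add: S_def)
    have 1: "L (Complex (-T) (-1)) (Complex X (-1)) = L (Complex (-T) (-1)) (Complex (-S) (-1)) + L (Complex (-S) (-1)) (Complex X (-1))"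
      unfolding L_def
      by (rule contour_integral_split_linepath[OF cont[OF seg]])
         (use SX ST in \<open>auto simp: closed_segment_same_Im closed_segment_eq_real_ivl\<close>)
    have 2: "L (Complex X 1) (Complex (-T) 1) = L (Complex X 1) (Complex (-S) 1) + L (Complex (-S) 1) (Complex (-T) 1)"
      unfolding L_def
      by (rule contour_integral_split_linepath[OF cont[OF seg]])
         (use SX ST in \<open>auto simp: closed_segment_same_Im closed_segment_eq_real_ivl\<close>)
    have "F T - F S = L (Complex (-T) (-1)) (Complex (-S) (-1)) + L (Complex (-S) 1) (Complex (-T) 1)"
      unfolding loop[of T] loop[of S] 1 2 by simp
    also have "norm \<dots> \<le> norm (L (Complex (-T) (-1)) (Complex (-S) (-1))) + norm (L (Complex (-S) 1) (Complex (-T) 1))"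
      by (rule norm_triangle_ineq)
    also have "\<dots> \<le> B S * 1 + B S * 1"
      by (rule add_mono; rule small) auto
    finally show ?thesis by (simp add: S_def)
  qed
  have N\<tau>: "filterlim (\<lambda>T. \<tau> (N T)) at_top at_top"
    using filterlim_compose[OF \<tau> N] .
  have FN: "((\<lambda>T. F T - F (\<tau> (N T))) \<longlongrightarrow> 0) at_top"
  proof (rule Lim_null_comparison)
    show "((\<lambda>T. B (\<tau> (N T)) * 2) \<longlongrightarrow> 0) at_top"
      by (rule filterlim_compose[OF B\<tau> N])
    show "eventually (\<lambda>T. norm (F T - F (\<tau> (N T))) \<le> B (\<tau> (N T)) * 2) at_top"
    proof -
      have "eventually (\<lambda>T. max (-X0) (max c 0) \<le> \<tau> (N T)) at_top"
        using N\<tau> by (simp only: filterlim_at_top)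
      with eventually_ge_at_top[of "c + 1/2"] show ?thesis
      proof eventually_elim
        case (elim T)
        show ?case by (rule diff) (use elim in linarith)+
      qed
    qed
  qed
  have FN': "((\<lambda>T. F (\<tau> (N T))) \<longlongrightarrow> 2 * of_real pi * \<i> * suminf t) at_top"
    by (rule filterlim_compose[OF F\<tau> N])
  have "(F \<longlongrightarrow> 2 * of_real pi * \<i> * suminf t) at_top"
    by (rule Lim_transform[OF FN' FN])
  then have "loop_integral c f = 2 * of_real pi * \<i> * suminf t"
    unfolding loop_integral_def F_def by (rule tendsto_Lim[OF trivial_limit_at_top_linorder])
  then have "1 / (2 * of_real pi * \<i>) * loop_integral c f = suminf t" by simp
  with summable_sums[OF sum_t] show ?thesis by (simp add: f_def t_def)
qed

section \<open>Series and line integrals for the Meijer functions\<close>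

lemma norm_of_real_powr:
  assumes "z > 0"
  shows "norm (complex_of_real z powr u) = z powr (Re u)"
  using assms by (simp add: norm_powr_real_powr)

lemma holomorphic_of_real_powr [holomorphic_intros]:
  assumes "z > 0" "f holomorphic_on A"
  shows "(\<lambda>u. complex_of_real z powr f u) holomorphic_on A"
proof -
  have "(\<lambda>u. complex_of_real z powr f u) = (\<lambda>u. exp (f u * of_real (ln z)))"
    using assms(1) by (auto simp: powr_def Ln_of_real)
  then show ?thesis using assms(2) by (simp add: holomorphic_intros)
qed

text \<open>
  The entire factor of the integrands decays along the loop, by the growth of the Gamma function in
  the strip \<open>\<bar>Im u\<bar> \<le> 1\<close>.
\<close>

lemma rGamma_powr_strip_decay:
  assumes z: "z > 0"
  obtains C where "C > 0"
    "\<And>u. Re u \<le> d - 1 \<Longrightarrow> \<bar>Im u\<bar> \<le> 1 \<Longrightarrow>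
       norm (rGamma (of_real d - u) * of_real z powr (-u)) \<le> C / (1 + (Re u)\<^sup>2)"
proof -
  obtain C1 where C1: "C1 > 0"
    "\<And>w. Re w \<ge> 1 \<Longrightarrow> \<bar>Im w\<bar> \<le> 1 \<Longrightarrow> norm (rGamma w) \<le> C1 / Gamma (Re w)"
    using norm_rGamma_strip by blast
  obtain C2 where C2: "C2 > 0" "\<And>x. x \<le> d - 1 \<Longrightarrow> z powr (-x) / Gamma (d - x) \<le> C2 / (1 + x\<^sup>2)"
    using powr_over_Gamma_decay[OF z, of d "d - 1"] by auto
  show ?thesis
  proof (rule that[of "C1 * C2"])
    show "C1 * C2 > 0" using C1 C2 by simp
    fix u :: complex
    assume u: "Re u \<le> d - 1" "\<bar>Im u\<bar> \<le> 1"
    have "norm (rGamma (of_real d - u) * of_real z powr (-u))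
        = norm (rGamma (of_real d - u)) * z powr (- Re u)"
      using z by (simp add: norm_mult norm_of_real_powr)
    also have "\<dots> \<le> C1 / Gamma (d - Re u) * z powr (- Re u)"
      using C1(2)[of "of_real d - u"] u by (intro mult_right_mono) auto
    also have "\<dots> = C1 * (z powr (- Re u) / Gamma (d - Re u))" by simp
    also have "\<dots> \<le> C1 * (C2 / (1 + (Re u)\<^sup>2))"
      using C1 C2(2)[OF u(1)] by (intro mult_left_mono) auto
    finally show "norm (rGamma (of_real d - u) * of_real z powr (-u)) \<le> C1 * C2 / (1 + (Re u)\<^sup>2)"
      by simp
  qed
qed

text \<open>
  The numerator of the integrand is a single Gamma function, so all poles are simple for every value
  of the parameters.
\<close>

lemma meijer_H_sums:
  assumes z: "z > 0"
  shows "(\<lambda>n. complex_of_real ((-1) ^ n / fact n * (rGamma (1 + c + real n) * rGamma (\<alpha> + 1 + real n)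
            * z powr (c + real n)))) sums meijer_H \<alpha> c z"
proof -
  define d where "d = \<alpha> - c + 1"
  define h where "h = (\<lambda>u::complex. rGamma (1 - u) * (rGamma (of_real d - u) * of_real z powr (-u)))"
  obtain C1 where C1: "C1 > 0" "\<And>u. Re u \<le> d - 1 \<Longrightarrow> \<bar>Im u\<bar> \<le> 1 \<Longrightarrow>
       norm (rGamma (of_real d - u) * of_real z powr (-u)) \<le> C1 / (1 + (Re u)\<^sup>2)"
    using rGamma_powr_strip_decay[OF z] by blast
  obtain C2 where C2: "C2 > 0" "\<And>u. Re u \<le> 1 - 1 \<Longrightarrow> \<bar>Im u\<bar> \<le> 1 \<Longrightarrow>
       norm (rGamma (of_real 1 - u) * of_real 1 powr (-u)) \<le> C2 / (1 + (Re u)\<^sup>2)"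
    by (rule rGamma_powr_strip_decay[of 1 1]) auto
  have hol: "h holomorphic_on UNIV"
    unfolding h_def using z by (intro holomorphic_intros) auto
  have bnd: "norm (h u) \<le> C2 * C1 / (1 + (Re u)\<^sup>2)" if u: "Re u \<le> min 0 (d - 1)" "\<bar>Im u\<bar> \<le> 1" for u
  proof -
    have "norm (rGamma (1 - u)) \<le> C2 / (1 + (Re u)\<^sup>2)"
      using C2(2)[of u] u by (simp add: powr_def)
    also have "\<dots> \<le> C2 / 1" using C2(1) by (intro divide_left_mono) (auto intro: add_pos_nonneg)
    finally have "norm (rGamma (1 - u)) \<le> C2" by simp
    then have "norm (h u) \<le> C2 * (C1 / (1 + (Re u)\<^sup>2))"
      unfolding h_def norm_mult[of "rGamma (1 - u)"] using C1(2)[of u] u C2(1)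
      by (intro mult_mono) auto
    then show ?thesis by simp
  qed
  have "(\<lambda>n. (-1) ^ n / fact n * h (- (of_real c + of_nat n))) sums
    (1 / (2 * of_real pi * \<i>) * loop_integral c (\<lambda>u. Gamma (u + of_real c) * h u))"
    by (rule loop_integral_Gamma_sums[OF hol bnd])
  also have "(\<lambda>u. Gamma (u + of_real c) * h u) =
     (\<lambda>u. Gamma (u + of_real c) / (Gamma (1 - u) * Gamma (of_real (\<alpha> - c + 1) - u)) * of_real z powr (-u))"
    by (auto simp: h_def d_def rGamma_inverse_Gamma divide_inverse mult_ac)
  also have "1 / (2 * of_real pi * \<i>) * loop_integral c \<dots> = meijer_H \<alpha> c z"
    unfolding meijer_H_def ..
  also have "(\<lambda>n. (-1) ^ n / fact n * h (- (of_real c + of_nat n)))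
     = (\<lambda>n. complex_of_real ((-1) ^ n / fact n * (rGamma (1 + c + real n) * rGamma (\<alpha> + 1 + real n)
            * z powr (c + real n))))"
  proof
    fix n
    have 1: "1 - (- (of_real c + of_nat n)) = complex_of_real (1 + c + real n)" by simp
    have 2: "of_real d - (- (of_real c + of_nat n)) = complex_of_real (\<alpha> + 1 + real n)" by (simp add: d_def)
    have 3: "- (- (of_real c + of_nat n)) = complex_of_real (c + real n)" by simp
    have 4: "complex_of_real z powr complex_of_real (c + real n) = of_real (z powr (c + real n))"
      using z by (intro powr_of_real) auto
    show "(-1) ^ n / fact n * h (- (of_real c + of_nat n)) = complex_of_real ((-1) ^ n / fact n *
        (rGamma (1 + c + real n) * rGamma (\<alpha> + 1 + real n) * z powr (c + real n)))"
      unfolding h_def 1 2 3 4 rGamma_complex_of_real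
      by (simp only: of_real_mult of_real_divide of_real_power of_real_minus of_real_1 of_real_fact mult.assoc)
  qed
  finally show ?thesis .
qed

lemma divide_two_pi_i:
  "1 / (2 * of_real pi * \<i>) * (2 * of_real pi * \<i> * S + \<i> * V) = S + 1 / (2 * of_real pi) * (V :: complex)"
  by (simp add: distrib_left)

lemma nonpos_Ints_complexD:
  assumes "w \<in> \<int>\<^sub>\<le>\<^sub>0"
  shows "Im w = 0" "Re w \<le> 0"
  using assms by (auto elim!: nonpos_Ints_cases)

text \<open>
  The common shape of the integrals for \<open>\<tilde>H\<^sub>b\<close>, with \<open>G u = \<Gamma>(u + b)\<close>, and for the Bessel function,
  with \<open>G = 1\<close>. On the line \<open>Re u = s\<close> the quotient \<open>\<Gamma>(u) / \<Gamma>(a + 1 - u)\<close> is of order \<open>\<bar>Im u\<bar>\<^sup>2\<^sup>s\<^sup>-\<^sup>1\<^sup>-\<^sup>a\<close>.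
  If \<open>a \<le> 0\<close>, this is not integrable for any \<open>s > 0\<close>; for \<open>s = -3/2\<close> it is integrable whenever
  \<open>a > -1\<close>. The price is the residues at the poles \<open>0\<close> and \<open>-1\<close> of \<open>\<Gamma>(u)\<close>.
\<close>

lemma loop_integral_eq_line_minus_three_halves:
  fixes G :: "complex \<Rightarrow> complex"
  assumes z: "z > 0" and a: "a > -1"
    and G: "G holomorphic_on {u. Im u \<noteq> 0 \<or> Re u > -2}"
    and K: "\<And>u. Re u \<le> -3/2 \<Longrightarrow> \<bar>Im u\<bar> \<ge> 1 \<Longrightarrow> norm (G u) \<le> K"
  defines "f \<equiv> \<lambda>u. Gamma u * (G u * (rGamma (of_real (a + 1) - u) * of_real z powr (-u)))"
  shows "integrable lborel (\<lambda>y. f (Complex (-3/2) y))"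
    and "1 / (2 * of_real pi * \<i>) * loop_integral c f = G 0 * of_real (rGamma (a + 1))
        - G (-1) * of_real (rGamma (a + 2) * z) + 1 / (2 * of_real pi) * (LBINT y. f (Complex (-3/2) y))" (is ?formula)
proof -
  obtain C1 where C1: "C1 > 0" "\<And>u. Re u \<le> -3/2 \<Longrightarrow> \<bar>Im u\<bar> \<ge> 1 \<Longrightarrow>
       norm (Gamma u * rGamma (of_real (a+1) - u)) \<le> C1 / ((Im u)\<^sup>2 * Gamma (a + 1 - Re u))"
    using norm_Gamma_rGamma_decay[of "-3/2" "a + 1"] a by auto
  obtain C2 where C2: "C2 > 0" "\<And>x. x \<le> -3/2 \<Longrightarrow> z powr (-x) / Gamma (a + 1 - x) \<le> C2 / (1 + x\<^sup>2)"
    using powr_over_Gamma_decay[OF z, of "a + 1" "-3/2"] a by auto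
  have K0: "K \<ge> 0" by (rule order_trans[OF norm_ge_zero K[of "Complex (-3/2) 1"]]) auto
  have decay: "norm (f u) \<le> (K * C1 * C2) / ((1 + (Re u)\<^sup>2) * (Im u)\<^sup>2)"
    if u: "Re u \<le> -3/2" "\<bar>Im u\<bar> \<ge> 1" for u
  proof -
    have "norm (f u) = norm (G u) * (norm (Gamma u * rGamma (of_real (a+1) - u)) * z powr (- Re u))"
      using z by (simp add: f_def norm_mult norm_of_real_powr)
    also have "\<dots> \<le> K * (C1 / ((Im u)\<^sup>2 * Gamma (a + 1 - Re u)) * z powr (- Re u))"
      using K[OF u] C1(2)[OF u] K0 by (intro mult_mono mult_right_mono) auto
    also have "\<dots> = K * C1 / (Im u)\<^sup>2 * (z powr (- Re u) / Gamma (a + 1 - Re u))" by simp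
    also have "\<dots> \<le> K * C1 / (Im u)\<^sup>2 * (C2 / (1 + (Re u)\<^sup>2))"
      using C2(2)[OF u(1)] K0 C1(1) by (intro mult_left_mono) auto
    finally show ?thesis by (simp add: mult_ac)
  qed
  have g: "(\<lambda>u. G u * (rGamma (of_real (a + 1) - u) * of_real z powr (-u))) holomorphic_on A"
    if "A \<subseteq> {u. Im u \<noteq> 0 \<or> Re u > -2}" for A
    using z that by (intro holomorphic_intros holomorphic_on_subset[OF G]) auto
  have hol: "f holomorphic_on {u. Im u \<noteq> 0 \<or> Re u > -2} - {0, -1}"
    unfolding f_def
  proof (rule holomorphic_on_mult[OF holomorphic_Gamma g])
    show "({u. Im u \<noteq> 0 \<or> Re u > -2} - {0, -1}) \<inter> \<int>\<^sub>\<le>\<^sub>0 = {}"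
    proof (rule ccontr)
      assume "({u. Im u \<noteq> 0 \<or> Re u > -2} - {0, -1}) \<inter> \<int>\<^sub>\<le>\<^sub>0 \<noteq> ({} :: complex set)"
      then obtain n where n: "- complex_of_nat n \<noteq> 0" "- complex_of_nat n \<noteq> -1"
        "Re (- complex_of_nat n) > -2"
        by (auto elim!: nonpos_Ints_cases')
      then have "n < 2" by simp
      then have "n = 0 \<or> n = 1" by linarith
      with n show False by auto
    qed
  qed auto
  have res: "residue f (- of_nat n) = (-1) ^ n / fact n
      * (G (- of_nat n) * (rGamma (of_real (a + 1) + of_nat n) * of_real z powr (of_nat n)))"
    if "n \<le> 1" for n
  proof -
    have "residue (\<lambda>u. Gamma (u + 0) * (G u * (rGamma (of_real (a + 1) - u) * of_real z powr (-u)))) (- (0 + of_nat n))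
      = (-1) ^ n / fact n * (G (- (0 + of_nat n)) * (rGamma (of_real (a + 1) - (- (0 + of_nat n))) * of_real z powr (- (- (0 + of_nat n)))))"
    proof (rule residue_Gamma_mult[of "ball (- (0 + of_nat n)) 1"])
      show "(\<lambda>u. G u * (rGamma (of_real (a + 1) - u) * of_real z powr (-u))) holomorphic_on ball (- (0 + of_nat n)) 1"
      proof (rule g, safe)
        fix u assume u: "u \<in> ball (- (0 + of_nat n)) 1" "\<not> -2 < Re u" "Im u = 0"
        have "\<bar>Re (- of_nat n - u)\<bar> \<le> norm (- of_nat n - u)" by (rule abs_Re_le_cmod)
        also have "\<dots> < 1" using u by (simp add: dist_norm)
        finally show False using u that by simp
      qed
      fix m :: nat assume "m \<noteq> n"
      have "- (0 + of_nat n) - (- (0 + of_nat m)) = complex_of_real (real m - real n)" by simp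
      then have "dist (- (0 + of_nat n)) (- (0 + of_nat m) :: complex) = \<bar>real m - real n\<bar>"
        unfolding dist_norm by (simp only: norm_of_real real_norm_def)
      also have "\<dots> \<ge> 1" using \<open>m \<noteq> n\<close> by linarith
      finally show "- (0 + of_nat m :: complex) \<notin> ball (- (0 + of_nat n)) 1" by simp
    qed auto
    then show ?thesis by (simp add: f_def)
  qed
  have P: "{0, -1} \<subseteq> complex_of_real ` {-3/2<..<1 + \<bar>c\<bar>}"
  proof -
    have "0 = complex_of_real 0" "-1 = complex_of_real (-1)" by simp_all
    then show ?thesis by fastforce
  qed
  have s: "(-2::real) < -3/2" "-3/2 < 1 + \<bar>c\<bar>" by auto
  show "integrable lborel (\<lambda>y. f (Complex (-3/2) y))"
    by (rule loop_integral_eq_vertical_integral(1)[OF s _ P hol decay]) auto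
  have "loop_integral c f = 2 * of_real pi * \<i> * (\<Sum>p\<in>{0,-1}. residue f p) + \<i> * (LBINT y. f (Complex (-3/2) y))"
    by (rule loop_integral_eq_vertical_integral(2)[OF s _ P hol decay]) auto
  also have "(\<Sum>p\<in>{0,-1}. residue f p) = residue f (- of_nat 0) + residue f (- of_nat 1)" by simp
  also have "residue f (- of_nat 0) = G 0 * of_real (rGamma (a + 1))"
    using z by (subst res) (simp_all add: rGamma_complex_of_real[symmetric])
  also have "residue f (- of_nat 1) = - (G (-1) * of_real (rGamma (a + 2) * z))"
  proof -
    have "complex_of_real (a + 1) + of_nat 1 = of_real (a + 2)" by simp
    then have "rGamma (complex_of_real (a + 1) + of_nat 1) = of_real (rGamma (a + 2))"
      by (simp only: rGamma_complex_of_real)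
    then show ?thesis using z by (subst res) simp_all
  qed
  finally show ?formula
    by (simp only: divide_two_pi_i) simp
qed

text \<open>
  The entire function with \<open>J\<^sub>a(2 \<surd>x) = x\<^sup>a\<^sup>/\<^sup>2 * bessel_clifford a x\<close>.
\<close>

definition bessel_clifford :: "real \<Rightarrow> real \<Rightarrow> real" where
  "bessel_clifford a x = (\<Sum>n. (-1) ^ n / fact n * (rGamma (a + 1 + real n) * x ^ n))"

text \<open>
  Evaluate one loop integral in two ways: as the sum of its residues, which is the defining series,
  and on the line \<open>Re u = -3/2\<close>.
\<close>

lemma bessel_clifford_vertical:
  assumes z: "z > 0" and a: "a > -1"
  defines "f \<equiv> \<lambda>u. Gamma u * (rGamma (of_real (a + 1) - u) * of_real z powr (-u))"
  shows "integrable lborel (\<lambda>y. f (Complex (-3/2) y))"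
    and "of_real (bessel_clifford a z) = of_real (rGamma (a + 1))
        - of_real (rGamma (a + 2) * z) + 1 / (2 * of_real pi) * (LBINT y. f (Complex (-3/2) y))" (is ?formula)
    and "(\<lambda>n. (-1) ^ n / fact n * (rGamma (a + 1 + real n) * z ^ n)) sums bessel_clifford a z"
proof -
  note V = loop_integral_eq_line_minus_three_halves[OF z a, of "\<lambda>_. 1" 1, simplified mult_1_left]
  show "integrable lborel (\<lambda>y. f (Complex (-3/2) y))"
    unfolding f_def using V(1) by auto
  define h where "h = (\<lambda>u::complex. rGamma (of_real (a + 1) - u) * of_real z powr (-u))"
  obtain C where C: "C > 0" "\<And>u. Re u \<le> a + 1 - 1 \<Longrightarrow> \<bar>Im u\<bar> \<le> 1 \<Longrightarrow>
       norm (h u) \<le> C / (1 + (Re u)\<^sup>2)"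
    unfolding h_def using rGamma_powr_strip_decay[OF z] by blast
  have hol: "h holomorphic_on UNIV"
    unfolding h_def using z by (intro holomorphic_intros) auto
  have "(\<lambda>n. (-1) ^ n / fact n * h (- (of_real 0 + of_nat n))) sums
    (1 / (2 * of_real pi * \<i>) * loop_integral 0 (\<lambda>u. Gamma (u + of_real 0) * h u))"
    using loop_integral_Gamma_sums[OF hol C(2)] .
  also have "(\<lambda>u. Gamma (u + of_real 0) * h u) = f" by (simp add: h_def f_def)
  also have "(\<lambda>n. (-1) ^ n / fact n * h (- (of_real 0 + of_nat n)))
     = (\<lambda>n. complex_of_real ((-1) ^ n / fact n * (rGamma (a + 1 + real n) * z ^ n)))"
  proof
    fix n
    have 1: "of_real (a + 1) - (- (of_real 0 + of_nat n)) = complex_of_real (a + 1 + real n)" by simp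
    have 2: "complex_of_real z powr (- (- (of_real 0 + of_nat n))) = of_real (z ^ n)"
      using z by (simp add: powr_nat')
    show "(-1) ^ n / fact n * h (- (of_real 0 + of_nat n))
        = complex_of_real ((-1) ^ n / fact n * (rGamma (a + 1 + real n) * z ^ n))"
      unfolding h_def 1 2 rGamma_complex_of_real
      by (simp only: of_real_mult of_real_divide of_real_power of_real_minus of_real_1 of_real_fact mult.assoc)
  qed
  finally have S: "(\<lambda>n. complex_of_real ((-1) ^ n / fact n * (rGamma (a + 1 + real n) * z ^ n))) sums
     (1 / (2 * of_real pi * \<i>) * loop_integral 0 f)" .
  then have "summable (\<lambda>n. complex_of_real ((-1) ^ n / fact n * (rGamma (a + 1 + real n) * z ^ n)))"
    by (rule sums_summable)
  then have "summable (\<lambda>n. (-1) ^ n / fact n * (rGamma (a + 1 + real n) * z ^ n))"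
    by (simp only: summable_complex_of_real)
  then show R: "(\<lambda>n. (-1) ^ n / fact n * (rGamma (a + 1 + real n) * z ^ n)) sums bessel_clifford a z"
    unfolding bessel_clifford_def by (rule summable_sums)
  then have "(\<lambda>n. complex_of_real ((-1) ^ n / fact n * (rGamma (a + 1 + real n) * z ^ n))) sums
     of_real (bessel_clifford a z)" by (simp only: sums_of_real)
  with S have "of_real (bessel_clifford a z) = 1 / (2 * of_real pi * \<i>) * loop_integral 0 f"
    by (rule sums_unique2[symmetric])
  also have "\<dots> = of_real (rGamma (a + 1))
        - of_real (rGamma (a + 2) * z) + 1 / (2 * of_real pi) * (LBINT y. f (Complex (-3/2) y))"
    using V(2)[of 0] unfolding f_def by simp
  finally show ?formula .
qed

text \<open>
  For \<open>b \<ge> 2\<close> the poles \<open>-b - n\<close> of \<open>\<Gamma>(u + b)\<close> stay to the left of \<open>-3/2\<close>, so only the poles \<open>0\<close> and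
  \<open>-1\<close> are crossed, also when \<open>b\<close> is an integer.
\<close>

lemma meijer_H_tilde_b_vertical:
  assumes z: "z > 0" and a: "a > -1" and b: "b \<ge> 2"
  defines "f \<equiv> \<lambda>u. Gamma u * (Gamma (u + of_real b) * (rGamma (of_real (a + 1) - u) * of_real z powr (-u)))"
  shows "integrable lborel (\<lambda>y. f (Complex (-3/2) y))"
    and "meijer_H_tilde (a + b) b z = of_real (Gamma b * rGamma (a + 1))
        - of_real (Gamma (b - 1) * rGamma (a + 2) * z) + 1 / (2 * of_real pi) * (LBINT y. f (Complex (-3/2) y))" (is ?formula)
proof -
  obtain C where C: "C > 0" "\<And>u. Re u \<le> -3/2 + b \<Longrightarrow> \<bar>Im u\<bar> \<ge> 1 \<Longrightarrow> norm (Gamma u) \<le> C / (Im u)\<^sup>2"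
    using norm_Gamma_decay by blast
  have K: "norm (Gamma (u + of_real b)) \<le> C" if "Re u \<le> -3/2" "\<bar>Im u\<bar> \<ge> 1" for u
  proof -
    have "norm (Gamma (u + of_real b)) \<le> C / (Im u)\<^sup>2" using C(2)[of "u + of_real b"] that by simp
    also have "1 \<le> (Im u)\<^sup>2" using that(2) by (metis one_le_power power2_abs)
    then have "C / (Im u)\<^sup>2 \<le> C / 1" using C(1) by (intro divide_left_mono) auto
    finally show ?thesis by simp
  qed
  have hol: "(\<lambda>u. Gamma (u + of_real b)) holomorphic_on {u. Im u \<noteq> 0 \<or> Re u > -2}"
  proof (intro holomorphic_intros)
    fix u assume "u \<in> {u. Im u \<noteq> 0 \<or> Re u > -2}"
    then have "Im (u + of_real b) \<noteq> 0 \<or> Re (u + of_real b) > 0" using b by auto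
    then show "u + of_real b \<notin> \<int>\<^sub>\<le>\<^sub>0"
      using nonpos_Ints_complexD[of "u + of_real b"] by auto
  qed
  show "integrable lborel (\<lambda>y. f (Complex (-3/2) y))"
    unfolding f_def by (rule loop_integral_eq_line_minus_three_halves(1)[OF z a hol K])
  have e0: "Gamma (0 + complex_of_real b) = of_real (Gamma b)"
    by (simp add: Gamma_complex_of_real)
  have e1: "Gamma (-1 + complex_of_real b) = of_real (Gamma (b - 1))"
  proof -
    have "-1 + complex_of_real b = of_real (b - 1)" by simp
    then show ?thesis by (simp only: Gamma_complex_of_real)
  qed
  have "f = (\<lambda>u. Gamma u * Gamma (u + of_real b) / Gamma (of_real (a + b - b + 1) - u) * of_real z powr (-u))"
    by (rule ext) (simp add: f_def rGamma_inverse_Gamma divide_inverse mult.assoc)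
  then have "meijer_H_tilde (a + b) b z = 1 / (2 * of_real pi * \<i>) * loop_integral b f"
    unfolding meijer_H_tilde_def by (simp only:)
  also have "\<dots> = of_real (Gamma b * rGamma (a + 1))
        - of_real (Gamma (b - 1) * rGamma (a + 2) * z) + 1 / (2 * of_real pi) * (LBINT y. f (Complex (-3/2) y))"
    using loop_integral_eq_line_minus_three_halves(2)[OF z a hol K, of b]
    unfolding f_def e0 e1 by (simp only: of_real_mult mult.assoc)
  finally show ?formula .
qed

text \<open>
  The line \<open>Re u = s\<close> lies to the right of all poles, so there is no residue. On it
  \<open>\<Gamma>(u + a) / \<Gamma>(b + 1 - u)\<close> is at most its value at \<open>u = s\<close>, which carries the whole dependence on \<open>b\<close>,
  and \<open>\<Gamma>(u)\<close> is integrable.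
\<close>

lemma meijer_H_tilde_a_bound:
  assumes a: "a > -1" and s: "0 < s" "-a < s" "s < 1"
  obtains C where "C > 0" "\<And>b z. b \<ge> 3 \<Longrightarrow> b \<ge> a + 1 \<Longrightarrow> z > 0 \<Longrightarrow>
    norm (meijer_H_tilde (a + b) a z) \<le> C / Gamma (b + 1 - s) * z powr (-s)"
proof -
  have cont: "continuous_on UNIV (\<lambda>y. Gamma (Complex s y))"
  proof -
    have "Gamma holomorphic_on {u. Re u > 0}"
      by (rule holomorphic_Gamma) (auto dest: nonpos_Ints_complexD)
    then have 1: "continuous_on {u. Re u > 0} (Gamma :: complex \<Rightarrow> complex)"
      by (rule holomorphic_on_imp_continuous_on)
    have 2: "continuous_on UNIV (\<lambda>y. Complex s y)"
      unfolding Complex_eq by (intro continuous_intros)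
    show ?thesis by (rule continuous_on_compose2[OF 1 2]) (use s in auto)
  qed
  obtain C0 where C0: "C0 > 0" "\<And>u. Re u \<le> s \<Longrightarrow> \<bar>Im u\<bar> \<ge> 1 \<Longrightarrow> norm (Gamma u) \<le> C0 / (Im u)\<^sup>2"
    using norm_Gamma_decay by blast
  have "integrable lborel (\<lambda>y. Gamma (Complex s y))"
    by (rule integrable_inverse_quadratic_bound[OF cont, of C0]) (use C0(2)[of "Complex s _"] in auto)
  then have int: "integrable lborel (\<lambda>y. norm (Gamma (Complex s y)))" by (rule integrable_norm)
  define I where "I = (LBINT y. norm (Gamma (Complex s y)))"
  have I: "I \<ge> 0" unfolding I_def by simp
  have Gs: "Gamma (s + a) > 0" using s by (intro Gamma_real_pos) simp
  show ?thesis
  proof (rule that[of "(I + 1) * Gamma (s + a)"])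
    show "(I + 1) * Gamma (s + a) > 0" using I Gs by simp
    fix b z :: real
    assume b: "b \<ge> 3" "b \<ge> a + 1" and z: "z > 0"
    define f where "f = (\<lambda>u::complex. Gamma u * Gamma (u + of_real a) * (rGamma (of_real (b + 1) - u) * of_real z powr (-u)))"
    obtain C1 where C1: "C1 > 0" "\<And>u. Re u \<le> s \<Longrightarrow> \<bar>Im u\<bar> \<ge> 1 \<Longrightarrow>
       norm (Gamma u * rGamma (of_real (b+1) - u)) \<le> C1 / ((Im u)\<^sup>2 * Gamma (b + 1 - Re u))"
      using norm_Gamma_rGamma_decay[of s "b + 1"] b s by auto
    obtain C2 where C2: "C2 > 0" "\<And>x. x \<le> s \<Longrightarrow> z powr (-x) / Gamma (b + 1 - x) \<le> C2 / (1 + x\<^sup>2)"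
      using powr_over_Gamma_decay[OF z, of "b + 1" s] b s by auto
    obtain C3 where C3: "C3 > 0" "\<And>u. Re u \<le> s + a \<Longrightarrow> \<bar>Im u\<bar> \<ge> 1 \<Longrightarrow> norm (Gamma u) \<le> C3 / (Im u)\<^sup>2"
      using norm_Gamma_decay by blast
    have decay: "norm (f u) \<le> (C3 * C1 * C2) / ((1 + (Re u)\<^sup>2) * (Im u)\<^sup>2)"
      if u: "Re u \<le> s" "\<bar>Im u\<bar> \<ge> 1" for u
    proof -
      have "1 \<le> (Im u)\<^sup>2" using u(2) by (metis one_le_power power2_abs)
      then have "C3 / (Im u)\<^sup>2 \<le> C3 / 1" using C3(1) by (intro divide_left_mono) auto
      then have K: "norm (Gamma (u + of_real a)) \<le> C3" using C3(2)[of "u + of_real a"] u by simp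
      have "norm (f u) = norm (Gamma (u + of_real a)) * (norm (Gamma u * rGamma (of_real (b+1) - u)) * z powr (- Re u))"
        using z by (simp add: f_def norm_mult norm_of_real_powr)
      also have "\<dots> \<le> C3 * (C1 / ((Im u)\<^sup>2 * Gamma (b + 1 - Re u)) * z powr (- Re u))"
        using K C1(2)[OF u] C3(1) by (intro mult_mono mult_right_mono) auto
      also have "\<dots> = C3 * C1 / (Im u)\<^sup>2 * (z powr (- Re u) / Gamma (b + 1 - Re u))" by simp
      also have "\<dots> \<le> C3 * C1 / (Im u)\<^sup>2 * (C2 / (1 + (Re u)\<^sup>2))"
        using C2(2)[OF u(1)] C3(1) C1(1) by (intro mult_left_mono) auto
      finally show ?thesis by (simp add: mult_ac)
    qed
    have hol: "f holomorphic_on {u. Im u \<noteq> 0 \<or> Re u > max 0 (-a)} - {}"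
      unfolding f_def using z
      by (intro holomorphic_intros) (auto dest: nonpos_Ints_complexD)
    have s': "max 0 (-a) < s" "s < 1 + \<bar>a\<bar>" using s by auto
    have "loop_integral a f = 2 * of_real pi * \<i> * (\<Sum>p\<in>{}. residue f p) + \<i> * (LBINT y. f (Complex s y))"
      by (rule loop_integral_eq_vertical_integral(2)[OF s' _ _ hol decay]) auto
    moreover have "f = (\<lambda>u. Gamma u * Gamma (u + of_real a) / Gamma (of_real (a + b - a + 1) - u) * of_real z powr (-u))"
      by (rule ext) (simp add: f_def rGamma_inverse_Gamma divide_inverse mult.assoc)
    then have "meijer_H_tilde (a + b) a z = 1 / (2 * of_real pi * \<i>) * loop_integral a f"
      unfolding meijer_H_tilde_def by (simp only:)
    ultimately have H: "meijer_H_tilde (a + b) a z = 1 / (2 * of_real pi) * (LBINT y. f (Complex s y))"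
      using divide_two_pi_i[of 0] by simp
    define B where "B = Gamma (s + a) / Gamma (b + 1 - s) * z powr (-s)"
    have B: "B > 0" unfolding B_def using Gs b s z by simp
    have le: "norm (f (Complex s y)) \<le> norm (Gamma (Complex s y)) * B" for y
    proof -
      define w where "w = Complex (s + a) y"
      define r where "r = b + 1 - s - (s + a)"
      have mono: "norm (Gamma w) * Gamma (Re w + r) \<le> Gamma (Re w) * norm (Gamma (w + of_real r))"
        using b s by (intro norm_Gamma_quotient_mono) (auto simp: w_def r_def)
      have wr: "w + of_real r = cnj (of_real (b + 1) - Complex s y)"
        by (simp add: w_def r_def complex_eq_iff)
      have "norm (Gamma (w + of_real r)) = norm (Gamma (of_real (b + 1) - Complex s y))"
        by (simp only: wr cnj_Gamma[symmetric] complex_mod_cnj)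
      with mono have 1: "norm (Gamma w) * Gamma (b + 1 - s) \<le> Gamma (s + a) * norm (Gamma (of_real (b + 1) - Complex s y))"
        by (simp add: w_def r_def)
      have G1: "Gamma (b + 1 - s) > 0" using b s by simp
      have "Re (of_real (b + 1) - Complex s y) > 0" using b s by simp
      then have "of_real (b + 1) - Complex s y \<notin> \<int>\<^sub>\<le>\<^sub>0" using nonpos_Ints_complexD(2) not_le by blast
      then have G2: "norm (Gamma (of_real (b + 1) - Complex s y)) > 0" by (simp add: Gamma_eq_zero_iff)
      have 2: "norm (Gamma w) * norm (rGamma (of_real (b + 1) - Complex s y)) \<le> Gamma (s + a) / Gamma (b + 1 - s)"
      proof -
        have "norm (Gamma w) / norm (Gamma (of_real (b + 1) - Complex s y)) \<le> Gamma (s + a) / Gamma (b + 1 - s)"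
          using 1 G1 G2 by (subst frac_le_eq) (auto simp: divide_le_0_iff mult_ac)
        then show ?thesis by (simp only: rGamma_inverse_Gamma norm_inverse divide_inverse)
      qed
      have "Complex s y + of_real a = w" by (simp add: w_def complex_eq_iff)
      then have "norm (f (Complex s y)) = norm (Gamma (Complex s y)) *
         ((norm (Gamma w) * norm (rGamma (of_real (b + 1) - Complex s y))) * z powr (-s))"
        using z by (simp add: f_def norm_mult norm_of_real_powr)
      also have "\<dots> \<le> norm (Gamma (Complex s y)) * (Gamma (s + a) / Gamma (b + 1 - s) * z powr (-s))"
        using 2 by (intro mult_left_mono mult_right_mono) auto
      finally show ?thesis by (simp add: B_def)
    qed
    have intf: "integrable lborel (\<lambda>y. f (Complex s y))"
      by (rule loop_integral_eq_vertical_integral(1)[OF s' _ _ hol decay]) auto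
    have "norm (LBINT y. f (Complex s y)) \<le> (LBINT y. norm (Gamma (Complex s y)) * B)"
      by (rule Bochner_Integration.integral_norm_bound_integral[OF intf]) (use int le in auto)
    also have "\<dots> = I * B" by (simp add: I_def)
    finally have IB: "norm (LBINT y. f (Complex s y)) \<le> I * B" .
    have "norm (meijer_H_tilde (a + b) a z) = 1 / (2 * pi) * norm (LBINT y. f (Complex s y))"
      unfolding H norm_mult by (simp add: norm_divide norm_mult)
    also have "\<dots> \<le> 1 * (I * B)"
    proof (rule mult_mono[OF _ IB])
      show "1 / (2 * pi) \<le> 1" using pi_ge_two by (simp add: divide_le_eq)
    qed auto
    also have "\<dots> \<le> (I + 1) * B" using B by (simp add: algebra_simps)
    finally show "norm (meijer_H_tilde (a + b) a z) \<le> (I + 1) * Gamma (s + a) / Gamma (b + 1 - s) * z powr (-s)"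
      by (simp add: B_def)
  qed
qed

section \<open>Quotients of Gamma functions with a large argument\<close>

text \<open>
  \<open>\<Gamma>(b + z) / (\<Gamma>(b) b\<^sup>z)\<close>, for real and for complex \<open>z\<close>. It equals the mean of \<open>(Y / b)\<^sup>z\<close> for a random
  variable \<open>Y\<close> with the Gamma distribution of shape \<open>b\<close>, and tends to \<open>1\<close>.
\<close>

definition Gamma_shift_ratio :: "real \<Rightarrow> 'a \<Rightarrow> 'a :: {Gamma, ln}" where
  "Gamma_shift_ratio b z = Gamma (of_real b + z) / (of_real (Gamma b) * of_real b powr z)"

lemma Gamma_real_plus1: "x > 0 \<Longrightarrow> Gamma (x + 1) = x * Gamma (x :: real)"
  by (rule Gamma_plus1) (auto elim!: nonpos_Ints_cases)

text \<open>
  Log-convexity of \<open>\<Gamma>\<close>, used once between \<open>b\<close> and \<open>b + 1\<close> and once between \<open>b + s\<close> and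
  \<open>b + s + 1\<close>.
\<close>

lemma Gamma_real_Wendel:
  fixes b s :: real
  assumes b: "b > 0" and s: "0 \<le> s" "s \<le> 1"
  shows "ln (Gamma (b + s)) \<le> ln (Gamma b) + s * ln b"
    and "ln (Gamma b) + ln b - (1 - s) * ln (b + s) \<le> ln (Gamma (b + s))"
proof -
  note conv = convex_onD[OF log_convex_Gamma_real, simplified]
  have pos: "Gamma b > 0" "Gamma (b + s) > 0" "b + s > 0" using b s by auto
  then have nz: "Gamma b \<noteq> 0" "Gamma (b + s) \<noteq> 0" by linarith+
  have "ln (Gamma ((1 - s) * b + s * (b + 1))) \<le> (1 - s) * ln (Gamma b) + s * ln (Gamma (b + 1))"
    using conv[of s b "b + 1"] b s by simp
  also have "ln (Gamma (b + 1)) = ln b + ln (Gamma b)"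
    using b nz by (simp add: Gamma_real_plus1 ln_mult)
  also have "(1 - s) * b + s * (b + 1) = b + s" by (simp add: algebra_simps)
  finally show "ln (Gamma (b + s)) \<le> ln (Gamma b) + s * ln b" by (simp add: algebra_simps)
  have "ln (Gamma ((1 - (1 - s)) * (b + s) + (1 - s) * (b + s + 1)))
      \<le> (1 - (1 - s)) * ln (Gamma (b + s)) + (1 - s) * ln (Gamma (b + s + 1))"
    using conv[of "1 - s" "b + s" "b + s + 1"] b s by simp
  also have "ln (Gamma (b + s + 1)) = ln (b + s) + ln (Gamma (b + s))"
    using pos nz by (simp add: Gamma_real_plus1 ln_mult)
  also have "(1 - (1 - s)) * (b + s) + (1 - s) * (b + s + 1) = b + 1" by (simp add: algebra_simps)
  also have "ln (Gamma (b + 1)) = ln b + ln (Gamma b)"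
    using b nz by (simp add: Gamma_real_plus1 ln_mult)
  finally show "ln (Gamma b) + ln b - (1 - s) * ln (b + s) \<le> ln (Gamma (b + s))"
    by (simp add: algebra_simps)
qed

lemma Gamma_shift_ratio_plus1:
  fixes b p :: real
  assumes "b > 0" "b + p > 0"
  shows "Gamma_shift_ratio b (p + 1) = Gamma_shift_ratio b p * ((b + p) / b)"
proof -
  have "Gamma (b + (p + 1)) = (b + p) * Gamma (b + p)"
    using Gamma_real_plus1[OF assms(2)] by (simp add: add.assoc)
  then show ?thesis
    using assms by (simp add: Gamma_shift_ratio_def powr_add mult_ac)
qed

text \<open>
  Wendel's inequalities settle \<open>0 \<le> p \<le> 1\<close>; the functional equation carries the limit to \<open>p + 1\<close> and to
  \<open>p - 1\<close>.
\<close>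

lemma tendsto_Gamma_shift_ratio_real:
  fixes p :: real
  shows "((\<lambda>b. Gamma_shift_ratio b p) \<longlongrightarrow> 1) at_top"
proof -
  have base: "((\<lambda>b. Gamma_shift_ratio b s) \<longlongrightarrow> 1) at_top" if s: "0 \<le> s" "s \<le> 1" for s :: real
  proof -
    have lim: "((\<lambda>b. ln (Gamma_shift_ratio b s)) \<longlongrightarrow> 0) at_top"
    proof (rule tendsto_sandwich)
      have lnQ: "ln (Gamma_shift_ratio b s) = ln (Gamma (b + s)) - ln (Gamma b) - s * ln b"
        if "b > 0" for b
      proof -
        have "Gamma b > 0" "Gamma (b + s) > 0" using that s by auto
        then have "Gamma b \<noteq> 0" "Gamma (b + s) \<noteq> 0" by linarith+
        then show ?thesis
          using that by (simp add: Gamma_shift_ratio_def ln_div ln_mult ln_powr)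
      qed
      show "eventually (\<lambda>b. (1 - s) * (ln b - ln (b + s)) \<le> ln (Gamma_shift_ratio b s)) at_top"
        using eventually_gt_at_top[of 0]
        by eventually_elim (use Gamma_real_Wendel(2)[OF _ s] lnQ in \<open>force simp: algebra_simps\<close>)
      show "eventually (\<lambda>b. ln (Gamma_shift_ratio b s) \<le> 0) at_top"
        using eventually_gt_at_top[of 0]
        by eventually_elim (use Gamma_real_Wendel(1)[OF _ s] lnQ in \<open>force simp: algebra_simps\<close>)
      have "((\<lambda>b. ln b - ln (b + s)) \<longlongrightarrow> 0) at_top" by real_asymp
      then show "((\<lambda>b. (1 - s) * (ln b - ln (b + s))) \<longlongrightarrow> 0) at_top"
        by (rule tendsto_mult_right_zero)
    qed auto
    have "((\<lambda>b. exp (ln (Gamma_shift_ratio b s))) \<longlongrightarrow> exp 0) at_top"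
      using lim by (rule tendsto_exp)
    moreover have "eventually (\<lambda>b. exp (ln (Gamma_shift_ratio b s)) = Gamma_shift_ratio b s) at_top"
      using eventually_gt_at_top[of 0]
    proof eventually_elim
      case (elim b)
      then have "Gamma_shift_ratio b s > 0"
        using s by (simp add: Gamma_shift_ratio_def)
      then show ?case by simp
    qed
    ultimately have "((\<lambda>b. Gamma_shift_ratio b s) \<longlongrightarrow> exp 0) at_top"
      by (rule Lim_transform_eventually)
    then show ?thesis unfolding exp_zero .
  qed
  have up: "((\<lambda>b. Gamma_shift_ratio b (q + 1)) \<longlongrightarrow> 1) at_top"
    if "((\<lambda>b. Gamma_shift_ratio b q) \<longlongrightarrow> 1) at_top" for q :: real
  proof -
    have "((\<lambda>b. (b + q) / b) \<longlongrightarrow> 1) at_top" by real_asymp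
    from tendsto_mult[OF that this]
    have "((\<lambda>b. Gamma_shift_ratio b q * ((b + q) / b)) \<longlongrightarrow> 1) at_top" by simp
    moreover have "eventually (\<lambda>b. Gamma_shift_ratio b q * ((b + q) / b) = Gamma_shift_ratio b (q + 1)) at_top"
      using eventually_gt_at_top[of 0] eventually_gt_at_top[of "-q"]
      by eventually_elim (simp add: Gamma_shift_ratio_plus1)
    ultimately show ?thesis by (rule Lim_transform_eventually)
  qed
  have down: "((\<lambda>b. Gamma_shift_ratio b q) \<longlongrightarrow> 1) at_top"
    if "((\<lambda>b. Gamma_shift_ratio b (q + 1)) \<longlongrightarrow> 1) at_top" for q :: real
  proof -
    have "((\<lambda>b. b / (b + q)) \<longlongrightarrow> 1) at_top" by real_asymp
    from tendsto_mult[OF that this]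
    have "((\<lambda>b. Gamma_shift_ratio b (q + 1) * (b / (b + q))) \<longlongrightarrow> 1) at_top" by simp
    moreover have "eventually (\<lambda>b. Gamma_shift_ratio b (q + 1) * (b / (b + q)) = Gamma_shift_ratio b q) at_top"
      using eventually_gt_at_top[of 0] eventually_gt_at_top[of "-q"]
      by eventually_elim (simp add: Gamma_shift_ratio_plus1)
    ultimately show ?thesis by (rule Lim_transform_eventually)
  qed
  define s where "s = frac p"
  have s: "0 \<le> s" "s \<le> 1" using frac_ge_0[of p] frac_lt_1[of p] unfolding s_def by linarith+
  have plus: "((\<lambda>b. Gamma_shift_ratio b (s + real n)) \<longlongrightarrow> 1) at_top" for n
  proof (induction n)
    case 0
    show ?case using base[OF s] by simp
  next
    case (Suc n)
    have "s + real (Suc n) = s + real n + 1" by simp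
    with up[OF Suc] show ?case by (simp only:)
  qed
  have minus: "((\<lambda>b. Gamma_shift_ratio b (s - real n)) \<longlongrightarrow> 1) at_top" for n
  proof (induction n)
    case 0
    show ?case using base[OF s] by simp
  next
    case (Suc n)
    have "s - real n = s - real (Suc n) + 1" by simp
    with Suc have "((\<lambda>b. Gamma_shift_ratio b (s - real (Suc n) + 1)) \<longlongrightarrow> 1) at_top" by (simp only:)
    then show ?case by (rule down)
  qed
  have "p = s + real_of_int \<lfloor>p\<rfloor>" by (simp add: s_def frac_def)
  then show ?thesis
    using plus[of "nat \<lfloor>p\<rfloor>"] minus[of "nat (- \<lfloor>p\<rfloor>)"] by (cases "\<lfloor>p\<rfloor> \<ge> 0") auto
qed

lemma norm_Gamma_shift_ratio_le:
  fixes z :: complex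
  assumes "b > 0" "b + Re z > 0"
  shows "norm (Gamma_shift_ratio b z) \<le> Gamma_shift_ratio b (Re z)"
proof -
  have "norm (Gamma (of_real b + z)) \<le> Gamma (b + Re z)"
    using norm_Gamma_le_Gamma_Re[of "of_real b + z"] assms by simp
  then show ?thesis
    using assms by (simp add: Gamma_shift_ratio_def norm_divide norm_mult norm_of_real_powr divide_right_mono)
qed

lemma of_real_powr_conv_exp:
  assumes "x > 0"
  shows "complex_of_real x powr z = exp (z * of_real (ln x))"
  using assms by (simp add: powr_def Ln_of_real)

lemma Gamma_shift_ratio_of_real:
  assumes "b > 0"
  shows "Gamma_shift_ratio b (complex_of_real p) = of_real (Gamma_shift_ratio b p)"
proof -
  have "complex_of_real b powr of_real p = of_real (b powr p)"
    using assms by (intro powr_of_real) simp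
  moreover have "Gamma (of_real b + complex_of_real p) = of_real (Gamma (b + p))"
    by (simp only: of_real_add[symmetric] Gamma_complex_of_real)
  ultimately show ?thesis unfolding Gamma_shift_ratio_def by simp
qed

text \<open>
  Euler's integral, arranged as \<open>\<Gamma>(b)\<close> times the mean of \<open>(Y / b)\<^sup>z\<close>.
\<close>

lemma has_integral_Gamma_shift_ratio_complex:
  fixes z :: complex
  assumes b: "b > 0" "b + Re z > 0"
  shows "((\<lambda>t. of_real (t powr (b - 1) / exp t) * of_real (t / b) powr z)
           has_integral of_real (Gamma b) * Gamma_shift_ratio b z) {0<..}"
proof -
  have "((\<lambda>t. of_real t powr (of_real b + z - 1) / of_real (exp t)) has_integral Gamma (of_real b + z)) {0<..}"
    by (rule Gamma_integral_complex') (use b in simp)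
  then have "((\<lambda>t. of_real t powr (of_real b + z - 1) / of_real (exp t) * (1 / of_real b powr z))
      has_integral Gamma (of_real b + z) * (1 / of_real b powr z)) {0<..}"
    by (rule has_integral_mult_left)
  moreover have "Gamma (of_real b + z) * (1 / of_real b powr z) = of_real (Gamma b) * Gamma_shift_ratio b z"
  proof -
    have "Gamma b \<noteq> 0" using Gamma_real_pos[OF b(1)] by linarith
    then show ?thesis by (simp add: Gamma_shift_ratio_def)
  qed
  ultimately have I: "((\<lambda>t. of_real t powr (of_real b + z - 1) / of_real (exp t) * (1 / of_real b powr z))
      has_integral of_real (Gamma b) * Gamma_shift_ratio b z) {0<..}" by simp
  show ?thesis
  proof (rule has_integral_eq[OF _ I])
    fix t :: real
    assume "t \<in> {0<..}"
    then have t: "t > 0" by simp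
    have e1: "(of_real b + z - 1) * of_real (ln t) = of_real ((b - 1) * ln t) + z * of_real (ln t)"
      by (simp add: algebra_simps)
    have e2: "z * of_real (ln (t / b)) = z * of_real (ln t) - z * of_real (ln b)"
      using t b by (simp add: ln_div algebra_simps)
    have "t powr (b - 1) = exp ((b - 1) * ln t)" using t by (simp add: powr_def)
    then have e3: "complex_of_real (t powr (b - 1) / exp t) = exp (of_real ((b - 1) * ln t)) / of_real (exp t)"
      by (simp only: of_real_divide exp_of_real)
    have tb: "t / b > 0" using t b by simp
    show "of_real t powr (of_real b + z - 1) / of_real (exp t) * (1 / of_real b powr z)
        = of_real (t powr (b - 1) / exp t) * of_real (t / b) powr z"
      unfolding of_real_powr_conv_exp[OF t] of_real_powr_conv_exp[OF tb] of_real_powr_conv_exp[OF b(1)]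
        e1 e2 e3 exp_add exp_diff
      by simp
  qed
qed

lemma has_integral_Gamma_shift_ratio_real:
  fixes p :: real
  assumes b: "b > 0" "b + p > 0"
  shows "((\<lambda>t. (t powr (b - 1) / exp t) * (t / b) powr p) has_integral Gamma b * Gamma_shift_ratio b p) {0<..}"
proof -
  have "((\<lambda>t. of_real (t powr (b - 1) / exp t) * of_real (t / b) powr of_real p)
           has_integral of_real (Gamma b) * Gamma_shift_ratio b (complex_of_real p)) {0<..}"
    by (rule has_integral_Gamma_shift_ratio_complex) (use b in auto)
  from has_integral_linear[OF this bounded_linear_Re]
  have "((\<lambda>t. Re (of_real (t powr (b - 1) / exp t) * of_real (t / b) powr of_real p))
           has_integral Gamma b * Gamma_shift_ratio b p) {0<..}"
    by (simp add: o_def Gamma_shift_ratio_of_real[OF b(1)] flip: of_real_mult)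
  then show ?thesis
  proof (rule has_integral_eq[rotated])
    fix t :: real
    assume "t \<in> {0<..}"
    then have "complex_of_real (t / b) powr of_real p = of_real ((t / b) powr p)"
      using b by (intro powr_of_real) auto
    then show "Re (of_real (t powr (b - 1) / exp t) * of_real (t / b) powr of_real p)
        = (t powr (b - 1) / exp t) * (t / b) powr p"
      by (simp only: of_real_mult[symmetric] Re_complex_of_real)
  qed
qed

text \<open>
  Chebyshev's argument: \<open>\<bar>w\<^sup>z - 1\<bar>\<close> is small for \<open>w\<close> near \<open>1\<close>, and elsewhere it is at most
  \<open>1 + w\<^sup>\<sigma>\<close> with \<open>\<sigma> = Re z\<close>, hence at most \<open>(1 + w\<^sup>\<sigma>) (w - 1)\<^sup>2 / d\<^sup>2\<close>. The mean of this expression at \<open>w = Y / b\<close>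
  is a combination of real ratios, and its limit is \<open>0\<close> because the coefficients of \<open>(w - 1)\<^sup>2\<close> add up to \<open>0\<close>.
\<close>

lemma tendsto_Gamma_shift_ratio_complex:
  fixes z :: complex
  shows "((\<lambda>b. Gamma_shift_ratio b z) \<longlongrightarrow> 1) at_top"
proof (rule tendstoI)
  fix e :: real
  assume e: "e > 0"
  define \<sigma> where "\<sigma> = Re z"
  have "((\<lambda>w. exp (z * complex_of_real (ln w))) \<longlongrightarrow> exp (z * complex_of_real (ln 1))) (at 1)"
    by (intro tendsto_intros) auto
  then have "eventually (\<lambda>w. dist (exp (z * complex_of_real (ln w))) 1 < e / 2) (at 1)"
    using e by (intro tendstoD) simp_all
  then obtain d where d: "d > 0"
    "\<And>w::real. w \<noteq> 1 \<Longrightarrow> dist w 1 < d \<Longrightarrow> dist (exp (z * complex_of_real (ln w))) 1 < e / 2"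
    by (auto simp: eventually_at)
  define R where "R = (\<lambda>b. (Gamma_shift_ratio b 2 - 2 * Gamma_shift_ratio b 1 + Gamma_shift_ratio b 0)
    + (Gamma_shift_ratio b (\<sigma> + 2) - 2 * Gamma_shift_ratio b (\<sigma> + 1) + Gamma_shift_ratio b \<sigma>))"
  have R0: "((\<lambda>b. e / 2 * Gamma_shift_ratio b 0 + R b / d\<^sup>2) \<longlongrightarrow> e / 2 * 1 + ((1 - 2 * 1 + 1) + (1 - 2 * 1 + 1)) / d\<^sup>2) at_top"
    unfolding R_def by (intro tendsto_intros tendsto_Gamma_shift_ratio_real) (use d in auto)
  have "e / 2 * 1 + ((1 - 2 * 1 + 1) + (1 - 2 * 1 + 1)) / d\<^sup>2 < e" using e by simp
  from order_tendstoD(2)[OF R0 this]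
  have ev: "eventually (\<lambda>b. e / 2 * Gamma_shift_ratio b 0 + R b / d\<^sup>2 < e) at_top" .
  have pw: "norm (complex_of_real w powr z - 1) \<le> e / 2 * w powr 0
      + ((w powr 2 - 2 * w powr 1 + w powr 0) + (w powr (\<sigma> + 2) - 2 * w powr (\<sigma> + 1) + w powr \<sigma>)) / d\<^sup>2"
    if w: "w > 0" for w
  proof -
    have sq: "(w powr 2 - 2 * w powr 1 + w powr 0) + (w powr (\<sigma> + 2) - 2 * w powr (\<sigma> + 1) + w powr \<sigma>)
        = (1 + w powr \<sigma>) * (w - 1)\<^sup>2"
    proof -
      have "w powr 2 = w * w" using w by (simp add: powr_numeral power2_eq_square)
      then show ?thesis using w by (simp add: powr_add power2_eq_square algebra_simps)
    qed
    show ?thesis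
      unfolding sq
    proof (cases "\<bar>w - 1\<bar> < d")
      case True
      have "norm (complex_of_real w powr z - 1) \<le> e / 2"
      proof (cases "w = 1")
        case False
        then show ?thesis
          using d(2)[of w] True w by (simp add: dist_norm of_real_powr_conv_exp)
      qed (use e in simp)
      moreover have "0 \<le> (1 + w powr \<sigma>) * (w - 1)\<^sup>2 / d\<^sup>2" by simp
      moreover have w0: "w powr 0 = 1" using w by simp
      ultimately show "norm (complex_of_real w powr z - 1) \<le> e / 2 * w powr 0 + (1 + w powr \<sigma>) * (w - 1)\<^sup>2 / d\<^sup>2"
        unfolding w0 mult_1_right by linarith
    next
      case False
      have "d\<^sup>2 \<le> \<bar>w - 1\<bar>\<^sup>2" using False d(1) by (intro power_mono) auto
      then have "1 \<le> (w - 1)\<^sup>2 / d\<^sup>2" using d(1) by simp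
      then have 1: "(1 + w powr \<sigma>) * 1 \<le> (1 + w powr \<sigma>) * ((w - 1)\<^sup>2 / d\<^sup>2)"
        by (intro mult_left_mono) auto
      have "norm (complex_of_real w powr z - 1) \<le> norm (complex_of_real w powr z) + norm (1::complex)"
        by (rule norm_triangle_ineq4)
      also have "\<dots> = w powr \<sigma> + 1" using w by (simp add: norm_of_real_powr \<sigma>_def)
      finally show "norm (complex_of_real w powr z - 1) \<le> e / 2 * w powr 0 + (1 + w powr \<sigma>) * (w - 1)\<^sup>2 / d\<^sup>2"
        using 1 w e by simp
    qed
  qed
  have distr: "x * (E * w0 + ((w2 - 2 * w1 + w0) + (v2 - 2 * v1 + v0)) / D)
     = E * (x * w0) + ((x * w2 - 2 * (x * w1) + x * w0) + (x * v2 - 2 * (x * v1) + x * v0)) / D"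
    for x E w0 w1 w2 v0 v1 v2 D :: real
    unfolding divide_inverse by (simp add: distrib_left distrib_right left_diff_distrib right_diff_distrib mult.assoc mult.left_commute)
  show "eventually (\<lambda>b. dist (Gamma_shift_ratio b z) 1 < e) at_top"
    using ev eventually_gt_at_top[of 0] eventually_gt_at_top[of "- \<sigma>"]
  proof eventually_elim
    case (elim b)
    then have b: "b > 0" "b + \<sigma> > 0" by auto
    define F where "F = (\<lambda>t. t powr (b - 1) / exp t)"
    have F: "F t \<ge> 0" for t by (simp add: F_def)
    have G: "Gamma b > 0" using b by simp
    have IR: "((\<lambda>t. F t * (t / b) powr p) has_integral Gamma b * Gamma_shift_ratio b p) {0<..}" if "b + p > 0" for p
      unfolding F_def by (rule has_integral_Gamma_shift_ratio_real[OF b(1) that])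
    have I1: "((\<lambda>t. of_real (F t) * (of_real (t / b) powr z - 1)) has_integral of_real (Gamma b) * (Gamma_shift_ratio b z - 1)) {0<..}"
    proof -
      have "((\<lambda>t. of_real (F t) * of_real (t / b) powr z) has_integral of_real (Gamma b) * Gamma_shift_ratio b z) {0<..}"
        unfolding F_def by (rule has_integral_Gamma_shift_ratio_complex) (use b in \<open>auto simp: \<sigma>_def\<close>)
      moreover have "((\<lambda>t. of_real (F t) * of_real (t / b) powr 0) has_integral complex_of_real (Gamma b) * Gamma_shift_ratio b 0) {0<..}"
        unfolding F_def by (rule has_integral_Gamma_shift_ratio_complex) (use b in auto)
      moreover have "Gamma b \<noteq> 0" using G by linarith
      then have "Gamma_shift_ratio b 0 = (1::complex)"
        using b by (simp add: Gamma_shift_ratio_def Gamma_complex_of_real)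
      ultimately have "((\<lambda>t. of_real (F t) * of_real (t / b) powr z - of_real (F t) * of_real (t / b) powr 0) has_integral
          of_real (Gamma b) * Gamma_shift_ratio b z - of_real (Gamma b) * 1) {0<..}"
        by (simp only: has_integral_diff)
      then have "((\<lambda>t. of_real (F t) * of_real (t / b) powr z - of_real (F t) * of_real (t / b) powr 0) has_integral
          of_real (Gamma b) * (Gamma_shift_ratio b z - 1)) {0<..}"
        by (simp only: right_diff_distrib)
      then show ?thesis
      proof (rule has_integral_eq[rotated])
        fix t :: real
        assume "t \<in> {0<..}"
        then have "complex_of_real (t / b) \<noteq> 0" using b by simp
        then have "complex_of_real (t / b) powr 0 = 1" by (simp add: powr_def)
        then show "of_real (F t) * of_real (t / b) powr z - of_real (F t) * of_real (t / b) powr 0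
           = of_real (F t) * (complex_of_real (t / b) powr z - 1)"
          by (simp only: right_diff_distrib)
      qed
    qed
    have I2: "((\<lambda>t. F t * (e / 2 * (t / b) powr 0 + (((t / b) powr 2 - 2 * (t / b) powr 1 + (t / b) powr 0)
        + ((t / b) powr (\<sigma> + 2) - 2 * (t / b) powr (\<sigma> + 1) + (t / b) powr \<sigma>)) / d\<^sup>2))
       has_integral Gamma b * (e / 2 * Gamma_shift_ratio b 0 + R b / d\<^sup>2)) {0<..}"
    proof -
      have "((\<lambda>t. e / 2 * (F t * (t / b) powr 0) + ((F t * (t / b) powr 2 - 2 * (F t * (t / b) powr 1) + F t * (t / b) powr 0)
        + (F t * (t / b) powr (\<sigma> + 2) - 2 * (F t * (t / b) powr (\<sigma> + 1)) + F t * (t / b) powr \<sigma>)) / d\<^sup>2)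
       has_integral e / 2 * (Gamma b * Gamma_shift_ratio b 0) + ((Gamma b * Gamma_shift_ratio b 2 - 2 * (Gamma b * Gamma_shift_ratio b 1) + Gamma b * Gamma_shift_ratio b 0)
        + (Gamma b * Gamma_shift_ratio b (\<sigma> + 2) - 2 * (Gamma b * Gamma_shift_ratio b (\<sigma> + 1)) + Gamma b * Gamma_shift_ratio b \<sigma>)) / d\<^sup>2) {0<..}"
      proof (rule has_integral_add[OF has_integral_mult_right has_integral_divide])
        show "((\<lambda>t. F t * (t / b) powr 0) has_integral Gamma b * Gamma_shift_ratio b 0) {0<..}"
          by (rule IR) (use b in simp)
        have A: "((\<lambda>t. F t * (t / b) powr (q + 2) - 2 * (F t * (t / b) powr (q + 1)) + F t * (t / b) powr q)
          has_integral Gamma b * Gamma_shift_ratio b (q + 2) - 2 * (Gamma b * Gamma_shift_ratio b (q + 1)) + Gamma b * Gamma_shift_ratio b q) {0<..}"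
          if "b + q > 0" for q
          by (rule has_integral_add[OF has_integral_diff[OF IR has_integral_mult_right[OF IR]] IR]) (use that in linarith)+
        from has_integral_add[OF A[of 0] A[of \<sigma>]] b
        show "((\<lambda>t. (F t * (t / b) powr 2 - 2 * (F t * (t / b) powr 1) + F t * (t / b) powr 0)
          + (F t * (t / b) powr (\<sigma> + 2) - 2 * (F t * (t / b) powr (\<sigma> + 1)) + F t * (t / b) powr \<sigma>))
          has_integral (Gamma b * Gamma_shift_ratio b 2 - 2 * (Gamma b * Gamma_shift_ratio b 1) + Gamma b * Gamma_shift_ratio b 0)
          + (Gamma b * Gamma_shift_ratio b (\<sigma> + 2) - 2 * (Gamma b * Gamma_shift_ratio b (\<sigma> + 1)) + Gamma b * Gamma_shift_ratio b \<sigma>)) {0<..}"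
          by (simp only: add_0 add_0_right)
      qed
      moreover have "e / 2 * (Gamma b * Gamma_shift_ratio b 0) + ((Gamma b * Gamma_shift_ratio b 2 - 2 * (Gamma b * Gamma_shift_ratio b 1) + Gamma b * Gamma_shift_ratio b 0)
        + (Gamma b * Gamma_shift_ratio b (\<sigma> + 2) - 2 * (Gamma b * Gamma_shift_ratio b (\<sigma> + 1)) + Gamma b * Gamma_shift_ratio b \<sigma>)) / d\<^sup>2
        = Gamma b * (e / 2 * Gamma_shift_ratio b 0 + R b / d\<^sup>2)"
        unfolding R_def by (rule distr[symmetric])
      ultimately show ?thesis
        by (simp only: distr)
    qed
    have "norm (integral {0<..} (\<lambda>t. of_real (F t) * (of_real (t / b) powr z - 1))) \<le>
       integral {0<..} (\<lambda>t. F t * (e / 2 * (t / b) powr 0 + (((t / b) powr 2 - 2 * (t / b) powr 1 + (t / b) powr 0)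
        + ((t / b) powr (\<sigma> + 2) - 2 * (t / b) powr (\<sigma> + 1) + (t / b) powr \<sigma>)) / d\<^sup>2))"
    proof (rule integral_norm_bound_integral)
      fix t :: real assume "t \<in> {0<..}"
      then have "t / b > 0" using b by simp
      from mult_left_mono[OF pw[OF this] F[of t]]
      show "norm (of_real (F t) * (of_real (t / b) powr z - 1)) \<le> F t * (e / 2 * (t / b) powr 0 + (((t / b) powr 2 - 2 * (t / b) powr 1 + (t / b) powr 0)
        + ((t / b) powr (\<sigma> + 2) - 2 * (t / b) powr (\<sigma> + 1) + (t / b) powr \<sigma>)) / d\<^sup>2)"
        using F[of t] unfolding norm_mult norm_of_real by simp
    qed (fact has_integral_integrable[OF I1] has_integral_integrable[OF I2])+
    then have "Gamma b * norm (Gamma_shift_ratio b z - 1) \<le> Gamma b * (e / 2 * Gamma_shift_ratio b 0 + R b / d\<^sup>2)"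
      unfolding integral_unique[OF I1] integral_unique[OF I2] norm_mult norm_of_real using G by simp
    then have "norm (Gamma_shift_ratio b z - 1) \<le> e / 2 * Gamma_shift_ratio b 0 + R b / d\<^sup>2"
      using G by (simp only: mult_le_cancel_left_pos)
    with elim show ?case by (simp add: dist_norm)
  qed
qed

section \<open>The Meijer functions for large b\<close>

lemma eventually_Gamma_shift_ratio_bounds:
  fixes p :: real
  shows "eventually (\<lambda>b. 1/2 < Gamma_shift_ratio b p \<and> Gamma_shift_ratio b p < 2) at_top"
  using order_tendstoD(1)[OF tendsto_Gamma_shift_ratio_real[of p], of "1/2"]
    order_tendstoD(2)[OF tendsto_Gamma_shift_ratio_real[of p], of 2]
  by (simp add: eventually_conj_iff)

lemma Gamma_shift_ratio_mult:
  fixes p :: real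
  assumes "b > 0"
  shows "Gamma (b + p) = Gamma_shift_ratio b p * Gamma b * b powr p"
proof -
  have "Gamma b \<noteq> 0" using Gamma_real_pos[OF assms] by linarith
  then show ?thesis using assms by (simp add: Gamma_shift_ratio_def)
qed

lemma norm_sums_le_exp:
  fixes f :: "nat \<Rightarrow> complex"
  assumes "f sums s" "\<And>n. norm (f n) \<le> c * (x ^ n / fact n)"
  shows "norm s \<le> c * exp x"
proof -
  have "(\<lambda>n. x ^ n /\<^sub>R fact n) sums exp x" by (rule exp_converges)
  then have "(\<lambda>n. x ^ n / fact n) sums exp x" by (simp add: divide_inverse mult.commute)
  then have e: "(\<lambda>n. c * (x ^ n / fact n)) sums (c * exp x)" by (rule sums_mult)
  have "norm (suminf f) \<le> (\<Sum>n. c * (x ^ n / fact n))"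
    by (rule norm_suminf_le) (use assms e sums_summable in auto)
  then show ?thesis using assms(1) e by (simp add: sums_iff)
qed

text \<open>
  Each of the \<open>n\<close> factors produced by the recursion is at least \<open>q\<close>.
\<close>

lemma Gamma_real_add_nat_ge:
  assumes "0 < q" "q \<le> (p::real)"
  shows "Gamma p * q ^ n \<le> Gamma (p + real n)"
proof (induction n)
  case (Suc n)
  have pos: "Gamma (p + real n) > 0" "p + real n > 0" using assms by (auto intro!: Gamma_real_pos)
  have "Gamma p * q ^ Suc n = q * (Gamma p * q ^ n)" by simp
  also have "\<dots> \<le> (p + real n) * Gamma (p + real n)"
    using Suc assms pos by (intro mult_mono) auto
  also have "\<dots> = Gamma (p + real n + 1)" using Gamma_real_plus1[OF pos(2)] by simp
  finally show ?case by (simp add: add_ac)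
qed simp

text \<open>
  In the line integral at \<open>b x\<close> the factor \<open>\<Gamma>(u + b) (b x)\<^sup>-\<^sup>u\<close> equals \<open>\<Gamma>(b) x\<^sup>-\<^sup>u\<close> times a ratio that tends
  to \<open>1\<close>.
\<close>

lemma meijer_H_tilde_b_rescaled:
  assumes a: "a > -1" and b: "b \<ge> 2" and x: "x > 0"
  defines "g \<equiv> \<lambda>u. Gamma u * (rGamma (of_real (a + 1) - u) * of_real x powr (-u))"
  shows "integrable lborel (\<lambda>y. g (Complex (-3/2) y) * Gamma_shift_ratio b (Complex (-3/2) y))" (is ?integrable)
    and "meijer_H_tilde (a + b) b (b * x) / of_real (Gamma b) = of_real (rGamma (a + 1))
        - of_real (Gamma_shift_ratio b (-1) * rGamma (a + 2) * x)
        + 1 / (2 * of_real pi) * (LBINT y. g (Complex (-3/2) y) * Gamma_shift_ratio b (Complex (-3/2) y))" (is ?formula)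
proof -
  define G where "G = complex_of_real (Gamma b)"
  have G: "Gamma b \<noteq> 0" "G \<noteq> 0" using Gamma_real_pos[of b] b unfolding G_def of_real_eq_0_iff by linarith+
  have bx: "b * x > 0" using b x by simp
  have b0: "b > 0" using b by simp
  define f where "f = (\<lambda>u::complex. Gamma u * (Gamma (u + of_real b) * (rGamma (of_real (a + 1) - u) * of_real (b * x) powr (-u))))"
  have f: "f u = G * (g u * Gamma_shift_ratio b u)" for u
  proof -
    have "- u * of_real (ln (b * x)) = - u * of_real (ln x) - u * of_real (ln b)"
      using b0 x by (simp add: ln_mult algebra_simps)
    then have "of_real (b * x) powr (-u) = of_real x powr (-u) / of_real b powr u"
      unfolding of_real_powr_conv_exp[OF bx] of_real_powr_conv_exp[OF x] of_real_powr_conv_exp[OF b0]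
      by (simp only: exp_diff)
    then show ?thesis
      using G unfolding f_def g_def Gamma_shift_ratio_def G_def[symmetric]
      by (simp add: add.commute)
  qed
  have V: "integrable lborel (\<lambda>y. f (Complex (-3/2) y))"
    "meijer_H_tilde (a + b) b (b * x) = of_real (Gamma b * rGamma (a + 1))
        - of_real (Gamma (b - 1) * rGamma (a + 2) * (b * x)) + 1 / (2 * of_real pi) * (LBINT y. f (Complex (-3/2) y))"
    unfolding f_def by (rule meijer_H_tilde_b_vertical[OF bx a b])+
  have "integrable lborel (\<lambda>y. f (Complex (-3/2) y) / G)"
    using V(1) by (rule integrable_divide)
  then show ?integrable
    unfolding f using G by simp
  have r1: "Gamma (b - 1) * b = Gamma_shift_ratio b (-1) * Gamma b"
    using Gamma_shift_ratio_mult[OF b0, of "-1"] b0 by (simp add: powr_minus_divide)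
  have "Gamma (b - 1) * rGamma (a + 2) * (b * x) = Gamma b * (Gamma_shift_ratio b (-1) * rGamma (a + 2) * x)"
  proof -
    have "Gamma (b - 1) * rGamma (a + 2) * (b * x) = (Gamma (b - 1) * b) * (rGamma (a + 2) * x)"
      by (simp only: mult_ac)
    then show ?thesis unfolding r1 by (simp only: mult_ac)
  qed
  then have "meijer_H_tilde (a + b) b (b * x) = G * of_real (rGamma (a + 1))
     - G * of_real (Gamma_shift_ratio b (-1) * rGamma (a + 2) * x)
     + 1 / (2 * of_real pi) * (LBINT y. G * (g (Complex (-3/2) y) * Gamma_shift_ratio b (Complex (-3/2) y)))"
    using V(2) unfolding f by (simp only: G_def of_real_mult)
  also have "(LBINT y. G * (g (Complex (-3/2) y) * Gamma_shift_ratio b (Complex (-3/2) y)))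
      = G * (LBINT y. g (Complex (-3/2) y) * Gamma_shift_ratio b (Complex (-3/2) y))"
    by (rule integral_mult_right_zero)
  finally have "meijer_H_tilde (a + b) b (b * x) = G * (of_real (rGamma (a + 1))
        - of_real (Gamma_shift_ratio b (-1) * rGamma (a + 2) * x)
        + 1 / (2 * of_real pi) * (LBINT y. g (Complex (-3/2) y) * Gamma_shift_ratio b (Complex (-3/2) y)))"
    by (simp only: distrib_left right_diff_distrib mult.left_commute)
  then show ?formula
    unfolding G_def[symmetric] using G(2) by (simp del: of_real_mult)
qed

lemma norm_line_integrand_le:
  assumes b: "b \<ge> 2" and x: "x > 0"
  shows "norm (Gamma (Complex (-3/2) y) * (rGamma (of_real (a + 1) - Complex (-3/2) y) * of_real x powr (- Complex (-3/2) y))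
            * Gamma_shift_ratio b (Complex (-3/2) y))
    \<le> norm (Gamma (Complex (-3/2) y) * rGamma (of_real (a + 1) - Complex (-3/2) y)) * (x powr (3/2) * Gamma_shift_ratio b (-3/2))"
proof -
  have "norm (Gamma_shift_ratio b (Complex (-3/2) y)) \<le> Gamma_shift_ratio b (-3/2)"
    using norm_Gamma_shift_ratio_le[of b "Complex (-3/2) y"] b by simp
  moreover have "norm (complex_of_real x powr (- Complex (-3/2) y)) = x powr (3/2)"
    using x by (simp add: norm_of_real_powr)
  ultimately have "norm (complex_of_real x powr (- Complex (-3/2) y)) * norm (Gamma_shift_ratio b (Complex (-3/2) y))
     \<le> x powr (3/2) * Gamma_shift_ratio b (-3/2)"
    by (simp only: mult_left_mono powr_ge_zero)
  then show ?thesis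
    unfolding norm_mult mult.assoc by (intro mult_left_mono norm_ge_zero)
qed

text \<open>
  Dominated convergence on the line; the modulus of the ratio at \<open>u\<close> is at most its value at
  \<open>Re u = -3/2\<close>, which is eventually below \<open>2\<close>.
\<close>

lemma tendsto_meijer_H_tilde_b:
  assumes a: "a > -1" and x: "x > 0"
  shows "((\<lambda>b. meijer_H_tilde (a + b) b (b * x) / of_real (Gamma b)) \<longlongrightarrow> of_real (bessel_clifford a x)) at_top"
proof -
  define g where "g = (\<lambda>u::complex. Gamma u * (rGamma (of_real (a + 1) - u) * of_real x powr (-u)))"
  define g1 where "g1 = (\<lambda>y. norm (Gamma (Complex (-3/2) y) * rGamma (of_real (a + 1) - Complex (-3/2) y)))"
  have int1: "integrable lborel g1"
    using bessel_clifford_vertical(1)[of 1 a] a unfolding g1_def by (simp add: powr_def)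
  \<comment> \<open>The dominated convergence theorem wants measurable functions for all \<open>b\<close>.\<close>
  define S where "S = (\<lambda>b y. if b \<ge> 2 then g (Complex (-3/2) y) * Gamma_shift_ratio b (Complex (-3/2) y) else 0)"
  have ig: "integrable lborel (\<lambda>y. g (Complex (-3/2) y))"
    unfolding g_def by (rule bessel_clifford_vertical(1)[OF x a])
  have "((\<lambda>b. LBINT y. S b y) \<longlongrightarrow> (LBINT y. g (Complex (-3/2) y))) at_top"
  proof (rule integral_dominated_convergence_at_top)
    show "(\<lambda>y. g (Complex (-3/2) y)) \<in> borel_measurable lborel"
      using ig by (rule borel_measurable_integrable)
    show "S b \<in> borel_measurable lborel" for b
    proof (cases "b \<ge> 2")
      case True
      from borel_measurable_integrable[OF meijer_H_tilde_b_rescaled(1)[OF a True x]] True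
      show ?thesis unfolding S_def g_def by (simp only: if_True)
    next
      case False
      then show ?thesis unfolding S_def by simp
    qed
    show "integrable lborel (\<lambda>y. g1 y * (x powr (3/2) * 2))"
      using int1 by (rule integrable_mult_left)
    show "AE y in lborel. ((\<lambda>b. S b y) \<longlongrightarrow> g (Complex (-3/2) y)) at_top"
    proof (rule AE_I2)
      fix y :: real
      have "((\<lambda>b. g (Complex (-3/2) y) * Gamma_shift_ratio b (Complex (-3/2) y)) \<longlongrightarrow> g (Complex (-3/2) y) * 1) at_top"
        by (intro tendsto_mult tendsto_const tendsto_Gamma_shift_ratio_complex)
      moreover have "eventually (\<lambda>b. g (Complex (-3/2) y) * Gamma_shift_ratio b (Complex (-3/2) y) = S b y) at_top"
        using eventually_ge_at_top[of 2] by eventually_elim (simp add: S_def)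
      ultimately have "((\<lambda>b. S b y) \<longlongrightarrow> g (Complex (-3/2) y) * 1) at_top"
        by (rule Lim_transform_eventually)
      then show "((\<lambda>b. S b y) \<longlongrightarrow> g (Complex (-3/2) y)) at_top" by simp
    qed
    show "eventually (\<lambda>b. AE y in lborel. norm (S b y) \<le> g1 y * (x powr (3/2) * 2)) at_top"
      using eventually_ge_at_top[of 2] eventually_Gamma_shift_ratio_bounds[of "-3/2"]
    proof eventually_elim
      case (elim b)
      show ?case
      proof (rule AE_I2)
        fix y :: real
        have "norm (S b y) \<le> g1 y * (x powr (3/2) * Gamma_shift_ratio b (-3/2))"
          using norm_line_integrand_le[OF elim(1) x, of y a] elim(1)
          unfolding S_def g_def g1_def by (simp only: if_True)
        also have "\<dots> \<le> g1 y * (x powr (3/2) * 2)"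
          using elim(2) unfolding g1_def by (intro mult_left_mono) auto
        finally show "norm (S b y) \<le> g1 y * (x powr (3/2) * 2)" .
      qed
    qed
  qed
  then have "((\<lambda>b. of_real (rGamma (a + 1)) - of_real (Gamma_shift_ratio b (-1) * rGamma (a + 2) * x)
      + 1 / (2 * of_real pi) * (LBINT y. S b y)) \<longlongrightarrow> of_real (rGamma (a + 1)) - of_real (1 * rGamma (a + 2) * x)
      + 1 / (2 * of_real pi) * (LBINT y. g (Complex (-3/2) y))) at_top"
    by (intro tendsto_add tendsto_diff tendsto_mult tendsto_of_real tendsto_const tendsto_Gamma_shift_ratio_real)
  also have "of_real (rGamma (a + 1)) - of_real (1 * rGamma (a + 2) * x)
      + 1 / (2 * of_real pi) * (LBINT y. g (Complex (-3/2) y)) = of_real (bessel_clifford a x)"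
    unfolding g_def bessel_clifford_vertical(2)[OF x a] by simp
  finally show ?thesis
  proof (rule Lim_transform_eventually)
    show "eventually (\<lambda>b. of_real (rGamma (a + 1)) - of_real (Gamma_shift_ratio b (-1) * rGamma (a + 2) * x)
      + 1 / (2 * of_real pi) * (LBINT y. S b y) = meijer_H_tilde (a + b) b (b * x) / of_real (Gamma b)) at_top"
      using eventually_ge_at_top[of 2]
    proof eventually_elim
      case (elim b)
      show ?case
        unfolding meijer_H_tilde_b_rescaled(2)[OF a elim x] S_def g_def using elim by (simp only: if_True)
    qed
  qed
qed

text \<open>
  The terms \<open>1\<close> and \<open>x\<close> stem from the residues at \<open>0\<close> and \<open>-1\<close>, the term \<open>x\<^sup>3\<^sup>/\<^sup>2\<close> from the line.
\<close>

lemma meijer_H_tilde_b_bound: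
  assumes a: "a > -1"
  obtains C where "C > 0"
    "eventually (\<lambda>b. \<forall>x>0. norm (meijer_H_tilde (a + b) b (b * x)) \<le> C * Gamma b * (1 + x + x powr (3/2))) at_top"
proof -
  define g1 where "g1 = (\<lambda>y. norm (Gamma (Complex (-3/2) y) * rGamma (of_real (a + 1) - Complex (-3/2) y)))"
  have int1: "integrable lborel g1"
    using bessel_clifford_vertical(1)[of 1 a] a unfolding g1_def by (simp add: powr_def)
  define I where "I = (LBINT y. g1 y)"
  have I: "I \<ge> 0" unfolding I_def g1_def by simp
  have r: "rGamma (a + 1) > 0" "rGamma (a + 2) > 0"
    using a by (auto simp: rGamma_inverse_Gamma)
  define C where "C = rGamma (a + 1) + 2 * rGamma (a + 2) + I"
  show ?thesis
  proof (rule that[of C])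
    show "C > 0" using r I by (simp add: C_def)
    show "eventually (\<lambda>b. \<forall>x>0. norm (meijer_H_tilde (a + b) b (b * x)) \<le> C * Gamma b * (1 + x + x powr (3/2))) at_top"
      using eventually_ge_at_top[of 2] eventually_Gamma_shift_ratio_bounds[of "-3/2"]
        eventually_Gamma_shift_ratio_bounds[of "-1"]
    proof eventually_elim
      case (elim b)
      show ?case
      proof (intro allI impI)
        fix x :: real
        assume x: "x > 0"
        define g where "g = (\<lambda>u::complex. Gamma u * (rGamma (of_real (a + 1) - u) * of_real x powr (-u)))"
        define J where "J = (LBINT y. g (Complex (-3/2) y) * Gamma_shift_ratio b (Complex (-3/2) y))"
        have Gb: "Gamma b > 0" using elim(1) by simp
        have "norm J \<le> (LBINT y. g1 y * (x powr (3/2) * Gamma_shift_ratio b (-3/2)))"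
          unfolding J_def
        proof (rule Bochner_Integration.integral_norm_bound_integral)
          show "integrable lborel (\<lambda>y. g (Complex (-3/2) y) * Gamma_shift_ratio b (Complex (-3/2) y))"
            unfolding g_def by (rule meijer_H_tilde_b_rescaled(1)[OF a elim(1) x])
          show "integrable lborel (\<lambda>y. g1 y * (x powr (3/2) * Gamma_shift_ratio b (-3/2)))"
            using int1 by (rule integrable_mult_left)
          show "norm (g (Complex (-3/2) y) * Gamma_shift_ratio b (Complex (-3/2) y))
             \<le> g1 y * (x powr (3/2) * Gamma_shift_ratio b (-3/2))" for y
            unfolding g_def g1_def by (rule norm_line_integrand_le[OF elim(1) x])
        qed
        also have "\<dots> = I * (x powr (3/2) * Gamma_shift_ratio b (-3/2))"
          unfolding I_def by (rule integral_mult_left_zero)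
        also have "\<dots> \<le> I * (x powr (3/2) * 2)"
          using I elim(2) by (intro mult_left_mono) auto
        finally have J: "norm J \<le> I * (x powr (3/2) * 2)" .
        have "norm (1 / (2 * of_real pi) * J) = 1 / (2 * pi) * norm J"
          by (simp add: norm_mult norm_divide)
        also have "\<dots> \<le> 1 / 2 * (I * (x powr (3/2) * 2))"
          using J pi_ge_two by (intro mult_mono) (auto simp: divide_simps)
        also have "\<dots> = I * x powr (3/2)" by simp
        finally have J': "norm (1 / (2 * of_real pi) * J) \<le> I * x powr (3/2)" .
        have q: "norm (complex_of_real (Gamma_shift_ratio b (-1) * rGamma (a + 2) * x)) \<le> 2 * rGamma (a + 2) * x"
        proof -
          have "norm (complex_of_real (Gamma_shift_ratio b (-1) * rGamma (a + 2) * x)) = Gamma_shift_ratio b (-1) * rGamma (a + 2) * x"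
            using elim(3) r x unfolding norm_of_real by simp
          also have "\<dots> \<le> 2 * rGamma (a + 2) * x"
            using elim(3) r x by (intro mult_right_mono) auto
          finally show ?thesis .
        qed
        have "norm (meijer_H_tilde (a + b) b (b * x)) / Gamma b = norm (meijer_H_tilde (a + b) b (b * x) / of_real (Gamma b))"
          using Gb unfolding norm_divide norm_of_real by simp
        also have "\<dots> = norm (of_real (rGamma (a + 1)) - of_real (Gamma_shift_ratio b (-1) * rGamma (a + 2) * x) + 1 / (2 * of_real pi) * J)"
          unfolding meijer_H_tilde_b_rescaled(2)[OF a elim(1) x] J_def g_def ..
        also have "\<dots> \<le> norm (complex_of_real (rGamma (a + 1))) + norm (complex_of_real (Gamma_shift_ratio b (-1) * rGamma (a + 2) * x))
            + norm (1 / (2 * of_real pi) * J)"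
          by (rule order_trans[OF norm_triangle_ineq add_right_mono[OF norm_triangle_ineq4]])
        also have "\<dots> \<le> rGamma (a + 1) + 2 * rGamma (a + 2) * x + I * x powr (3/2)"
          by (intro add_mono q J') (use r in simp)
        also have "\<dots> \<le> C * 1 + C * x + C * x powr (3/2)"
          unfolding C_def using r I x by (intro add_mono mult_right_mono) auto
        also have "\<dots> = C * (1 + x + x powr (3/2))" by (simp only: distrib_left)
        finally show "norm (meijer_H_tilde (a + b) b (b * x)) \<le> C * Gamma b * (1 + x + x powr (3/2))"
          using Gb by (simp add: pos_divide_le_eq mult_ac)
      qed
    qed
  qed
qed

text \<open>
  Here \<open>\<Gamma>(b + 1 - s) b\<^sup>s\<close> may be replaced by \<open>\<Gamma>(b + 1)\<close>, since their quotient tends to \<open>1\<close>.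
\<close>

lemma meijer_H_tilde_a_rescaled_bound:
  assumes a: "a > -1" and s: "0 < s" "-a < s" "s < 1"
  obtains C where "C > 0"
    "eventually (\<lambda>b. \<forall>x>0. norm (meijer_H_tilde (a + b) a (b * x)) \<le> C / Gamma (b + 1) * x powr (-s)) at_top"
proof -
  obtain C where C: "C > 0" "\<And>b z. b \<ge> 3 \<Longrightarrow> b \<ge> a + 1 \<Longrightarrow> z > 0 \<Longrightarrow>
    norm (meijer_H_tilde (a + b) a z) \<le> C / Gamma (b + 1 - s) * z powr (-s)"
    using meijer_H_tilde_a_bound[OF a s] by blast
  show ?thesis
  proof (rule that[of "2 * C"])
    show "2 * C > 0" using C(1) by simp
    show "eventually (\<lambda>b. \<forall>x>0. norm (meijer_H_tilde (a + b) a (b * x)) \<le> 2 * C / Gamma (b + 1) * x powr (-s)) at_top"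
      using eventually_ge_at_top[of 3] eventually_ge_at_top[of "a + 1"]
        eventually_Gamma_shift_ratio_bounds[of "1 - s"]
    proof eventually_elim
      case (elim b)
      define q where "q = Gamma_shift_ratio b (1 - s)"
      have b: "b > 0" using elim by simp
      have q: "q > 1/2" using elim by (simp add: q_def)
      have Gb: "Gamma (b + 1) > 0" using b by simp
      have "Gamma (b + 1 - s) = q * Gamma b * b powr (1 - s)"
        using Gamma_shift_ratio_mult[OF b, of "1 - s"] by (simp add: q_def algebra_simps)
      also have "b powr (1 - s) = b * b powr (-s)"
        using b by (simp add: powr_diff powr_minus divide_inverse)
      also have "q * Gamma b * (b * b powr (-s)) = q * Gamma (b + 1) * b powr (-s)"
        using Gamma_real_plus1[OF b] by simp
      finally have G: "Gamma (b + 1 - s) = q * Gamma (b + 1) * b powr (-s)" .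
      show ?case
      proof (intro allI impI)
        fix x :: real
        assume x: "x > 0"
        have "norm (meijer_H_tilde (a + b) a (b * x)) \<le> C / Gamma (b + 1 - s) * (b * x) powr (-s)"
          using elim b x by (intro C(2)) auto
        also have "(b * x) powr (-s) = b powr (-s) * x powr (-s)"
          by (rule powr_mult)
        also have "C / Gamma (b + 1 - s) * (b powr (-s) * x powr (-s)) = (1 / q) * (C / Gamma (b + 1) * x powr (-s))"
          unfolding G using b by simp
        also have "\<dots> \<le> 2 * (C / Gamma (b + 1) * x powr (-s))"
          using q C(1) Gb by (intro mult_right_mono) (auto simp: divide_simps)
        finally show "norm (meijer_H_tilde (a + b) a (b * x)) \<le> 2 * C / Gamma (b + 1) * x powr (-s)" by simp
      qed
    qed
  qed
qed

text \<open>
  The \<open>n\<close>-th term of the series of \<open>\<Gamma>(b + 1) H\<^sub>a(b x)\<close>, in a form that shows its limit.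
\<close>

definition meijer_H_term :: "real \<Rightarrow> real \<Rightarrow> real \<Rightarrow> nat \<Rightarrow> real" where
  "meijer_H_term a b x n = (-1) ^ n / fact n * (rGamma (1 + a + real n) * x powr (a + real n)) / Gamma_shift_ratio b (a + 1 + real n)"

lemma Gamma_shift_ratio_pos:
  fixes p :: real
  assumes "b > 0" "b + p > 0"
  shows "Gamma_shift_ratio b p > 0"
proof -
  have "Gamma (b + p) > 0" "Gamma b > 0" using assms by (auto intro!: Gamma_real_pos)
  then show ?thesis using assms by (simp add: Gamma_shift_ratio_def)
qed

lemma meijer_H_term_sums:
  assumes a: "a > -1" and b: "b > 0" and x: "x > 0"
  shows "(\<lambda>n. complex_of_real (meijer_H_term a b x n)) sums (of_real (Gamma (b + 1)) * meijer_H (a + b) a (b * x))"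
proof -
  have bx: "b * x > 0" using b x by simp
  have Gb: "Gamma b \<noteq> 0" using Gamma_real_pos[OF b] by linarith
  have "(\<lambda>n. of_real (Gamma (b + 1)) * complex_of_real ((-1) ^ n / fact n * (rGamma (1 + a + real n) * rGamma (a + b + 1 + real n)
            * (b * x) powr (a + real n)))) sums (of_real (Gamma (b + 1)) * meijer_H (a + b) a (b * x))"
    by (intro sums_mult meijer_H_sums[OF bx])
  also have "(\<lambda>n. of_real (Gamma (b + 1)) * complex_of_real ((-1) ^ n / fact n * (rGamma (1 + a + real n) * rGamma (a + b + 1 + real n)
            * (b * x) powr (a + real n)))) = (\<lambda>n. complex_of_real (meijer_H_term a b x n))"
  proof
    fix n
    define Q where "Q = Gamma_shift_ratio b (a + 1 + real n)"
    define B where "B = b powr (a + real n)"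
    have Q: "Q > 0" unfolding Q_def using a b by (intro Gamma_shift_ratio_pos) auto
    have B: "B > 0" unfolding B_def using b by simp
    have 1: "Gamma (b + (a + 1 + real n)) = Q * Gamma b * b powr (a + 1 + real n)"
      unfolding Q_def by (rule Gamma_shift_ratio_mult[OF b])
    have 2: "b powr (a + 1 + real n) = B * b"
      using b by (simp add: B_def powr_add algebra_simps)
    have e: "a + b + 1 + real n = b + (a + 1 + real n)" by simp
    have 3: "rGamma (a + b + 1 + real n) = 1 / (Q * Gamma b * (B * b))"
      unfolding rGamma_inverse_Gamma e 1 2 by (simp add: divide_inverse)
    have 4: "Gamma (b + 1) = b * Gamma b" by (rule Gamma_real_plus1[OF b])
    have 5: "(b * x) powr (a + real n) = B * x powr (a + real n)"
      unfolding B_def by (rule powr_mult)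
    have "Gamma (b + 1) * ((-1) ^ n / fact n * (rGamma (1 + a + real n) * rGamma (a + b + 1 + real n)
            * (b * x) powr (a + real n))) = meijer_H_term a b x n"
      unfolding 3 4 5 meijer_H_term_def Q_def[symmetric] using Gb b B Q by simp
    then show "of_real (Gamma (b + 1)) * complex_of_real ((-1) ^ n / fact n * (rGamma (1 + a + real n) * rGamma (a + b + 1 + real n)
            * (b * x) powr (a + real n))) = complex_of_real (meijer_H_term a b x n)"
      by (simp only: of_real_mult[symmetric])
  qed
  finally show ?thesis .
qed

text \<open>
  For \<open>n \<ge> 1\<close> the recursion from \<open>2 + a > 1\<close> only multiplies by numbers above \<open>1\<close>; the value at
  \<open>n = 0\<close> is added separately because \<open>1 + a\<close> may be small.
\<close>

lemma rGamma_real_le: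
  assumes a: "a > -1"
  obtains M where "M > 0" "\<And>n. 0 < rGamma (1 + a + real n)" "\<And>n. rGamma (1 + a + real n) \<le> M"
proof -
  define M where "M = 1 / Gamma (1 + a) + 1 / Gamma (2 + a)"
  have pos: "Gamma (1 + a) > 0" "Gamma (2 + a) > 0" using a by (auto intro!: Gamma_real_pos)
  show ?thesis
  proof (rule that[of M])
    show "M > 0" using pos by (simp add: M_def add_pos_pos)
    fix n
    have Gn: "Gamma (1 + a + real n) > 0" using a by (intro Gamma_real_pos) simp
    then show "0 < rGamma (1 + a + real n)" by (simp add: rGamma_inverse_Gamma)
    show "rGamma (1 + a + real n) \<le> M"
    proof (cases n)
      case 0
      then show ?thesis using pos by (simp add: M_def rGamma_inverse_Gamma divide_inverse)
    next
      case (Suc m)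
      have "Gamma (2 + a) * 1 ^ m \<le> Gamma (2 + a + real m)"
        using a by (intro Gamma_real_add_nat_ge) auto
      moreover have "2 + a + real m = 1 + a + real n" using Suc by simp
      ultimately have "Gamma (2 + a) \<le> Gamma (1 + a + real n)" by simp
      then have "1 / Gamma (1 + a + real n) \<le> 1 / Gamma (2 + a)"
        using pos by (intro divide_left_mono) auto
      moreover have "0 < 1 / Gamma (1 + a)" using pos by simp
      ultimately have "1 / Gamma (1 + a + real n) \<le> M" unfolding M_def by linarith
      then show ?thesis by (simp add: rGamma_inverse_Gamma divide_inverse)
    qed
  qed
qed

text \<open>
  The ratio in the denominator is at least its value for \<open>n = 0\<close>, because
  \<open>\<Gamma>(b + a + 1 + n) \<ge> \<Gamma>(b + a + 1) b\<^sup>n\<close>. So one bound serves all \<open>n\<close>.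
\<close>

lemma meijer_H_term_bound:
  assumes a: "a > -1"
  obtains M where "M > 0"
    "eventually (\<lambda>b. \<forall>x>0. \<forall>n. \<bar>meijer_H_term a b x n\<bar> \<le> M * x powr a * (x ^ n / fact n)) at_top"
proof -
  obtain M where M: "M > 0" "\<And>n. 0 < rGamma (1 + a + real n)" "\<And>n. rGamma (1 + a + real n) \<le> M"
    using rGamma_real_le[OF a] by blast
  show ?thesis
  proof (rule that[of "2 * M"])
    show "2 * M > 0" using M by simp
    show "eventually (\<lambda>b. \<forall>x>0. \<forall>n. \<bar>meijer_H_term a b x n\<bar> \<le> 2 * M * x powr a * (x ^ n / fact n)) at_top"
      using eventually_gt_at_top[of 0] eventually_Gamma_shift_ratio_bounds[of "a + 1"]
    proof eventually_elim
      case (elim b)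
      show ?case
      proof (intro allI impI)
        fix x :: real and n :: nat
        assume x: "x > 0"
        define Q where "Q = Gamma_shift_ratio b (a + 1 + real n)"
        have "Gamma (b + (a + 1)) * b ^ n \<le> Gamma (b + (a + 1) + real n)"
          using elim(1) a by (intro Gamma_real_add_nat_ge) auto
        also have "Gamma (b + (a + 1) + real n) = Q * Gamma b * b powr (a + 1 + real n)"
          using Gamma_shift_ratio_mult[OF elim(1), of "a + 1 + real n"] by (simp add: Q_def add_ac)
        also have "b powr (a + 1 + real n) = b powr (a + 1) * b ^ n"
          using elim(1) by (simp add: powr_add powr_realpow)
        also have "Gamma (b + (a + 1)) = Gamma_shift_ratio b (a + 1) * Gamma b * b powr (a + 1)"
          by (rule Gamma_shift_ratio_mult[OF elim(1)])
        finally have "Gamma_shift_ratio b (a + 1) * (Gamma b * (b powr (a + 1) * b ^ n)) \<le> Q * (Gamma b * (b powr (a + 1) * b ^ n))"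
          by (simp only: mult.assoc)
        moreover have "Gamma b * (b powr (a + 1) * b ^ n) > 0" using elim(1) by simp
        ultimately have "Gamma_shift_ratio b (a + 1) \<le> Q" by (simp only: mult_le_cancel_right_pos)
        with elim(2) have Q: "Q > 1/2" by linarith
        then have Q': "1 / Q \<le> 2" by (simp add: divide_simps)
        have "\<bar>meijer_H_term a b x n\<bar> = (1 / fact n) * (rGamma (1 + a + real n) * x powr (a + real n)) * (1 / Q)"
          using Q M(2)[of n] unfolding meijer_H_term_def Q_def[symmetric]
          by (simp add: abs_mult power_abs)
        also have "x powr (a + real n) = x powr a * x ^ n"
          using x by (simp add: powr_add powr_realpow)
        also have "(1 / fact n) * (rGamma (1 + a + real n) * (x powr a * x ^ n)) * (1 / Q)
            \<le> (1 / fact n) * (M * (x powr a * x ^ n)) * 2"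
          using M(2)[of n] M(3)[of n] M(1) Q' Q x by (intro mult_mono mult_left_mono mult_right_mono) auto
        also have "\<dots> = 2 * M * x powr a * (x ^ n / fact n)" by simp
        finally show "\<bar>meijer_H_term a b x n\<bar> \<le> 2 * M * x powr a * (x ^ n / fact n)" .
      qed
    qed
  qed
qed

lemma meijer_H_a_bound:
  assumes a: "a > -1"
  obtains C where "C > 0"
    "eventually (\<lambda>b. \<forall>x>0. norm (meijer_H (a + b) a (b * x)) \<le> C / Gamma (b + 1) * x powr a * exp x) at_top"
proof -
  obtain M where M: "M > 0"
    "eventually (\<lambda>b. \<forall>x>0. \<forall>n. \<bar>meijer_H_term a b x n\<bar> \<le> M * x powr a * (x ^ n / fact n)) at_top"
    using meijer_H_term_bound[OF a] by blast
  show ?thesis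
  proof (rule that[of M])
    show "eventually (\<lambda>b. \<forall>x>0. norm (meijer_H (a + b) a (b * x)) \<le> M / Gamma (b + 1) * x powr a * exp x) at_top"
      using M(2) eventually_gt_at_top[of 0]
    proof eventually_elim
      case (elim b)
      show ?case
      proof (intro allI impI)
        fix x :: real
        assume x: "x > 0"
        have G: "Gamma (b + 1) > 0" using elim(2) by simp
        have "norm (of_real (Gamma (b + 1)) * meijer_H (a + b) a (b * x)) \<le> M * x powr a * exp x"
          using elim(1) x by (intro norm_sums_le_exp[OF meijer_H_term_sums[OF a elim(2) x]]) simp
        then have "Gamma (b + 1) * norm (meijer_H (a + b) a (b * x)) \<le> M * x powr a * exp x"
          using G unfolding norm_mult norm_of_real by simp
        then have "norm (meijer_H (a + b) a (b * x)) \<le> M * x powr a * exp x / Gamma (b + 1)"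
          using G by (simp add: pos_le_divide_eq mult.commute)
        then show "norm (meijer_H (a + b) a (b * x)) \<le> M / Gamma (b + 1) * x powr a * exp x" by simp
      qed
    qed
  qed (fact M)
qed

text \<open>
  Tannery's theorem with the exponential series as majorant.
\<close>

lemma tendsto_meijer_H_a:
  assumes a: "a > -1" and x: "x > 0"
  shows "((\<lambda>b. of_real (Gamma (b + 1)) * meijer_H (a + b) a (b * x)) \<longlongrightarrow> of_real (x powr a * bessel_clifford a x)) at_top"
proof -
  obtain M where M: "M > 0"
    "eventually (\<lambda>b. \<forall>x>0. \<forall>n. \<bar>meijer_H_term a b x n\<bar> \<le> M * x powr a * (x ^ n / fact n)) at_top"
    using meijer_H_term_bound[OF a] by blast
  define L where "L = (\<lambda>n. (-1) ^ n / fact n * (rGamma (1 + a + real n) * x powr (a + real n)))"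
  have "((\<lambda>b. suminf (\<lambda>n. meijer_H_term a b x n)) \<longlongrightarrow> suminf L) at_top"
  proof (rule tannerys_theorem[THEN conjunct2, THEN conjunct2])
    show "((\<lambda>b. meijer_H_term a b x n) \<longlongrightarrow> L n) at_top" for n
    proof -
      have "((\<lambda>b. meijer_H_term a b x n) \<longlongrightarrow> L n / 1) at_top"
        unfolding meijer_H_term_def L_def
        by (intro tendsto_divide tendsto_const tendsto_Gamma_shift_ratio_real) simp
      then show ?thesis by simp
    qed
    have "eventually (\<lambda>b. \<forall>n. norm (meijer_H_term a b x n) \<le> M * x powr a * (x ^ n / fact n)) at_top"
      using M(2) by eventually_elim (simp add: x)
    then show "eventually (\<lambda>(n, b). norm (meijer_H_term a b x n) \<le> M * x powr a * (x ^ n / fact n)) (at_top \<times>\<^sub>F at_top)"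
      unfolding eventually_prod_filter
      by (intro exI[of _ "\<lambda>_. True"] exI[of _ "\<lambda>b. \<forall>n. norm (meijer_H_term a b x n) \<le> M * x powr a * (x ^ n / fact n)"]) simp
    have "summable (\<lambda>n. x ^ n /\<^sub>R fact n)" using exp_converges by (rule sums_summable)
    then have "summable (\<lambda>n. x ^ n / fact n)" by (simp add: divide_inverse mult.commute)
    then show "summable (\<lambda>n. M * x powr a * (x ^ n / fact n))" by (rule summable_mult)
    show "at_top \<noteq> (bot :: real filter)" by simp
  qed
  moreover have "suminf L = x powr a * bessel_clifford a x"
  proof -
    have "(\<lambda>n. x powr a * ((-1) ^ n / fact n * (rGamma (a + 1 + real n) * x ^ n))) sums (x powr a * bessel_clifford a x)"
      by (intro sums_mult bessel_clifford_vertical(3)[OF x a])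
    also have "(\<lambda>n. x powr a * ((-1) ^ n / fact n * (rGamma (a + 1 + real n) * x ^ n))) = L"
      using x unfolding L_def by (auto simp: powr_add powr_realpow add.commute)
    finally show ?thesis by (simp add: sums_iff)
  qed
  ultimately have "((\<lambda>b. complex_of_real (suminf (\<lambda>n. meijer_H_term a b x n))) \<longlongrightarrow> of_real (x powr a * bessel_clifford a x)) at_top"
    by (simp only: tendsto_of_real)
  then show ?thesis
  proof (rule Lim_transform_eventually)
    show "eventually (\<lambda>b. complex_of_real (suminf (\<lambda>n. meijer_H_term a b x n)) = of_real (Gamma (b + 1)) * meijer_H (a + b) a (b * x)) at_top"
      using eventually_gt_at_top[of 0]
    proof eventually_elim
      case (elim b)
      note S = meijer_H_term_sums[OF a elim x]
      have "summable (meijer_H_term a b x)"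
        using sums_summable[OF S] by (simp only: summable_complex_of_real)
      then have "(\<lambda>n. complex_of_real (meijer_H_term a b x n)) sums of_real (suminf (meijer_H_term a b x))"
        by (simp only: sums_of_real summable_sums)
      from sums_unique2[OF this S] show ?case .
    qed
  qed
qed

text \<open>
  The first term of the series is \<open>(b x)\<^sup>b / (\<Gamma>(b + 1) \<Gamma>(a + b + 1))\<close>, and \<open>b\<^sup>b / \<Gamma>(b + 1) \<le> e\<^sup>b\<close>. The
  later terms are smaller by at least \<open>x\<^sup>n / n!\<close>.
\<close>

lemma meijer_H_b_bound:
  assumes a: "a > -1" and b: "b \<ge> 1" and x: "x > 0"
  shows "norm (meijer_H (a + b) b (b * x)) \<le> (exp 1 * x) powr b / Gamma (a + b + 1) * exp x"
proof -
  have bx: "b * x > 0" using b x by simp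
  have G: "Gamma (1 + b) > 0" "Gamma (a + b + 1) > 0" using a b by (auto intro!: Gamma_real_pos)
  have "norm (meijer_H (a + b) b (b * x)) \<le> ((b * x) powr b / (Gamma (1 + b) * Gamma (a + b + 1))) * exp x"
  proof (rule norm_sums_le_exp[OF meijer_H_sums[OF bx]])
    fix n
    have 1: "Gamma (1 + b) * b ^ n \<le> Gamma (1 + b + real n)"
      using b by (intro Gamma_real_add_nat_ge) auto
    have 2: "Gamma (a + b + 1) * 1 ^ n \<le> Gamma (a + b + 1 + real n)"
      using a b by (intro Gamma_real_add_nat_ge) auto
    have P: "Gamma (1 + b) * b ^ n > 0" using G b by simp
    have r1: "\<bar>rGamma (1 + b + real n)\<bar> \<le> 1 / (Gamma (1 + b) * b ^ n)"
    proof -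
      have "Gamma (1 + b + real n) > 0" using P 1 by linarith
      then have "\<bar>rGamma (1 + b + real n)\<bar> = 1 / Gamma (1 + b + real n)"
        by (simp add: rGamma_inverse_Gamma divide_inverse)
      also have "\<dots> \<le> 1 / (Gamma (1 + b) * b ^ n)"
        using 1 P by (intro divide_left_mono) auto
      finally show ?thesis .
    qed
    have r2: "\<bar>rGamma (a + b + 1 + real n)\<bar> \<le> 1 / Gamma (a + b + 1)"
    proof -
      have 3: "Gamma (a + b + 1) \<le> Gamma (a + b + 1 + real n)" using 2 by simp
      then have "Gamma (a + b + 1 + real n) > 0" using G by linarith
      then have "\<bar>rGamma (a + b + 1 + real n)\<bar> = 1 / Gamma (a + b + 1 + real n)"
        by (simp add: rGamma_inverse_Gamma divide_inverse)
      also have "\<dots> \<le> 1 / Gamma (a + b + 1)"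
        using 3 G by (intro divide_left_mono) auto
      finally show ?thesis .
    qed
    have p: "(b * x) powr (b + real n) = (b * x) powr b * (b ^ n * x ^ n)"
      using bx by (simp add: powr_add powr_realpow power_mult_distrib)
    have "norm (complex_of_real ((-1) ^ n / fact n * (rGamma (1 + b + real n) * rGamma (a + b + 1 + real n) * (b * x) powr (b + real n))))
        = 1 / fact n * (\<bar>rGamma (1 + b + real n)\<bar> * \<bar>rGamma (a + b + 1 + real n)\<bar> * ((b * x) powr b * (b ^ n * x ^ n)))"
      unfolding norm_of_real p using b x by (simp add: abs_mult power_abs)
    also have "\<dots> \<le> 1 / fact n * (1 / (Gamma (1 + b) * b ^ n) * (1 / Gamma (a + b + 1)) * ((b * x) powr b * (b ^ n * x ^ n)))"
      using r1 r2 P G b x by (intro mult_left_mono mult_right_mono mult_mono) auto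
    also have "\<dots> = ((b * x) powr b / (Gamma (1 + b) * Gamma (a + b + 1))) * (x ^ n / fact n)"
      using b by simp
    finally show "norm (complex_of_real ((-1) ^ n / fact n * (rGamma (1 + b + real n) * rGamma (a + b + 1 + real n) * (b * x) powr (b + real n))))
      \<le> ((b * x) powr b / (Gamma (1 + b) * Gamma (a + b + 1))) * (x ^ n / fact n)" .
  qed
  also have "\<dots> \<le> ((exp 1 * x) powr b / Gamma (a + b + 1)) * exp x"
  proof (intro mult_right_mono)
    have "b powr b * exp (-b) \<le> b * Gamma b" using b by (intro Gamma_real_lower_bound) auto
    also have "\<dots> = Gamma (1 + b)" using Gamma_real_plus1[of b] b by (simp add: add.commute)
    finally have "b powr b * exp (-b) * exp b \<le> Gamma (1 + b) * exp b" by (intro mult_right_mono) auto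
    then have bb: "b powr b \<le> Gamma (1 + b) * exp b" by (simp add: exp_minus field_simps)
    have "(b * x) powr b = b powr b * x powr b" by (rule powr_mult)
    also have "\<dots> \<le> Gamma (1 + b) * exp b * x powr b" using bb by (intro mult_right_mono) auto
    also have "exp b = exp 1 powr b" by (simp add: powr_def)
    also have "Gamma (1 + b) * exp 1 powr b * x powr b = Gamma (1 + b) * (exp 1 * x) powr b"
      by (simp only: powr_mult mult.assoc)
    finally have "(b * x) powr b / Gamma (1 + b) \<le> (exp 1 * x) powr b"
      using G by (simp add: pos_divide_le_eq mult.commute)
    then have "(b * x) powr b / Gamma (1 + b) / Gamma (a + b + 1) \<le> (exp 1 * x) powr b / Gamma (a + b + 1)"
      using G by (intro divide_right_mono) auto
    then show "(b * x) powr b / (Gamma (1 + b) * Gamma (a + b + 1)) \<le> (exp 1 * x) powr b / Gamma (a + b + 1)"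
      by simp
  qed simp
  finally show ?thesis .
qed

section \<open>Determinants\<close>

lemma tendsto_det:
  fixes f :: "'b \<Rightarrow> nat \<Rightarrow> nat \<Rightarrow> complex"
  assumes "\<And>i j. i < n \<Longrightarrow> j < n \<Longrightarrow> ((\<lambda>b. f b i j) \<longlongrightarrow> L i j) F"
  shows "((\<lambda>b. Determinant.det (Matrix.mat n n (\<lambda>(i, j). f b i j))) \<longlongrightarrow>
           Determinant.det (Matrix.mat n n (\<lambda>(i, j). L i j))) F"
proof -
  have det: "Determinant.det (Matrix.mat n n (\<lambda>(i, j). g i j)) =
      (\<Sum>p\<in>{p. p permutes {0..<n}}. signof p * (\<Prod>i=0..<n. g i (p i)))" for g :: "nat \<Rightarrow> nat \<Rightarrow> complex"
  proof -
    have "Determinant.det (Matrix.mat n n (\<lambda>(i, j). g i j)) =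
      (\<Sum>p\<in>{p. p permutes {0..<n}}. signof p * (\<Prod>i=0..<n. Matrix.mat n n (\<lambda>(i, j). g i j) $$ (i, p i)))"
      by (rule det_def') simp
    also have "\<dots> = (\<Sum>p\<in>{p. p permutes {0..<n}}. signof p * (\<Prod>i=0..<n. g i (p i)))"
    proof (intro sum.cong refl arg_cong2[where f = "(*)"] prod.cong)
      fix p i assume "p \<in> {p. p permutes {0..<n}}" "i \<in> {0..<n}"
      then have "i < n" "p i < n" using permutes_in_image[of p "{0..<n}" i] by auto
      then show "Matrix.mat n n (\<lambda>(i, j). g i j) $$ (i, p i) = g i (p i)" by simp
    qed
    finally show ?thesis .
  qed
  show ?thesis
    unfolding det
  proof (intro tendsto_sum tendsto_mult tendsto_const tendsto_prod assms)
    fix p i assume "p \<in> {p. p permutes {0..<n}}" "i \<in> {0..<n}"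
    then show "i < n" "p i < n" using permutes_in_image[of p "{0..<n}" i] by auto
  qed
qed

text \<open>
  In the Leibniz expansion the factors \<open>d i / d (p i)\<close> multiply up to \<open>1\<close> for every permutation \<open>p\<close>.
\<close>

lemma det_diagonal_conjugation:
  fixes d :: "nat \<Rightarrow> complex"
  assumes "\<And>i. i < n \<Longrightarrow> d i \<noteq> 0"
  shows "Determinant.det (Matrix.mat n n (\<lambda>(i, j). d i / d j * f i j)) =
         Determinant.det (Matrix.mat n n (\<lambda>(i, j). f i j))"
proof -
  have "(\<Prod>i=0..<n. Matrix.mat n n (\<lambda>(i, j). d i / d j * f i j) $$ (i, p i))
      = (\<Prod>i=0..<n. Matrix.mat n n (\<lambda>(i, j). f i j) $$ (i, p i))" if p: "p permutes {0..<n}" for p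
  proof -
    have lt: "p i < n" if "i < n" for i using p that permutes_in_image[of p "{0..<n}" i] by auto
    have "(\<Prod>i=0..<n. d (p i)) = (\<Prod>i=0..<n. d i)"
      using prod.permute[OF p, of d] by (simp add: o_def)
    moreover have "(\<Prod>i=0..<n. d i) \<noteq> 0" using assms by simp
    ultimately have 1: "(\<Prod>i=0..<n. d i / d (p i)) = 1" by (simp add: prod_dividef)
    have "(\<Prod>i=0..<n. Matrix.mat n n (\<lambda>(i, j). d i / d j * f i j) $$ (i, p i))
        = (\<Prod>i=0..<n. d i / d (p i) * f i (p i))"
      by (intro prod.cong refl) (use lt in simp)
    also have "\<dots> = (\<Prod>i=0..<n. d i / d (p i)) * (\<Prod>i=0..<n. f i (p i))" by (rule prod.distrib)
    also have "\<dots> = (\<Prod>i=0..<n. f i (p i))" unfolding 1 by simp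
    also have "\<dots> = (\<Prod>i=0..<n. Matrix.mat n n (\<lambda>(i, j). f i j) $$ (i, p i))"
      by (intro prod.cong refl) (use lt in simp)
    finally show ?thesis .
  qed
  then show ?thesis
    by (subst (1 2) det_def'[where n = n]) auto
qed

text \<open>
  Every product of the Leibniz expansion takes exactly one entry from column \<open>k\<close>.
\<close>

lemma norm_det_le_small_column:
  fixes A :: "complex mat"
  assumes A: "A \<in> carrier_mat n n" and k: "k < n" and M: "M \<ge> 0"
    and le: "\<And>i j. i < n \<Longrightarrow> j < n \<Longrightarrow> norm (A $$ (i, j)) \<le> M"
    and col: "\<And>i. i < n \<Longrightarrow> norm (A $$ (i, k)) \<le> \<delta>"
  shows "norm (Determinant.det A) \<le> fact n * (\<delta> * M ^ (n - 1))"
proof -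
  have d: "\<delta> \<ge> 0" using col[OF k] norm_ge_zero order_trans by blast
  have "norm (Determinant.det A) \<le> (\<Sum>p\<in>{p. p permutes {0..<n}}. \<delta> * M ^ (n - 1))"
    unfolding det_def'[OF A]
  proof (rule sum_norm_le)
    fix p assume "p \<in> {p. p permutes {0..<n}}"
    then have p: "p permutes {0..<n}" by simp
    have lt: "p i < n" if "i < n" for i using p that permutes_in_image[of p "{0..<n}" i] by auto
    obtain m where m: "m < n" "p m = k"
      using p k permutes_surj[OF p] permutes_in_image[OF p] by (metis atLeastLessThan_iff surjD zero_le)
    have "norm (signof p :: complex) = 1" by (cases "evenperm p") (auto simp: sign_def)
    then have "norm (signof p * (\<Prod>i=0..<n. A $$ (i, p i))) = (\<Prod>i=0..<n. norm (A $$ (i, p i)))"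
      by (simp add: norm_mult prod_norm)
    also have "\<dots> = norm (A $$ (m, p m)) * (\<Prod>i\<in>{0..<n} - {m}. norm (A $$ (i, p i)))"
      by (rule prod.remove) (use m in auto)
    also have "\<dots> \<le> \<delta> * (\<Prod>i\<in>{0..<n} - {m}. M)"
    proof (intro mult_mono prod_mono conjI)
      show "norm (A $$ (m, p m)) \<le> \<delta>" using col[OF m(1)] m(2) by simp
    qed (use d lt le in \<open>auto intro!: prod_nonneg\<close>)
    also have "(\<Prod>i\<in>{0..<n} - {m}. M) = M ^ (n - 1)"
      using m by simp
    finally show "norm (signof p * (\<Prod>i=0..<n. A $$ (i, p i))) \<le> \<delta> * M ^ (n - 1)" .
  qed
  also have "\<dots> = fact n * (\<delta> * M ^ (n - 1))"
    by (simp add: card_permutations[of "{0..<n}" n])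
  finally show ?thesis .
qed

lemma det_of_real_mat:
  "Determinant.det (Matrix.mat n n (\<lambda>(i, j). complex_of_real (f i j))) = of_real (Determinant.det (Matrix.mat n n (\<lambda>(i, j). f i j)))"
proof -
  interpret comm_ring_hom complex_of_real by unfold_locales auto
  have "Matrix.mat n n (\<lambda>(i, j). complex_of_real (f i j)) = map_mat complex_of_real (Matrix.mat n n (\<lambda>(i, j). f i j))"
    by (rule eq_matI) auto
  then show ?thesis by simp
qed

lemma det_mult_entries:
  fixes f :: "nat \<Rightarrow> nat \<Rightarrow> complex"
  shows "c ^ n * Determinant.det (Matrix.mat n n (\<lambda>(i, j). f i j)) = Determinant.det (Matrix.mat n n (\<lambda>(i, j). c * f i j))"
proof -
  have "Matrix.mat n n (\<lambda>(i, j). c * f i j) = c \<cdot>\<^sub>m Matrix.mat n n (\<lambda>(i, j). f i j)"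
    by (rule eq_matI) auto
  then show ?thesis by simp
qed

section \<open>Bounds for the rescaled kernels\<close>

text \<open>
  If \<open>f\<close> is not integrable, its integral is \<open>0\<close> by convention, and the right-hand side is nonnegative.
\<close>

lemma norm_set_integral_le:
  fixes f :: "real \<Rightarrow> complex"
  assumes g: "set_integrable lborel A g" and le: "\<And>t. t \<in> A \<Longrightarrow> norm (f t) \<le> g t"
  shows "norm (LBINT t:A. f t) \<le> (LBINT t:A. g t)"
proof (cases "set_integrable lborel A f")
  case True
  show ?thesis
    unfolding set_lebesgue_integral_def
  proof (rule Bochner_Integration.integral_norm_bound_integral)
    show "integrable lborel (\<lambda>t. indicat_real A t *\<^sub>R f t)" using True by (simp add: set_integrable_def)
    show "integrable lborel (\<lambda>t. indicat_real A t *\<^sub>R g t)" using g by (simp add: set_integrable_def)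
    show "norm (indicat_real A t *\<^sub>R f t) \<le> indicat_real A t *\<^sub>R g t" for t
      using le[of t] by (cases "t \<in> A") auto
  qed
next
  case False
  then have "(LBINT t:A. f t) = 0"
    unfolding set_lebesgue_integral_def set_integrable_def by (rule not_integrable_integral_eq)
  moreover have "(LBINT t:A. g t) \<ge> 0"
    unfolding set_lebesgue_integral_def
  proof (rule Bochner_Integration.integral_nonneg)
    fix t
    show "indicat_real A t *\<^sub>R g t \<ge> 0"
    proof (cases "t \<in> A")
      case True
      then show ?thesis using order_trans[OF norm_ge_zero le[OF True]] by simp
    qed simp
  qed
  ultimately show ?thesis by simp
qed

text \<open>
  A Beta integral with second parameter \<open>1\<close>.
\<close>

lemma set_integrable_powr_unit:
  assumes "p > -1"
  shows "set_integrable lborel {0<..<1} (\<lambda>t::real. t powr p)"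
proof -
  have "set_integrable lborel {0..1} (\<lambda>t. t powr (p + 1 - 1) * (1 - t) powr (1 - 1))"
    by (rule integrable_Beta) (use assms in auto)
  then have "set_integrable lborel {0<..<1} (\<lambda>t. t powr (p + 1 - 1) * (1 - t) powr (1 - 1))"
    by (rule set_integrable_subset) auto
  then show ?thesis
    by (rule set_integrable_cong[THEN iffD1, rotated 3]) auto
qed

definition powr_moment :: "real \<Rightarrow> real" where
  "powr_moment p = (LBINT t:{0<..<1}. t powr p)"

lemma powr_moment_nonneg: "powr_moment p \<ge> 0"
  unfolding powr_moment_def set_lebesgue_integral_def
  by (rule Bochner_Integration.integral_nonneg) (simp add: indicator_def)

text \<open>
  All four kernels are integrals of this form. The variable \<open>t\<close> survives only in the singular factor
  \<open>t\<^sup>p\<close>; in the monotone factors it is replaced by its upper bound \<open>1\<close>.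
\<close>

lemma norm_kernel_integral_le:
  fixes F G :: "real \<Rightarrow> complex"
  assumes F: "\<And>x. x > 0 \<Longrightarrow> norm (F (b * x)) \<le> A * x powr p * u x"
    and G: "\<And>x. x > 0 \<Longrightarrow> norm (G (b * x)) \<le> B * v x"
    and u: "\<And>x y. 0 < x \<Longrightarrow> x \<le> y \<Longrightarrow> u x \<le> u y"
    and v: "\<And>x y. 0 < x \<Longrightarrow> x \<le> y \<Longrightarrow> v x \<le> v y" "\<And>x. x > 0 \<Longrightarrow> v x \<ge> 0"
    and pos: "A \<ge> 0" "B \<ge> 0" "p > -1" "\<zeta> > 0" "\<xi> > 0"
  shows "norm (LBINT t:{0<..<1}. F (t * (b / 4 * \<zeta>)) * G (t * (b / 4 * \<xi>)))
     \<le> A * B * (powr_moment p * (\<zeta> / 4) powr p * u (\<zeta> / 4) * v (\<xi> / 4))"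
proof -
  define K where "K = A * (\<zeta> / 4) powr p * u (\<zeta> / 4) * (B * v (\<xi> / 4))"
  have "norm (LBINT t:{0<..<1}. F (t * (b / 4 * \<zeta>)) * G (t * (b / 4 * \<xi>))) \<le> (LBINT t:{0<..<1}. K * t powr p)"
  proof (rule norm_set_integral_le)
    show "set_integrable lborel {0<..<1} (\<lambda>t. K * t powr p)"
      using pos by (intro set_integrable_mult_right set_integrable_powr_unit)
    fix t :: real
    assume t: "t \<in> {0<..<1}"
    define x where "x = t * (\<zeta> / 4)"
    define y where "y = t * (\<xi> / 4)"
    have x: "0 < x" "x \<le> \<zeta> / 4" using t pos by (auto simp: x_def)
    have y: "0 < y" "y \<le> \<xi> / 4" using t pos by (auto simp: y_def)
    have eq: "t * (b / 4 * \<zeta>) = b * x" "t * (b / 4 * \<xi>) = b * y" by (simp_all add: x_def y_def)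
    have "norm (F (b * x)) \<le> A * x powr p * u x" by (rule F[OF x(1)])
    also have "\<dots> \<le> A * x powr p * u (\<zeta> / 4)"
      using pos by (intro mult_left_mono u x) auto
    finally have 1: "norm (F (b * x)) \<le> A * x powr p * u (\<zeta> / 4)" .
    have "norm (G (b * y)) \<le> B * v y" by (rule G[OF y(1)])
    also have "\<dots> \<le> B * v (\<xi> / 4)" using pos by (intro mult_left_mono v y) auto
    finally have 2: "norm (G (b * y)) \<le> B * v (\<xi> / 4)" .
    have "norm (F (b * x) * G (b * y)) \<le> (A * x powr p * u (\<zeta> / 4)) * (B * v (\<xi> / 4))"
      unfolding norm_mult by (rule mult_mono[OF 1 2 order_trans[OF norm_ge_zero 1]]) simp
    also have "x powr p = t powr p * (\<zeta> / 4) powr p" unfolding x_def by (rule powr_mult)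
    finally show "norm (F (t * (b / 4 * \<zeta>)) * G (t * (b / 4 * \<xi>))) \<le> K * t powr p"
      unfolding eq K_def by (simp only: mult_ac)
  qed
  also have "(LBINT t:{0<..<1}. K * t powr p) = K * powr_moment p"
    unfolding powr_moment_def by (rule set_integral_mult_right)
  also have "\<dots> = A * B * (powr_moment p * (\<zeta> / 4) powr p * u (\<zeta> / 4) * v (\<xi> / 4))"
    unfolding K_def by (simp only: mult_ac)
  finally show ?thesis .
qed

text \<open>
  The growth of \<open>\<tilde>H\<^sub>b(b x) / \<Gamma>(b)\<close> in \<open>x\<close>.
\<close>

definition tilde_b_envelope :: "real \<Rightarrow> real" where
  "tilde_b_envelope x = 1 + x + x powr (3/2)"

lemma tilde_b_envelope_mono: "0 < x \<Longrightarrow> x \<le> y \<Longrightarrow> tilde_b_envelope x \<le> tilde_b_envelope y"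
  unfolding tilde_b_envelope_def by (intro add_mono powr_mono2) auto

lemma tilde_b_envelope_pos: "0 < x \<Longrightarrow> tilde_b_envelope x > 0"
  unfolding tilde_b_envelope_def by (intro add_pos_nonneg) auto

text \<open>
  The bound for \<open>H\<^sub>b(b x)\<close>, divided by \<open>\<Gamma>(b) = \<Gamma>(b + 1) / b\<close>. This is the size of the rescaled kernels
  whose second point belongs to the \<open>-\<close> field.
\<close>

definition negative_point_rate :: "real \<Rightarrow> real \<Rightarrow> real \<Rightarrow> real" where
  "negative_point_rate a b x = (exp 1 * x) powr b * exp x / (Gamma b * Gamma (a + b + 1))"

text \<open>
  The parameter \<open>s\<close> is the abscissa of the line used for \<open>\<tilde>H\<^sub>a\<close>; it may be any number strictly between
  \<open>max 0 (-a)\<close> and \<open>1\<close>.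
\<close>

definition rescaled_kernel_bounds :: "real \<Rightarrow> real \<Rightarrow> real \<Rightarrow> real \<Rightarrow> bool" where
  "rescaled_kernel_bounds a s C b \<longleftrightarrow> (\<forall>\<zeta>>0. \<forall>\<xi>>0.
      norm (of_real (b / 4) * R_pp a b (b / 4 * \<zeta>) (b / 4 * \<xi>)) \<le> C * ((\<zeta> / 4) powr a * exp (\<zeta> / 4) * tilde_b_envelope (\<xi> / 4)) \<and>
      norm (of_real (b / 4) * R_pm a b (b / 4 * \<zeta>) (b / 4 * \<xi>)) \<le> C * ((\<zeta> / 4) powr a * exp (\<zeta> / 4) * negative_point_rate a b (\<xi> / 4)) \<and>
      norm (of_real (b / 4) * R_mp a b (b / 4 * \<zeta>) (b / 4 * \<xi>)) \<le> C * ((\<zeta> / 4) powr (-s) * tilde_b_envelope (\<xi> / 4)) + 1 / \<zeta> \<and>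
      norm (of_real (b / 4) * R_mm a b (b / 4 * \<zeta>) (b / 4 * \<xi>)) \<le> C * ((\<zeta> / 4) powr (-s) * negative_point_rate a b (\<xi> / 4)))"

text \<open>
  Multiply the bounds of the two factors. In each kernel the first factor contributes \<open>1 / \<Gamma>(b + 1)\<close>,
  and \<open>b / \<Gamma>(b + 1) = 1 / \<Gamma>(b)\<close>. This cancels against the \<open>\<Gamma>(b)\<close> of \<open>\<tilde>H\<^sub>b\<close> in the kernels \<open>R\<^sup>+\<^sup>+\<close> and
  \<open>R\<^sup>-\<^sup>+\<close>, and becomes part of the rate in the other two. The term \<open>1 / (\<zeta> + \<xi>)\<close> of \<open>R\<^sup>-\<^sup>+\<close> is homogeneous of
  degree \<open>-1\<close> and therefore invariant under the rescaling.
\<close>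

lemma eventually_rescaled_kernel_bounds:
  assumes a: "a > -1" and s: "0 < s" "-a < s" "s < 1"
  obtains C where "C > 0"
    "eventually (rescaled_kernel_bounds a s C) at_top"
proof -
  obtain C1 where C1: "C1 > 0"
    "eventually (\<lambda>b. \<forall>x>0. norm (meijer_H (a + b) a (b * x)) \<le> C1 / Gamma (b + 1) * x powr a * exp x) at_top"
    using meijer_H_a_bound[OF a] by blast
  obtain C2 where C2: "C2 > 0"
    "eventually (\<lambda>b. \<forall>x>0. norm (meijer_H_tilde (a + b) b (b * x)) \<le> C2 * Gamma b * (1 + x + x powr (3/2))) at_top"
    using meijer_H_tilde_b_bound[OF a] by blast
  obtain C3 where C3: "C3 > 0"
    "eventually (\<lambda>b. \<forall>x>0. norm (meijer_H_tilde (a + b) a (b * x)) \<le> C3 / Gamma (b + 1) * x powr (-s)) at_top"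
    using meijer_H_tilde_a_rescaled_bound[OF a s] by blast
  define C where "C = C1 * C2 * powr_moment a + C1 * powr_moment a + C3 * C2 * powr_moment (-s) + C3 * powr_moment (-s) + 1"
  have nn: "0 \<le> C1 * C2 * powr_moment a" "0 \<le> C1 * powr_moment a" "0 \<le> C3 * C2 * powr_moment (-s)" "0 \<le> C3 * powr_moment (-s)"
    using C1(1) C2(1) C3(1) powr_moment_nonneg by auto
  have le: "C1 * C2 * powr_moment a \<le> C" "C1 * powr_moment a \<le> C" "C3 * C2 * powr_moment (-s) \<le> C" "C3 * powr_moment (-s) \<le> C" "C > 0"
    unfolding C_def using nn by linarith+
  show ?thesis
  proof (rule that[OF le(5)])
    show "eventually (rescaled_kernel_bounds a s C) at_top"
      using C1(2) C2(2) C3(2) eventually_ge_at_top[of 1]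
    proof eventually_elim
      case (elim b)
      have b: "b \<ge> 1" "b > 0" using elim(4) by auto
      have Gb: "Gamma b > 0" "Gamma (b + 1) = b * Gamma b" "Gamma (a + b + 1) > 0"
        using b a Gamma_real_plus1[OF b(2)] by (auto intro!: Gamma_real_pos)
      have Ga: "norm (meijer_H (a + b) a (b * x)) \<le> C1 / Gamma (b + 1) * x powr a * exp x" if "x > 0" for x
        using elim(1) that by blast
      have Gtb: "norm (meijer_H_tilde (a + b) b (b * x)) \<le> C2 * Gamma b * tilde_b_envelope x" if "x > 0" for x
        using elim(2) that unfolding tilde_b_envelope_def by blast
      have Gta: "norm (meijer_H_tilde (a + b) a (b * x)) \<le> C3 / Gamma (b + 1) * x powr (-s) * 1" if "x > 0" for x
        using elim(3) that unfolding mult_1_right by blast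
      have Gbb: "norm (meijer_H (a + b) b (b * x)) \<le> 1 / Gamma (a + b + 1) * ((exp 1 * x) powr b * exp x)" if "x > 0" for x
        using meijer_H_b_bound[OF a b(1) that] by simp
      have mono: "(exp 1 * x) powr b * exp x \<le> (exp 1 * y) powr b * exp y" if "0 < x" "x \<le> y" for x y
        using that b by (intro mult_mono powr_mono2) auto
      have nonneg: "C1 / Gamma (b + 1) \<ge> 0" "C2 * Gamma b \<ge> 0" "C3 / Gamma (b + 1) \<ge> 0" "1 / Gamma (a + b + 1) \<ge> 0"
        using C1(1) C2(1) C3(1) Gb b by auto
      have scale: "norm (complex_of_real (b / 4) * J) \<le> b * norm J" for J
        unfolding norm_mult norm_of_real using b by (intro mult_right_mono) auto
      have nz: "Gamma b \<noteq> 0" using Gb by linarith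
      have fin: "b * (A / Gamma (b + 1) * (B * Gamma b) * (m * U * V * W)) = (A * B * m) * (U * V * W)" for A B m U V W
        using b Gb nz by simp
      have fin': "b * (A / Gamma (b + 1) * (1 / Gamma (a + b + 1)) * (m * U * V * ((exp 1 * x) powr b * exp x))) = (A * m) * (U * V * negative_point_rate a b x)" for A m U V x
        using b Gb by (simp add: negative_point_rate_def)
      show ?case
        unfolding rescaled_kernel_bounds_def
      proof (intro allI impI conjI)
        fix \<zeta> \<xi> :: real
        assume pos: "\<zeta> > 0" "\<xi> > 0"
        have env: "tilde_b_envelope (\<xi> / 4) \<ge> 0" "negative_point_rate a b (\<xi> / 4) \<ge> 0"
          using tilde_b_envelope_pos[of "\<xi> / 4"] pos Gb by (auto simp: negative_point_rate_def)
        have "norm (of_real (b / 4) * R_pp a b (b / 4 * \<zeta>) (b / 4 * \<xi>)) \<le> b * norm (R_pp a b (b / 4 * \<zeta>) (b / 4 * \<xi>))"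
          by (rule scale)
        also have "\<dots> \<le> b * (C1 / Gamma (b + 1) * (C2 * Gamma b) * (powr_moment a * (\<zeta> / 4) powr a * exp (\<zeta> / 4) * tilde_b_envelope (\<xi> / 4)))"
          unfolding R_pp_def using b
          by (intro mult_left_mono norm_kernel_integral_le Ga Gtb nonneg tilde_b_envelope_mono less_imp_le[OF tilde_b_envelope_pos] pos a) auto
        also have "\<dots> = (C1 * C2 * powr_moment a) * ((\<zeta> / 4) powr a * exp (\<zeta> / 4) * tilde_b_envelope (\<xi> / 4))" by (rule fin)
        also have "\<dots> \<le> C * ((\<zeta> / 4) powr a * exp (\<zeta> / 4) * tilde_b_envelope (\<xi> / 4))"
          using le env by (intro mult_right_mono) auto
        finally show "norm (of_real (b / 4) * R_pp a b (b / 4 * \<zeta>) (b / 4 * \<xi>)) \<le> C * ((\<zeta> / 4) powr a * exp (\<zeta> / 4) * tilde_b_envelope (\<xi> / 4))" .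
        have "norm (of_real (b / 4) * R_pm a b (b / 4 * \<zeta>) (b / 4 * \<xi>)) \<le> b * norm (R_pm a b (b / 4 * \<zeta>) (b / 4 * \<xi>))"
          by (rule scale)
        also have "\<dots> \<le> b * (C1 / Gamma (b + 1) * (1 / Gamma (a + b + 1)) * (powr_moment a * (\<zeta> / 4) powr a * exp (\<zeta> / 4) * ((exp 1 * (\<xi> / 4)) powr b * exp (\<xi> / 4))))"
          unfolding R_pm_def using b
          by (intro mult_left_mono norm_kernel_integral_le Ga Gbb nonneg mono pos a) auto
        also have "\<dots> = (C1 * powr_moment a) * ((\<zeta> / 4) powr a * exp (\<zeta> / 4) * negative_point_rate a b (\<xi> / 4))" by (rule fin')
        also have "\<dots> \<le> C * ((\<zeta> / 4) powr a * exp (\<zeta> / 4) * negative_point_rate a b (\<xi> / 4))"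
          using le env by (intro mult_right_mono) auto
        finally show "norm (of_real (b / 4) * R_pm a b (b / 4 * \<zeta>) (b / 4 * \<xi>)) \<le> C * ((\<zeta> / 4) powr a * exp (\<zeta> / 4) * negative_point_rate a b (\<xi> / 4))" .
        have "norm (of_real (b / 4) * R_mm a b (b / 4 * \<zeta>) (b / 4 * \<xi>)) \<le> b * norm (R_mm a b (b / 4 * \<zeta>) (b / 4 * \<xi>))"
          by (rule scale)
        also have "\<dots> \<le> b * (C3 / Gamma (b + 1) * (1 / Gamma (a + b + 1)) * (powr_moment (-s) * (\<zeta> / 4) powr (-s) * 1 * ((exp 1 * (\<xi> / 4)) powr b * exp (\<xi> / 4))))"
          unfolding R_mm_def using b s
          by (intro mult_left_mono norm_kernel_integral_le[where u = "\<lambda>_. 1"] Gta Gbb nonneg mono pos a) auto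
        also have "\<dots> = (C3 * powr_moment (-s)) * ((\<zeta> / 4) powr (-s) * 1 * negative_point_rate a b (\<xi> / 4))" by (rule fin')
        also have "\<dots> \<le> C * ((\<zeta> / 4) powr (-s) * 1 * negative_point_rate a b (\<xi> / 4))"
          using le env by (intro mult_right_mono) auto
        finally show "norm (of_real (b / 4) * R_mm a b (b / 4 * \<zeta>) (b / 4 * \<xi>)) \<le> C * ((\<zeta> / 4) powr (-s) * negative_point_rate a b (\<xi> / 4))"
          unfolding mult_1_right .
        define J where "J = (LBINT t:{0<..<1}. meijer_H_tilde (a + b) a (t * (b / 4 * \<zeta>)) * meijer_H_tilde (a + b) b (t * (b / 4 * \<xi>)))"
        have "norm (of_real (b / 4) * J) \<le> b * norm J"
          by (rule scale)
        also have "\<dots> \<le> b * (C3 / Gamma (b + 1) * (C2 * Gamma b) * (powr_moment (-s) * (\<zeta> / 4) powr (-s) * 1 * tilde_b_envelope (\<xi> / 4)))"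
          unfolding J_def using b s
          by (intro mult_left_mono norm_kernel_integral_le[where u = "\<lambda>_. 1"] Gta Gtb nonneg tilde_b_envelope_mono less_imp_le[OF tilde_b_envelope_pos] pos) auto
        also have "\<dots> = (C3 * C2 * powr_moment (-s)) * ((\<zeta> / 4) powr (-s) * 1 * tilde_b_envelope (\<xi> / 4))" by (rule fin)
        also have "\<dots> \<le> C * ((\<zeta> / 4) powr (-s) * 1 * tilde_b_envelope (\<xi> / 4))"
          using le env by (intro mult_right_mono) auto
        finally have J: "norm (of_real (b / 4) * J) \<le> C * ((\<zeta> / 4) powr (-s) * tilde_b_envelope (\<xi> / 4))"
          unfolding mult_1_right .
        have "b / 4 * (1 / (b / 4 * \<zeta> + b / 4 * \<xi>)) = 1 / (\<zeta> + \<xi>)"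
        proof -
          have "b / 4 * \<zeta> + b / 4 * \<xi> = b / 4 * (\<zeta> + \<xi>)" by (simp only: distrib_left)
          then show ?thesis using b by simp
        qed
        then have "complex_of_real (b / 4) * of_real (1 / (b / 4 * \<zeta> + b / 4 * \<xi>)) = of_real (1 / (\<zeta> + \<xi>))"
          by (simp only: of_real_mult[symmetric])
        then have "of_real (b / 4) * R_mp a b (b / 4 * \<zeta>) (b / 4 * \<xi>) = of_real (b / 4) * J - of_real (1 / (\<zeta> + \<xi>))"
          unfolding R_mp_def J_def by (simp only: right_diff_distrib)
        then have "norm (of_real (b / 4) * R_mp a b (b / 4 * \<zeta>) (b / 4 * \<xi>)) \<le> norm (of_real (b / 4) * J) + norm (complex_of_real (1 / (\<zeta> + \<xi>)))"
          by (simp only: norm_triangle_ineq4)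
        also have "norm (complex_of_real (1 / (\<zeta> + \<xi>))) \<le> 1 / \<zeta>"
          unfolding norm_of_real using pos by (simp add: frac_le)
        finally show "norm (of_real (b / 4) * R_mp a b (b / 4 * \<zeta>) (b / 4 * \<xi>)) \<le> C * ((\<zeta> / 4) powr (-s) * tilde_b_envelope (\<xi> / 4)) + 1 / \<zeta>"
          using J by linarith
      qed
    qed
  qed
qed

text \<open>
  Lower bounds for both Gamma functions leave \<open>b (a + b + 1) e\<^sup>-\<^sup>b\<close> times a constant.
\<close>

lemma tendsto_negative_point_rate:
  assumes a: "a > -1" and x: "x > 0"
  shows "((\<lambda>b. negative_point_rate a b x) \<longlongrightarrow> 0) at_top"
proof (rule Lim_null_comparison)
  define A where "A = exp 2 * x"
  have A: "A > 0" using x by (simp add: A_def)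
  show "((\<lambda>b. b * exp A * ((a + b + 1) * exp 1) * exp x * exp (-b)) \<longlongrightarrow> 0) at_top"
  proof -
    have "((\<lambda>b. b * (a + b + 1) * exp (-b)) \<longlongrightarrow> 0) at_top" by real_asymp
    from tendsto_mult_right_zero[OF this, of "exp A * exp 1 * exp x"]
    show ?thesis by (simp only: mult_ac)
  qed
  show "eventually (\<lambda>b. norm (negative_point_rate a b x) \<le> b * exp A * ((a + b + 1) * exp 1) * exp x * exp (-b)) at_top"
    using eventually_ge_at_top[of 1]
  proof eventually_elim
    case (elim b)
    have G: "Gamma b > 0" "Gamma (a + b + 1) > 0" using elim a by (auto intro!: Gamma_real_pos)
    have 1: "A powr b * exp (-A) \<le> b * Gamma b" using elim A by (intro Gamma_real_lower_bound) auto
    have 2: "1 powr (a + b + 1) * exp (-1) \<le> (a + b + 1) * Gamma (a + b + 1)"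
      using elim a by (intro Gamma_real_lower_bound) auto
    have e: "A powr b = exp b * (exp 1 * x) powr b"
    proof -
      have "A = exp 1 * (exp 1 * x)" unfolding A_def by (simp flip: exp_add)
      then have "A powr b = exp 1 powr b * (exp 1 * x) powr b" by (simp only: powr_mult)
      then show ?thesis by (simp add: powr_def)
    qed
    have 3: "(exp 1 * x) powr b / Gamma b \<le> b * exp A * exp (-b)"
    proof -
      have "(exp b * (exp 1 * x) powr b) * exp (-A) * (exp A * exp (-b)) \<le> b * Gamma b * (exp A * exp (-b))"
        using 1 unfolding e by (intro mult_right_mono) auto
      also have "(exp b * (exp 1 * x) powr b) * exp (-A) * (exp A * exp (-b)) = (exp 1 * x) powr b"
      proof -
        have 1: "exp b * exp (-b) = 1" "exp A * exp (-A) = 1" by (simp_all flip: exp_add)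
        have "(exp b * (exp 1 * x) powr b) * exp (-A) * (exp A * exp (-b))
           = (exp b * exp (-b)) * (exp A * exp (-A)) * (exp 1 * x) powr b" by (simp only: mult_ac)
        then show ?thesis unfolding 1 by simp
      qed
      finally show ?thesis using G by (simp add: pos_divide_le_eq mult_ac)
    qed
    have 4: "1 / Gamma (a + b + 1) \<le> (a + b + 1) * exp 1"
    proof -
      have "exp (-1) * exp 1 \<le> (a + b + 1) * Gamma (a + b + 1) * exp (1::real)"
        using 2 by (intro mult_right_mono) auto
      then have "1 \<le> (a + b + 1) * Gamma (a + b + 1) * exp (1::real)" by (simp flip: exp_add)
      then show ?thesis using G by (simp add: pos_divide_le_eq mult_ac)
    qed
    have "norm (negative_point_rate a b x) = (exp 1 * x) powr b / Gamma b * (1 / Gamma (a + b + 1)) * exp x"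
      unfolding negative_point_rate_def using G by simp
    also have "\<dots> \<le> (b * exp A * exp (-b)) * ((a + b + 1) * exp 1) * exp x"
      using 3 4 G elim by (intro mult_right_mono mult_mono) auto
    also have "\<dots> = b * exp A * ((a + b + 1) * exp 1) * exp x * exp (-b)" by (simp only: mult_ac)
    finally show ?case .
  qed
qed

lemma negative_point_rate_mono:
  assumes "a > -1" "b \<ge> 1" "0 < x" "x \<le> y"
  shows "negative_point_rate a b x \<le> negative_point_rate a b y"
proof -
  have "Gamma b > 0" "Gamma (a + b + 1) > 0" using assms by (auto intro!: Gamma_real_pos)
  then show ?thesis
    unfolding negative_point_rate_def using assms
    by (intro divide_right_mono mult_mono powr_mono2) auto
qed

section \<open>The limit of the correlation functions of the + field\<close>

text \<open>
  The series agree term by term after \<open>(\<surd>z / 2)\<^sup>2\<^sup>n\<^sup>+\<^sup>a = (z / 4)\<^sup>a\<^sup>/\<^sup>2 (z / 4)\<^sup>n\<close>.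
\<close>

lemma bessel_J_sqrt:
  assumes a: "a > -1" and z: "z > 0"
  shows "bessel_J a (sqrt z) = (z / 4) powr (a / 2) * bessel_clifford a (z / 4)"
proof -
  have z4: "z / 4 > 0" using z by simp
  have "(\<lambda>n. (z / 4) powr (a / 2) * ((-1) ^ n / fact n * (rGamma (a + 1 + real n) * (z / 4) ^ n)))
      sums ((z / 4) powr (a / 2) * bessel_clifford a (z / 4))"
    by (intro sums_mult bessel_clifford_vertical(3)[OF z4 a])
  also have "(\<lambda>n. (z / 4) powr (a / 2) * ((-1) ^ n / fact n * (rGamma (a + 1 + real n) * (z / 4) ^ n)))
     = (\<lambda>n. (-1) ^ n / (fact n * Gamma (a + real n + 1)) * (sqrt z / 2) powr (2 * real n + a))"
  proof
    fix n
    have "sqrt z / 2 = (z / 4) powr (1/2)"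
      using z by (simp add: powr_half_sqrt real_sqrt_divide)
    then have "(sqrt z / 2) powr (2 * real n + a) = (z / 4) powr ((1/2) * (2 * real n + a))"
      by (simp add: powr_powr)
    also have "(1/2) * (2 * real n + a) = a / 2 + real n" by (simp add: algebra_simps)
    also have "(z / 4) powr (a / 2 + real n) = (z / 4) powr (a / 2) * (z / 4) ^ n"
      using z4 by (simp only: powr_add powr_realpow)
    finally have 1: "(sqrt z / 2) powr (2 * real n + a) = (z / 4) powr (a / 2) * (z / 4) ^ n" .
    have 2: "a + 1 + real n = a + real n + 1" by simp
    show "(z / 4) powr (a / 2) * ((-1) ^ n / fact n * (rGamma (a + 1 + real n) * (z / 4) ^ n))
      = (-1) ^ n / (fact n * Gamma (a + real n + 1)) * (sqrt z / 2) powr (2 * real n + a)"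
      unfolding 1 2 rGamma_inverse_Gamma by (simp only: divide_inverse inverse_mult_distrib mult_ac)
  qed
  finally show ?thesis unfolding bessel_J_def by (simp only: sums_iff)
qed

text \<open>
  The definition by a contour integral says nothing about the dependence on the variable; the series
  exhibits \<open>H\<^sub>c\<close> as a limit of finite sums of powers.
\<close>

lemma measurable_meijer_H:
  assumes z: "z > 0"
  shows "(\<lambda>t. indicat_real {0<..<1} t *\<^sub>R meijer_H \<alpha> c (t * z)) \<in> borel_measurable borel"
proof (rule borel_measurable_LIMSEQ_metric)
  define T where "T = (\<lambda>t n. complex_of_real ((-1) ^ n / fact n * (rGamma (1 + c + real n) * rGamma (\<alpha> + 1 + real n)
            * (t * z) powr (c + real n))))"
  show "(\<lambda>t. indicat_real {0<..<1} t *\<^sub>R (\<Sum>n<N. T t n)) \<in> borel_measurable borel" for N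
    unfolding T_def by measurable
  fix t :: real
  show "(\<lambda>N. indicat_real {0<..<1} t *\<^sub>R (\<Sum>n<N. T t n)) \<longlonglongrightarrow> indicat_real {0<..<1} t *\<^sub>R meijer_H \<alpha> c (t * z)"
  proof (cases "t \<in> {0<..<1}")
    case True
    then have "t * z > 0" using z by simp
    from meijer_H_sums[OF this, of c \<alpha>] True show ?thesis by (simp add: sums_def T_def)
  qed simp
qed

text \<open>
  The line integral depends measurably on its parameter, by Fubini's theorem.
\<close>

lemma measurable_meijer_H_tilde:
  assumes z: "z > 0" and a: "a > -1" and b: "b \<ge> 2"
  shows "(\<lambda>t. indicat_real {0<..<1} t *\<^sub>R meijer_H_tilde (a + b) b (t * z)) \<in> borel_measurable borel"
proof -
  define u where "u = (\<lambda>y. Complex (-3/2) y)"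
  define h where "h = (\<lambda>y. Gamma (u y) * (Gamma (u y + of_real b) * rGamma (of_real (a + 1) - u y)))"
  have "integrable lborel h"
    using meijer_H_tilde_b_vertical(1)[of 1 a b] a b unfolding h_def u_def by (simp add: powr_def)
  then have [measurable]: "h \<in> borel_measurable lborel" by (rule borel_measurable_integrable)
  have [measurable]: "u \<in> borel_measurable lborel" unfolding u_def Complex_eq by measurable
  have I: "(\<lambda>t. LBINT y. h y * exp (- u y * of_real (ln (t * z)))) \<in> borel_measurable borel"
    by (rule lborel.borel_measurable_lebesgue_integral) measurable
  have "(\<lambda>t. indicat_real {0<..<1} t *\<^sub>R (of_real (Gamma b * rGamma (a + 1))
        - of_real (Gamma (b - 1) * rGamma (a + 2) * (t * z)) + 1 / (2 * of_real pi) * (LBINT y. h y * exp (- u y * of_real (ln (t * z))))))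
      \<in> borel_measurable borel"
    using I by measurable
  also have "(\<lambda>t. indicat_real {0<..<1} t *\<^sub>R (of_real (Gamma b * rGamma (a + 1))
        - of_real (Gamma (b - 1) * rGamma (a + 2) * (t * z)) + 1 / (2 * of_real pi) * (LBINT y. h y * exp (- u y * of_real (ln (t * z))))))
    = (\<lambda>t. indicat_real {0<..<1} t *\<^sub>R meijer_H_tilde (a + b) b (t * z))"
  proof
    fix t :: real
    show "indicat_real {0<..<1} t *\<^sub>R (of_real (Gamma b * rGamma (a + 1))
        - of_real (Gamma (b - 1) * rGamma (a + 2) * (t * z)) + 1 / (2 * of_real pi) * (LBINT y. h y * exp (- u y * of_real (ln (t * z)))))
      = indicat_real {0<..<1} t *\<^sub>R meijer_H_tilde (a + b) b (t * z)"
    proof (cases "t \<in> {0<..<1}")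
      case True
      then have tz: "t * z > 0" using z by simp
      show ?thesis
        unfolding meijer_H_tilde_b_vertical(2)[OF tz a b] h_def u_def of_real_powr_conv_exp[OF tz]
        by (simp only: mult.assoc)
    qed simp
  qed
  finally show ?thesis .
qed

text \<open>
  The integrand tends to \<open>(1/4) x\<^sup>a c\<^sub>a(x) c\<^sub>a(y)\<close> with \<open>x = t \<zeta> / 4\<close> and \<open>y = t \<xi> / 4\<close>, where \<open>c\<^sub>a\<close> is the function
  \<open>bessel_clifford a\<close>. It is dominated by a multiple of \<open>t\<^sup>a\<close>. Since \<open>J\<^sub>a(\<surd>(\<zeta> t)) = x\<^sup>a\<^sup>/\<^sup>2 c\<^sub>a(x)\<close>, the limit
  is the integrand of the Bessel kernel times \<open>(x / y)\<^sup>a\<^sup>/\<^sup>2\<close>, and \<open>t\<close> cancels in that factor.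
\<close>

lemma tendsto_R_pp:
  assumes a: "a > -1" and pos: "\<zeta> > 0" "\<xi> > 0"
  shows "((\<lambda>b. of_real (b / 4) * R_pp a b (b / 4 * \<zeta>) (b / 4 * \<xi>)) \<longlongrightarrow>
     of_real ((\<zeta> / 4) powr (a / 2) / (\<xi> / 4) powr (a / 2) * bessel_kernel a \<zeta> \<xi>)) at_top"
proof -
  define x where "x = (\<lambda>t. t * (\<zeta> / 4))"
  define y where "y = (\<lambda>t. t * (\<xi> / 4))"
  define A where "A = (\<lambda>b t. of_real (Gamma (b + 1)) * meijer_H (a + b) a (b * x t))"
  define B where "B = (\<lambda>b t. meijer_H_tilde (a + b) b (b * y t) / of_real (Gamma b))"
  define S where "S = (\<lambda>b t. if b \<ge> 2 then indicat_real {0<..<1} t *\<^sub>R (1 / 4 * A b t * B b t) else 0)"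
  define L where "L = (\<lambda>t. indicat_real {0<..<1} t *\<^sub>R complex_of_real (1 / 4 * (x t powr a * bessel_clifford a (x t)) * bessel_clifford a (y t)))"
  have xy: "x t > 0" "y t > 0" "x t \<le> \<zeta> / 4" "y t \<le> \<xi> / 4" if "t \<in> {0<..<1}" for t
    using that pos by (auto simp: x_def y_def)
  obtain C1 where C1: "C1 > 0"
    "eventually (\<lambda>b. \<forall>x>0. norm (meijer_H (a + b) a (b * x)) \<le> C1 / Gamma (b + 1) * x powr a * exp x) at_top"
    using meijer_H_a_bound[OF a] by blast
  obtain C2 where C2: "C2 > 0"
    "eventually (\<lambda>b. \<forall>x>0. norm (meijer_H_tilde (a + b) b (b * x)) \<le> C2 * Gamma b * (1 + x + x powr (3/2))) at_top"
    using meijer_H_tilde_b_bound[OF a] by blast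
  define K where "K = C1 * (\<zeta> / 4) powr a * exp (\<zeta> / 4) * (C2 * tilde_b_envelope (\<xi> / 4))"
  have meas: "S b \<in> borel_measurable lborel" for b
  proof (cases "b \<ge> 2")
    case True
    have z: "b / 4 * \<zeta> > 0" "b / 4 * \<xi> > 0" using True pos by auto
    have Seq: "S b = (\<lambda>t. of_real (1 / 4 * Gamma (b + 1) / Gamma b) * ((indicat_real {0<..<1} t *\<^sub>R meijer_H (a + b) a (t * (b / 4 * \<zeta>)))
        * (indicat_real {0<..<1} t *\<^sub>R meijer_H_tilde (a + b) b (t * (b / 4 * \<xi>)))))"
    proof
      fix t
      have e: "b * x t = t * (b / 4 * \<zeta>)" "b * y t = t * (b / 4 * \<xi>)" by (simp_all add: x_def y_def)
      show "S b t = of_real (1 / 4 * Gamma (b + 1) / Gamma b) * ((indicat_real {0<..<1} t *\<^sub>R meijer_H (a + b) a (t * (b / 4 * \<zeta>)))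
        * (indicat_real {0<..<1} t *\<^sub>R meijer_H_tilde (a + b) b (t * (b / 4 * \<xi>))))"
        unfolding S_def A_def B_def e using True by (cases "t \<in> {0<..<1}") simp_all
    qed
    have "S b \<in> borel_measurable borel"
      unfolding Seq
      by (intro borel_measurable_times borel_measurable_const measurable_meijer_H[OF z(1)] measurable_meijer_H_tilde[OF z(2) a True])
    then show ?thesis by simp
  qed (simp add: S_def)
  have lim: "((\<lambda>b. S b t) \<longlongrightarrow> L t) at_top" for t
  proof (cases "t \<in> {0<..<1}")
    case True
    have "((\<lambda>b. 1 / 4 * A b t * B b t) \<longlongrightarrow> 1 / 4 * of_real (x t powr a * bessel_clifford a (x t)) * of_real (bessel_clifford a (y t))) at_top"
      unfolding A_def B_def
      by (intro tendsto_mult tendsto_const tendsto_meijer_H_a[OF a] tendsto_meijer_H_tilde_b[OF a] xy True)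
    also have "1 / 4 * of_real (x t powr a * bessel_clifford a (x t)) * of_real (bessel_clifford a (y t)) = L t"
      using True unfolding L_def by simp
    finally show ?thesis
    proof (rule Lim_transform_eventually)
      show "eventually (\<lambda>b. 1 / 4 * A b t * B b t = S b t) at_top"
        using eventually_ge_at_top[of 2] by eventually_elim (use True in \<open>simp add: S_def\<close>)
    qed
  next
    case False
    then have "(\<lambda>b. S b t) = (\<lambda>_. L t)" by (auto simp: S_def L_def)
    then show ?thesis by simp
  qed
  have "((\<lambda>b. LBINT t. S b t) \<longlongrightarrow> (LBINT t. L t)) at_top"
  proof (rule integral_dominated_convergence_at_top)
    show "S b \<in> borel_measurable lborel" for b by (rule meas)
    show "L \<in> borel_measurable lborel"
    proof (rule borel_measurable_LIMSEQ_metric[of "\<lambda>n. S (real n)"])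
      show "S (real n) \<in> borel_measurable lborel" for n by (rule meas)
      show "(\<lambda>n. S (real n) t) \<longlonglongrightarrow> L t" for t
        using filterlim_compose[OF lim filterlim_real_sequentially] .
    qed
    show "AE t in lborel. ((\<lambda>b. S b t) \<longlongrightarrow> L t) at_top" using lim by (intro AE_I2)
    have "set_integrable lborel {0<..<1} (\<lambda>t. K * t powr a)"
      by (intro set_integrable_mult_right set_integrable_powr_unit a)
    then show "integrable lborel (\<lambda>t. indicat_real {0<..<1} t *\<^sub>R (K * t powr a))"
      by (simp add: set_integrable_def)
    show "eventually (\<lambda>b. AE t in lborel. norm (S b t) \<le> indicat_real {0<..<1} t *\<^sub>R (K * t powr a)) at_top"
      using C1(2) C2(2) eventually_ge_at_top[of 2]
    proof eventually_elim
      case (elim b)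
      have G: "Gamma b > 0" "Gamma (b + 1) > 0" using elim(3) by (auto intro!: Gamma_real_pos)
      show ?case
      proof (rule AE_I2)
        fix t
        show "norm (S b t) \<le> indicat_real {0<..<1} t *\<^sub>R (K * t powr a)"
        proof (cases "t \<in> {0<..<1}")
          case True
          note xyt = xy[OF True]
          have "norm (A b t) = Gamma (b + 1) * norm (meijer_H (a + b) a (b * x t))"
            unfolding A_def norm_mult norm_of_real using G by simp
          also have "\<dots> \<le> Gamma (b + 1) * (C1 / Gamma (b + 1) * x t powr a * exp (x t))"
            using elim(1) xyt(1) G by (intro mult_left_mono) auto
          also have "\<dots> = C1 * x t powr a * exp (x t)" using G(2) by simp
          also have "\<dots> \<le> C1 * x t powr a * exp (\<zeta> / 4)"
            using xyt(3) C1(1) by (intro mult_left_mono) auto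
          finally have 1: "norm (A b t) \<le> C1 * x t powr a * exp (\<zeta> / 4)" .
          have "norm (B b t) = norm (meijer_H_tilde (a + b) b (b * y t)) / Gamma b"
            unfolding B_def norm_divide norm_of_real using G by simp
          also have "\<dots> \<le> (C2 * Gamma b * (1 + y t + y t powr (3/2))) / Gamma b"
            using elim(2) xyt(2) G by (intro divide_right_mono) auto
          also have "\<dots> = C2 * tilde_b_envelope (y t)"
          proof -
            have "Gamma b \<noteq> 0" using G by linarith
            then show ?thesis by (simp add: tilde_b_envelope_def)
          qed
          also have "\<dots> \<le> C2 * tilde_b_envelope (\<xi> / 4)"
            using xyt C2(1) by (intro mult_left_mono tilde_b_envelope_mono) auto
          finally have 2: "norm (B b t) \<le> C2 * tilde_b_envelope (\<xi> / 4)" .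
          have "norm (S b t) = 1 / 4 * (norm (A b t) * norm (B b t))"
            using True elim(3) by (simp add: S_def norm_mult)
          also have "\<dots> \<le> norm (A b t) * norm (B b t)" by simp
          also have "\<dots> \<le> (C1 * x t powr a * exp (\<zeta> / 4)) * (C2 * tilde_b_envelope (\<xi> / 4))"
            by (rule mult_mono[OF 1 2 order_trans[OF norm_ge_zero 1]]) simp
          also have "x t powr a = t powr a * (\<zeta> / 4) powr a" unfolding x_def by (rule powr_mult)
          also have "C1 * (t powr a * (\<zeta> / 4) powr a) * exp (\<zeta> / 4) * (C2 * tilde_b_envelope (\<xi> / 4)) = K * t powr a"
            unfolding K_def by (simp only: mult_ac)
          finally show ?thesis using True by simp
        next
          case False
          then show ?thesis by (simp add: S_def)
        qed
      qed
    qed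
  qed
  moreover have "eventually (\<lambda>b. (LBINT t. S b t) = of_real (b / 4) * R_pp a b (b / 4 * \<zeta>) (b / 4 * \<xi>)) at_top"
    using eventually_ge_at_top[of 2]
  proof eventually_elim
    case (elim b)
    have "Gamma b > 0" using elim by (intro Gamma_real_pos) simp
    then have G: "Gamma b \<noteq> 0" by linarith
    have G': "Gamma (b + 1) = b * Gamma b" using elim by (intro Gamma_real_plus1) simp
    have Seq: "S b t = of_real (b / 4) * (indicat_real {0<..<1} t *\<^sub>R (meijer_H (a + b) a (t * (b / 4 * \<zeta>)) * meijer_H_tilde (a + b) b (t * (b / 4 * \<xi>))))" for t
    proof -
      have e: "b * x t = t * (b / 4 * \<zeta>)" "b * y t = t * (b / 4 * \<xi>)" by (simp_all add: x_def y_def)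
      show ?thesis unfolding S_def A_def B_def e using elim G G' by (cases "t \<in> {0<..<1}") simp_all
    qed
    show ?case unfolding Seq R_pp_def set_lebesgue_integral_def by (rule integral_mult_right_zero)
  qed
  ultimately have main: "((\<lambda>b. of_real (b / 4) * R_pp a b (b / 4 * \<zeta>) (b / 4 * \<xi>)) \<longlongrightarrow> (LBINT t. L t)) at_top"
    by (rule Lim_transform_eventually)
  have L: "L t = complex_of_real ((\<zeta> / 4) powr (a / 2) / (\<xi> / 4) powr (a / 2) * (1 / 4 * (indicat_real {0<..<1} t *\<^sub>R (bessel_J a (sqrt (\<zeta> * t)) * bessel_J a (sqrt (\<xi> * t))))))" for t
  proof (cases "t \<in> {0<..<1}")
    case True
    then have t: "t > 0" by simp
    have J1: "bessel_J a (sqrt (\<zeta> * t)) = x t powr (a / 2) * bessel_clifford a (x t)"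
      using bessel_J_sqrt[OF a, of "\<zeta> * t"] t pos by (simp add: x_def mult.commute)
    have J2: "bessel_J a (sqrt (\<xi> * t)) = y t powr (a / 2) * bessel_clifford a (y t)"
      using bessel_J_sqrt[OF a, of "\<xi> * t"] t pos by (simp add: y_def mult.commute)
    have px: "x t powr a = x t powr (a / 2) * x t powr (a / 2)" by (simp flip: powr_add)
    have x2: "x t powr (a / 2) = t powr (a / 2) * (\<zeta> / 4) powr (a / 2)" unfolding x_def by (rule powr_mult)
    have y2: "y t powr (a / 2) = t powr (a / 2) * (\<xi> / 4) powr (a / 2)" unfolding y_def by (rule powr_mult)
    have nz: "(\<xi> / 4) powr (a / 2) \<noteq> 0" using pos by simp
    have "1 / 4 * (x t powr a * bessel_clifford a (x t)) * bessel_clifford a (y t) =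
      (\<zeta> / 4) powr (a / 2) / (\<xi> / 4) powr (a / 2) * (1 / 4 * (bessel_J a (sqrt (\<zeta> * t)) * bessel_J a (sqrt (\<xi> * t))))"
      unfolding J1 J2 px x2 y2 using nz by simp
    then show ?thesis using True unfolding L_def by (simp only: indicator_simps scaleR_one)
  next
    case False
    then show ?thesis by (simp add: L_def)
  qed
  have "(LBINT t. L t) = of_real ((\<zeta> / 4) powr (a / 2) / (\<xi> / 4) powr (a / 2) * bessel_kernel a \<zeta> \<xi>)"
    unfolding L integral_complex_of_real bessel_kernel_def set_lebesgue_integral_def by simp
  with main show ?thesis by simp
qed

lemma tendsto_rescaled_plus_correlation:
  fixes \<zeta> :: "nat \<Rightarrow> real"
  assumes a: "a > -1" and pos: "\<And>i. i < r \<Longrightarrow> \<zeta> i > 0"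
  shows "((\<lambda>b. of_real ((b / 4) ^ r) *
              Determinant.det (Matrix.mat r r (\<lambda>(i, j). R_pp a b (b / 4 * \<zeta> i) (b / 4 * \<zeta> j))))
          \<longlongrightarrow> of_real (Determinant.det (Matrix.mat r r (\<lambda>(i, j). bessel_kernel a (\<zeta> i) (\<zeta> j))))) at_top"
proof -
  \<comment> \<open>The conjugation that turns the limit kernel into the Bessel kernel.\<close>
  define d where "d = (\<lambda>i. complex_of_real ((\<zeta> i / 4) powr (a / 2)))"
  have "((\<lambda>b. Determinant.det (Matrix.mat r r (\<lambda>(i, j). of_real (b / 4) * R_pp a b (b / 4 * \<zeta> i) (b / 4 * \<zeta> j)))) \<longlongrightarrow>
     Determinant.det (Matrix.mat r r (\<lambda>(i, j). d i / d j * of_real (bessel_kernel a (\<zeta> i) (\<zeta> j))))) at_top"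
  proof (rule tendsto_det)
    fix i j assume ij: "i < r" "j < r"
    show "((\<lambda>b. of_real (b / 4) * R_pp a b (b / 4 * \<zeta> i) (b / 4 * \<zeta> j)) \<longlongrightarrow> d i / d j * of_real (bessel_kernel a (\<zeta> i) (\<zeta> j))) at_top"
      using tendsto_R_pp[OF a pos[OF ij(1)] pos[OF ij(2)]] unfolding d_def by simp
  qed
  also have "Determinant.det (Matrix.mat r r (\<lambda>(i, j). d i / d j * of_real (bessel_kernel a (\<zeta> i) (\<zeta> j))))
     = Determinant.det (Matrix.mat r r (\<lambda>(i, j). of_real (bessel_kernel a (\<zeta> i) (\<zeta> j))))"
    by (rule det_diagonal_conjugation) (use pos in \<open>force simp: d_def\<close>)
  also have "\<dots> = of_real (Determinant.det (Matrix.mat r r (\<lambda>(i, j). bessel_kernel a (\<zeta> i) (\<zeta> j))))"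
    by (rule det_of_real_mat)
  finally show ?thesis unfolding det_mult_entries[symmetric] by (simp only: of_real_power)
qed

section \<open>Correlation functions with points of the - field\<close>

lemma compact_pos_bounds:
  assumes "compact K" "K \<subseteq> {0<..}"
  obtains m X :: real where "0 < m" "m \<le> X" "\<And>x. x \<in> K \<Longrightarrow> m \<le> x \<and> x \<le> X"
proof (cases "K = {}")
  case True
  then show ?thesis by (intro that[of 1 1]) auto
next
  case False
  obtain m where m: "m \<in> K" "\<And>x. x \<in> K \<Longrightarrow> m \<le> x"
    using compact_attains_inf[OF assms(1) False] by blast
  obtain X where X: "X \<in> K" "\<And>x. x \<in> K \<Longrightarrow> x \<le> X"
    using compact_attains_sup[OF assms(1) False] by blast
  show ?thesis
    by (rule that[of m X]) (use m X assms in auto)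
qed

text \<open>
  The exponent may have either sign; the power is monotone in both cases.
\<close>

lemma powr_le_endpoints:
  assumes "0 < m" "m \<le> x" "x \<le> (X::real)"
  shows "x powr p \<le> m powr p + X powr p"
proof (cases "p \<ge> 0")
  case True
  then have "x powr p \<le> X powr p" using assms by (intro powr_mono2) auto
  then show ?thesis using powr_ge_zero[of m p] by linarith
next
  case False
  then have "x powr p \<le> m powr p" using assms by (intro powr_mono2') auto
  then show ?thesis using powr_ge_zero[of X p] by linarith
qed

text \<open>
  Column \<open>r\<close> of the matrix is the column of the first point of the \<open>-\<close> field.
\<close>

lemma rescaled_meijer_rho_small:
  assumes s1: "s \<ge> 1" and M: "M \<ge> 0"
    and pp: "\<And>i j. i < r \<Longrightarrow> j < r \<Longrightarrow> norm (of_real (b / 4) * R_pp a b (b / 4 * \<zeta> i) (b / 4 * \<zeta> j)) \<le> M"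
    and pm: "\<And>i j. i < r \<Longrightarrow> j < s \<Longrightarrow> norm (of_real (b / 4) * R_pm a b (b / 4 * \<zeta> i) (b / 4 * \<xi> j)) \<le> \<delta>"
    and mp: "\<And>i j. i < s \<Longrightarrow> j < r \<Longrightarrow> norm (of_real (b / 4) * R_mp a b (b / 4 * \<xi> i) (b / 4 * \<zeta> j)) \<le> M"
    and mm: "\<And>i j. i < s \<Longrightarrow> j < s \<Longrightarrow> norm (of_real (b / 4) * R_mm a b (b / 4 * \<xi> i) (b / 4 * \<xi> j)) \<le> \<delta>"
    and d: "\<delta> \<le> M"
  shows "norm (rescaled_meijer_rho a b r s \<zeta> \<xi>) \<le> fact (r + s) * (\<delta> * M ^ (r + s - 1))"
proof -
  define A where "A = four_block_mat
     (Matrix.mat r r (\<lambda>(i, j). R_pp a b (b / 4 * \<zeta> i) (b / 4 * \<zeta> j)))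
     (Matrix.mat r s (\<lambda>(i, j). R_pm a b (b / 4 * \<zeta> i) (b / 4 * \<xi> j)))
     (Matrix.mat s r (\<lambda>(i, j). R_mp a b (b / 4 * \<xi> i) (b / 4 * \<zeta> j)))
     (Matrix.mat s s (\<lambda>(i, j). R_mm a b (b / 4 * \<xi> i) (b / 4 * \<xi> j)))"
  define B where "B = of_real (b / 4) \<cdot>\<^sub>m A"
  have A: "A \<in> carrier_mat (r + s) (r + s)" unfolding A_def by (rule four_block_carrier_mat) auto
  then have B: "B \<in> carrier_mat (r + s) (r + s)" unfolding B_def by simp
  have "rescaled_meijer_rho a b r s \<zeta> \<xi> = of_real (b / 4) ^ (r + s) * Determinant.det A"
    unfolding rescaled_meijer_rho_def meijer_rho_def A_def by (simp only: of_real_power)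
  also have "\<dots> = Determinant.det B" unfolding B_def using A by simp
  finally have rho: "rescaled_meijer_rho a b r s \<zeta> \<xi> = Determinant.det B" .
  have entry: "B $$ (i, j) = of_real (b / 4) * (if i < r then
        if j < r then R_pp a b (b / 4 * \<zeta> i) (b / 4 * \<zeta> j) else R_pm a b (b / 4 * \<zeta> i) (b / 4 * \<xi> (j - r))
      else if j < r then R_mp a b (b / 4 * \<xi> (i - r)) (b / 4 * \<zeta> j) else R_mm a b (b / 4 * \<xi> (i - r)) (b / 4 * \<xi> (j - r)))"
    if "i < r + s" "j < r + s" for i j
  proof -
    have "B $$ (i, j) = of_real (b / 4) * A $$ (i, j)" using A that unfolding B_def by simp
    also have "A $$ (i, j) = (if i < r then
        if j < r then R_pp a b (b / 4 * \<zeta> i) (b / 4 * \<zeta> j) else R_pm a b (b / 4 * \<zeta> i) (b / 4 * \<xi> (j - r))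
      else if j < r then R_mp a b (b / 4 * \<xi> (i - r)) (b / 4 * \<zeta> j) else R_mm a b (b / 4 * \<xi> (i - r)) (b / 4 * \<xi> (j - r)))"
      using that unfolding A_def by (subst index_mat_four_block) auto
    finally show ?thesis .
  qed
  show ?thesis
    unfolding rho
  proof (rule norm_det_le_small_column[OF B _ M])
    show "r < r + s" using s1 by simp
    fix i assume i: "i < r + s"
    show "norm (B $$ (i, r)) \<le> \<delta>"
    proof (cases "i < r")
      case True
      then show ?thesis using pm[of i 0] s1 i by (simp only: entry) simp
    next
      case False
      then have "i - r < s" using i by simp
      then show ?thesis using mm[of "i - r" 0] s1 i False by (simp only: entry) simp
    qed
    fix j assume j: "j < r + s"
    show "norm (B $$ (i, j)) \<le> M"
    proof (cases "i < r")
      case True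
      show ?thesis
      proof (cases "j < r")
        case True
        then show ?thesis using pp[of i j] i j \<open>i < r\<close> by (simp only: entry) simp
      next
        case False
        then have "j - r < s" using j by simp
        then show ?thesis using pm[of i "j - r"] i j d \<open>i < r\<close> False by (simp only: entry) simp
      qed
    next
      case False
      then have i': "i - r < s" "\<not> i < r" using i by auto
      show ?thesis
      proof (cases "j < r")
        case True
        then show ?thesis using mp[of "i - r" j] i j i' by (simp only: entry) simp
      next
        case False
        then have "j - r < s" using j by simp
        then show ?thesis using mm[of "i - r" "j - r"] i j d i' False by (simp only: entry) simp
      qed
    qed
  qed
qed

text \<open>
  On a compact set the bounds for the kernels are uniform. The abscissa \<open>\<sigma>\<close> is the midpoint of the
  admissible interval.
\<close>

lemma uniform_limit_rescaled_meijer_rho: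
  assumes a: "a > -1" and s1: "s \<ge> 1" and K: "compact K" "K \<subseteq> {0<..}"
  shows "uniform_limit {(\<zeta>, \<xi>). (\<forall>i<r. \<zeta> i \<in> K) \<and> (\<forall>j<s. \<xi> j \<in> K)}
          (\<lambda>b (\<zeta>, \<xi>). rescaled_meijer_rho a b r s \<zeta> \<xi>) (\<lambda>_. 0) at_top"
proof (rule uniform_limitI)
  fix e :: real
  assume e: "e > 0"
  define \<sigma> where "\<sigma> = (1 + max 0 (-a)) / 2"
  have \<sigma>: "0 < \<sigma>" "-a < \<sigma>" "\<sigma> < 1" using a by (auto simp: \<sigma>_def)
  obtain C where C: "C > 0" and kb:
    "eventually (rescaled_kernel_bounds a \<sigma> C) at_top"
    using eventually_rescaled_kernel_bounds[OF a \<sigma>] by blast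
  obtain m X where mX: "0 < m" "m \<le> X" "\<And>x. x \<in> K \<Longrightarrow> m \<le> x \<and> x \<le> X"
    using compact_pos_bounds[OF K] by blast
  define W where "W = (\<lambda>p. (m / 4) powr p + (X / 4) powr p)"
  define V where "V = W a * exp (X / 4) + W (-\<sigma>)"
  define E where "E = tilde_b_envelope (X / 4)"
  define M where "M = C * (V * E) + 1 / m + 1"
  define \<delta> where "\<delta> = (\<lambda>b. C * (V * negative_point_rate a b (X / 4)))"
  have X: "X / 4 > 0" using mX by simp
  have Wpos: "W p \<ge> 0" for p by (simp add: W_def)
  have V: "W a * exp (X / 4) \<le> V" "W (-\<sigma>) \<le> V" "V \<ge> 0" using Wpos by (auto simp: V_def)
  have E: "E \<ge> 0" unfolding E_def using tilde_b_envelope_pos[OF X] by simp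
  have M: "M \<ge> 1" using C V E mX by (simp add: M_def)
  have \<delta>0: "(\<delta> \<longlongrightarrow> 0) at_top"
    unfolding \<delta>_def by (intro tendsto_mult_right_zero tendsto_negative_point_rate a X)
  have ev1: "eventually (\<lambda>b. \<delta> b < 1) at_top" using order_tendstoD(2)[OF \<delta>0, of 1] by simp
  have "((\<lambda>b. fact (r + s) * (\<delta> b * M ^ (r + s - 1))) \<longlongrightarrow> fact (r + s) * (0 * M ^ (r + s - 1))) at_top"
    by (intro tendsto_mult tendsto_const \<delta>0)
  then have ev2: "eventually (\<lambda>b. fact (r + s) * (\<delta> b * M ^ (r + s - 1)) < e) at_top"
    using e by (intro order_tendstoD(2)) simp_all
  show "\<forall>\<^sub>F b in at_top. \<forall>x\<in>{(\<zeta>, \<xi>). (\<forall>i<r. \<zeta> i \<in> K) \<and> (\<forall>j<s. \<xi> j \<in> K)}.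
          dist ((\<lambda>(\<zeta>, \<xi>). rescaled_meijer_rho a b r s \<zeta> \<xi>) x) 0 < e"
    using kb ev1 ev2 eventually_ge_at_top[of 1]
  proof eventually_elim
    case (elim b)
    have rate: "negative_point_rate a b x \<ge> 0" if "x > 0" for x
    proof -
      have "Gamma b > 0" "Gamma (a + b + 1) > 0" using elim(4) a by (auto intro!: Gamma_real_pos)
      then show ?thesis using that by (simp add: negative_point_rate_def)
    qed
    have K4: "0 < x / 4" "m / 4 \<le> x / 4" "x / 4 \<le> X / 4" "x > 0" if "x \<in> K" for x
      using mX(1) mX(3)[OF that] by auto
    have U: "(x / 4) powr a * exp (x / 4) \<le> V" if "x \<in> K" for x
    proof -
      have "(x / 4) powr a * exp (x / 4) \<le> W a * exp (X / 4)"
        unfolding W_def using mX K4[OF that] by (intro mult_mono powr_le_endpoints) auto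
      then show ?thesis using V by linarith
    qed
    have U': "(x / 4) powr (-\<sigma>) \<le> V" if "x \<in> K" for x
    proof -
      have "(x / 4) powr (-\<sigma>) \<le> W (-\<sigma>)"
        unfolding W_def using mX K4[OF that] by (intro powr_le_endpoints) auto
      then show ?thesis using V by linarith
    qed
    have env: "tilde_b_envelope (x / 4) \<le> E" "0 \<le> tilde_b_envelope (x / 4)" if "x \<in> K" for x
      unfolding E_def using K4[OF that] tilde_b_envelope_mono[of "x/4" "X/4"] tilde_b_envelope_pos[of "x/4"] by auto
    have ra: "negative_point_rate a b (x / 4) \<le> negative_point_rate a b (X / 4)" "0 \<le> negative_point_rate a b (x / 4)" if "x \<in> K" for x
      using K4[OF that] negative_point_rate_mono[OF a elim(4), of "x/4" "X/4"] rate[of "x/4"] by auto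
    have bpp: "norm (of_real (b / 4) * R_pp a b (b / 4 * x) (b / 4 * y)) \<le> M" if "x \<in> K" "y \<in> K" for x y
    proof -
      have "norm (of_real (b / 4) * R_pp a b (b / 4 * x) (b / 4 * y)) \<le> C * ((x / 4) powr a * exp (x / 4) * tilde_b_envelope (y / 4))"
        using elim(1) K4(4) that unfolding rescaled_kernel_bounds_def by blast
      also have "\<dots> \<le> C * (V * E)"
        using C V U[OF that(1)] env[OF that(2)] by (intro mult_left_mono mult_mono) auto
      also have "\<dots> \<le> M" using mX by (simp add: M_def)
      finally show ?thesis .
    qed
    have bpm: "norm (of_real (b / 4) * R_pm a b (b / 4 * x) (b / 4 * y)) \<le> \<delta> b" if "x \<in> K" "y \<in> K" for x y
    proof -
      have "norm (of_real (b / 4) * R_pm a b (b / 4 * x) (b / 4 * y)) \<le> C * ((x / 4) powr a * exp (x / 4) * negative_point_rate a b (y / 4))"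
        using elim(1) K4(4) that unfolding rescaled_kernel_bounds_def by blast
      also have "\<dots> \<le> \<delta> b" unfolding \<delta>_def
        using C V U[OF that(1)] ra[OF that(2)] by (intro mult_left_mono mult_mono) auto
      finally show ?thesis .
    qed
    have bmp: "norm (of_real (b / 4) * R_mp a b (b / 4 * x) (b / 4 * y)) \<le> M" if "x \<in> K" "y \<in> K" for x y
    proof -
      have "norm (of_real (b / 4) * R_mp a b (b / 4 * x) (b / 4 * y)) \<le> C * ((x / 4) powr (-\<sigma>) * tilde_b_envelope (y / 4)) + 1 / x"
        using elim(1) K4(4) that unfolding rescaled_kernel_bounds_def by blast
      also have "\<dots> \<le> C * (V * E) + 1 / m"
        using C V U'[OF that(1)] env[OF that(2)] mX(1) mX(3)[OF that(1)]
        by (intro add_mono mult_left_mono mult_mono divide_left_mono) auto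
      also have "\<dots> \<le> M" by (simp add: M_def)
      finally show ?thesis .
    qed
    have bmm: "norm (of_real (b / 4) * R_mm a b (b / 4 * x) (b / 4 * y)) \<le> \<delta> b" if "x \<in> K" "y \<in> K" for x y
    proof -
      have "norm (of_real (b / 4) * R_mm a b (b / 4 * x) (b / 4 * y)) \<le> C * ((x / 4) powr (-\<sigma>) * negative_point_rate a b (y / 4))"
        using elim(1) K4(4) that unfolding rescaled_kernel_bounds_def by blast
      also have "\<dots> \<le> \<delta> b" unfolding \<delta>_def
        using C V U'[OF that(1)] ra[OF that(2)] by (intro mult_left_mono mult_mono) auto
      finally show ?thesis .
    qed
    show ?case
    proof (rule ballI)
      fix x
      assume "x \<in> {(\<zeta>, \<xi>). (\<forall>i<r. \<zeta> i \<in> K) \<and> (\<forall>j<s. \<xi> j \<in> K)}"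
      then obtain \<zeta> \<xi> where x: "x = (\<zeta>, \<xi>)" and mem: "\<And>i. i < r \<Longrightarrow> \<zeta> i \<in> K" "\<And>j. j < s \<Longrightarrow> \<xi> j \<in> K"
        by auto
      have "norm (rescaled_meijer_rho a b r s \<zeta> \<xi>) \<le> fact (r + s) * (\<delta> b * M ^ (r + s - 1))"
      proof (rule rescaled_meijer_rho_small[OF s1])
        show "M \<ge> 0" "\<delta> b \<le> M" using M elim(2) by linarith+
      qed (intro bpp bpm bmp bmm mem; assumption)+
      also have "\<dots> < e" by (rule elim(3))
      finally show "dist ((\<lambda>(\<zeta>, \<xi>). rescaled_meijer_rho a b r s \<zeta> \<xi>) x) 0 < e"
        unfolding x case_prod_conv dist_norm diff_zero .
    qed
  qed
qed

section \<open>Probability of points of the - field\<close>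

lemma card_distinct_tuples_0: "card (distinct_tuples 0 S A) = 1"
  by (simp add: distinct_tuples_def)

lemma card_distinct_tuples_1: "card (distinct_tuples 1 S A) = card (S \<inter> A 0)"
proof -
  have "distinct_tuples 1 S A = (\<Pi>\<^sub>E i\<in>{..<1}. S \<inter> A i)"
    by (auto simp: distinct_tuples_def inj_on_def)
  also have "card \<dots> = (\<Prod>i<1. card (S \<inter> A i))" by (rule card_PiE) simp
  finally show ?thesis by simp
qed

lemma meijer_rho_single_minus: "meijer_rho a b 0 1 x y = R_mm a b (y 0) (y 0)"
proof -
  define A where "A = four_block_mat
     (Matrix.mat 0 0 (\<lambda>(i, j). R_pp a b (x i) (x j)))
     (Matrix.mat 0 1 (\<lambda>(i, j). R_pm a b (x i) (y j)))
     (Matrix.mat 1 0 (\<lambda>(i, j). R_mp a b (y i) (x j)))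
     (Matrix.mat 1 1 (\<lambda>(i, j). R_mm a b (y i) (y j)))"
  have "A \<in> carrier_mat (0 + 1) (0 + 1)" unfolding A_def by (rule four_block_carrier_mat) auto
  then have "A \<in> carrier_mat 1 1" by simp
  then have "Determinant.det A = A $$ (0, 0)" by (rule det_single)
  also have "\<dots> = R_mm a b (y 0) (y 0)"
    unfolding A_def by (subst index_mat_four_block) auto
  finally show ?thesis by (simp only: meijer_rho_def A_def)
qed

text \<open>
  For \<open>r = 0\<close> and \<open>s = 1\<close> the reference measure is Lebesgue measure, up to a one-point factor and a
  one-element index set.
\<close>

lemma emeasure_single_point_box:
  fixes A :: "nat \<Rightarrow> real set" and B :: "real set"
  assumes B: "B \<in> sets borel"
  shows "emeasure ((\<Pi>\<^sub>M i\<in>{..<0::nat}. lborel) \<Otimes>\<^sub>M (\<Pi>\<^sub>M j\<in>{..<1::nat}. lborel))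
           ((\<Pi>\<^sub>E i\<in>{..<0}. A i) \<times> (\<Pi>\<^sub>E j\<in>{..<1}. B)) = emeasure lborel B" (is ?emeasure)
    and "(\<Pi>\<^sub>E i\<in>{..<0}. A i) \<times> (\<Pi>\<^sub>E j\<in>{..<1}. B) \<in> sets ((\<Pi>\<^sub>M i\<in>{..<0::nat}. lborel) \<Otimes>\<^sub>M (\<Pi>\<^sub>M j\<in>{..<1::nat}. lborel))" (is ?measurable)
proof -
  interpret product_sigma_finite "\<lambda>_::nat. (lborel :: real measure)" by unfold_locales
  interpret S1: sigma_finite_measure "\<Pi>\<^sub>M j\<in>{..<1::nat}. (lborel :: real measure)"
    by (rule sigma_finite) simp
  have s0: "(\<Pi>\<^sub>E i\<in>{..<0}. A i) \<in> sets (\<Pi>\<^sub>M i\<in>{..<0::nat}. (lborel :: real measure))"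
    by (rule sets_PiM_I_finite) auto
  have s1: "(\<Pi>\<^sub>E j\<in>{..<1}. B) \<in> sets (\<Pi>\<^sub>M j\<in>{..<1::nat}. (lborel :: real measure))"
    by (rule sets_PiM_I_finite) (use B in auto)
  have e0: "emeasure (\<Pi>\<^sub>M i\<in>{..<0::nat}. (lborel :: real measure)) (\<Pi>\<^sub>E i\<in>{..<0}. A i) = (\<Prod>i<0. emeasure lborel (A i))"
    by (rule emeasure_PiM) auto
  have e1: "emeasure (\<Pi>\<^sub>M j\<in>{..<1::nat}. (lborel :: real measure)) (\<Pi>\<^sub>E j\<in>{..<1}. B) = (\<Prod>j<(1::nat). emeasure lborel B)"
    by (rule emeasure_PiM) (use B in auto)
  show ?measurable
    using s0 s1 by (rule pair_measureI)
  have "emeasure ((\<Pi>\<^sub>M i\<in>{..<0::nat}. lborel) \<Otimes>\<^sub>M (\<Pi>\<^sub>M j\<in>{..<1::nat}. lborel))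
           ((\<Pi>\<^sub>E i\<in>{..<0}. A i) \<times> (\<Pi>\<^sub>E j\<in>{..<1}. B))
     = emeasure (\<Pi>\<^sub>M i\<in>{..<0::nat}. (lborel :: real measure)) (\<Pi>\<^sub>E i\<in>{..<0}. A i) * emeasure (\<Pi>\<^sub>M j\<in>{..<1::nat}. (lborel :: real measure)) (\<Pi>\<^sub>E j\<in>{..<1}. B)"
    by (rule S1.emeasure_pair_measure_Times[OF s0 s1])
  also have "\<dots> = emeasure lborel B" unfolding e0 e1 by simp
  finally show ?emeasure .
qed

lemma norm_integral_le_integral:
  fixes f :: "'c \<Rightarrow> complex"
  assumes "integrable N f" "integrable N g" "\<And>x. norm (f x) \<le> g x"
  shows "norm (integral\<^sup>L N f) \<le> integral\<^sup>L N g"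
proof -
  have "norm (integral\<^sup>L N f) \<le> integral\<^sup>L N (\<lambda>x. norm (f x))" by (rule integral_norm_bound)
  also have "\<dots> \<le> integral\<^sup>L N g"
    using assms by (intro Bochner_Integration.integral_mono integrable_norm) auto
  finally show ?thesis .
qed

text \<open>
  The number of points is integer-valued, so the probability that it is positive is at most its mean.
  By the definition of the correlation functions the mean is the integral of \<open>\<rho>\<^sub>0\<^sub>,\<^sub>1(y) = R\<^sup>-\<^sup>-(y, y)\<close>.
\<close>

lemma prob_minus_points_le:
  assumes field: "meijer_G_field a b M X Y"
    and B: "B \<in> sets borel" "bounded B" "B \<subseteq> {0<..}"
    and R: "\<And>y. y \<in> B \<Longrightarrow> norm (R_mm a b y y) \<le> R" and R0: "R \<ge> 0"
  shows "measure M {\<omega> \<in> space M. Y \<omega> \<inter> B \<noteq> {}} \<le> R * measure lborel B"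
proof -
  interpret prob_space M using field by (simp add: meijer_G_field_def two_level_field_def)
  have Y: "random_configuration M Y" and corr: "has_correlation_functions M X Y (meijer_rho a b)"
    using field by (auto simp: meijer_G_field_def two_level_field_def)
  define P where "P = (\<Pi>\<^sub>M i\<in>{..<0::nat}. (lborel :: real measure)) \<Otimes>\<^sub>M (\<Pi>\<^sub>M j\<in>{..<1::nat}. (lborel :: real measure))"
  define D where "D = (\<Pi>\<^sub>E i\<in>{..<0::nat}. B) \<times> (\<Pi>\<^sub>E j\<in>{..<1::nat}. B)"
  define I where "I = set_lebesgue_integral P D (\<lambda>(x, y). meijer_rho a b 0 1 x y)"
  have box: "\<forall>i<k. B \<in> sets borel \<and> bounded B \<and> B \<subseteq> {0<..}" for k :: nat
    using B by blast
  note corr01 = corr[unfolded has_correlation_functions_def Let_def, THEN spec[where x = "0::nat"],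
      THEN spec[where x = "1::nat"], THEN spec[where x = "\<lambda>_. B"], THEN spec[where x = "\<lambda>_. B"],
      THEN mp, THEN mp, OF box box]
  have C: "set_integrable P D (\<lambda>(x, y). meijer_rho a b 0 1 x y)"
    "has_bochner_integral M (\<lambda>\<omega>. of_nat (card (distinct_tuples 0 (X \<omega>) (\<lambda>_. B)) * card (distinct_tuples 1 (Y \<omega>) (\<lambda>_. B)))) I"
    unfolding I_def P_def D_def
    by (rule corr01[THEN conjunct1], rule corr01[THEN conjunct2])
  have hb: "has_bochner_integral M (\<lambda>\<omega>. complex_of_nat (card (Y \<omega> \<inter> B))) I"
    using C(2) unfolding card_distinct_tuples_0 card_distinct_tuples_1 mult_1 .
  have fin: "emeasure lborel B < \<infinity>" using B(2) by (rule emeasure_bounded_finite)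
  have PD: "emeasure P D = emeasure lborel B" "D \<in> sets P"
    unfolding P_def D_def by (rule emeasure_single_point_box[OF B(1)])+
  have mD: "measure P D = measure lborel B" unfolding measure_def PD(1) ..
  have normI: "norm I \<le> R * measure lborel B"
  proof -
    have "norm I \<le> integral\<^sup>L P (\<lambda>z. R * indicat_real D z)"
      unfolding I_def set_lebesgue_integral_def
    proof (rule norm_integral_le_integral)
      show "integrable P (\<lambda>z. indicat_real D z *\<^sub>R (case z of (x, y) \<Rightarrow> meijer_rho a b 0 1 x y))"
        using C(1) by (simp add: set_integrable_def)
      show "integrable P (\<lambda>z. R * indicat_real D z)"
        using PD fin by (intro integrable_mult_right integrable_real_indicator) auto
      fix z
      show "norm (indicat_real D z *\<^sub>R (case z of (x, y) \<Rightarrow> meijer_rho a b 0 1 x y)) \<le> R * indicat_real D z"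
      proof (cases "z \<in> D")
        case True
        then have "snd z \<in> (\<Pi>\<^sub>E j\<in>{..<1::nat}. B)" unfolding D_def by (rule mem_Times_iff[THEN iffD1, THEN conjunct2])
        then have "snd z 0 \<in> B" by (rule PiE_mem) simp
        from R[OF this] True show ?thesis
          by (simp only: case_prod_beta meijer_rho_single_minus indicator_simps scaleR_one mult_1_right)
      qed simp
    qed
    also have "\<dots> = R * measure P D"
      using PD(2) by simp
    finally show ?thesis unfolding mD .
  qed
  have intc: "integrable M (\<lambda>\<omega>. complex_of_nat (card (Y \<omega> \<inter> B)))" and lim: "(\<integral>\<omega>. complex_of_nat (card (Y \<omega> \<inter> B)) \<partial>M) = I"
    using hb by (auto simp: has_bochner_integral_iff)
  have intr: "integrable M (\<lambda>\<omega>. real (card (Y \<omega> \<inter> B)))"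
    using integrable_Re[OF intc] by simp
  have "I = complex_of_real (\<integral>\<omega>. real (card (Y \<omega> \<inter> B)) \<partial>M)"
    unfolding lim[symmetric] integral_complex_of_real[symmetric] by simp
  then have E: "(\<integral>\<omega>. real (card (Y \<omega> \<inter> B)) \<partial>M) \<le> norm I"
    by (simp only: norm_of_real abs_ge_self)
  define S where "S = {\<omega> \<in> space M. Y \<omega> \<inter> B \<noteq> {}}"
  have finY: "finite (Y \<omega> \<inter> B)" if "\<omega> \<in> space M" for \<omega>
    using Y B(2) that by (simp add: random_configuration_def)
  have S_eq: "S = (\<lambda>\<omega>. card (Y \<omega> \<inter> B)) -` (- {0}) \<inter> space M"
    using finY by (auto simp: S_def card_eq_0_iff)
  have "(\<lambda>\<omega>. card (Y \<omega> \<inter> B)) \<in> measurable M (count_space UNIV)"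
    using Y B by (simp add: random_configuration_def)
  then have S: "S \<in> sets M" unfolding S_eq by (rule measurable_sets) simp
  have "measure M S = (\<integral>\<omega>. indicat_real S \<omega> \<partial>M)" using S by simp
  also have "\<dots> \<le> (\<integral>\<omega>. real (card (Y \<omega> \<inter> B)) \<partial>M)"
  proof (rule integral_mono)
    show "integrable M (indicat_real S)" using S by (intro integrable_real_indicator) (auto simp: emeasure_eq_measure)
    show "integrable M (\<lambda>\<omega>. real (card (Y \<omega> \<inter> B)))" by (rule intr)
    fix \<omega> assume "\<omega> \<in> space M"
    show "indicat_real S \<omega> \<le> real (card (Y \<omega> \<inter> B))"
    proof (cases "\<omega> \<in> S")
      case True
      then have "card (Y \<omega> \<inter> B) \<noteq> 0" by (simp add: S_eq)
      then have "1 \<le> real (card (Y \<omega> \<inter> B))" by linarith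
      then show ?thesis using True by simp
    qed simp
  qed
  also have "\<dots> \<le> norm I" by (rule E)
  also note normI
  finally show ?thesis unfolding S_def .
qed

text \<open>
  A bounded set may accumulate at the origin, where the bounds on compact subsets of \<open>(0, \<infinity>)\<close> are of no
  use; the kernel bounds hold on the whole half-line and remain bounded at the origin for large \<open>b\<close>.
\<close>

lemma tendsto_prob_minus_points:
  fixes M :: "real \<Rightarrow> 'w measure"
  assumes a: "a > -1"
    and field: "\<And>b. b > -1 \<Longrightarrow> a + b > -1 \<Longrightarrow> meijer_G_field a b (M b) (X b) (Y b)"
    and A: "A \<in> sets borel" "bounded A" "A \<subseteq> {0<..}"
  shows "((\<lambda>b. measure (M b) {\<omega> \<in> space (M b). rescale (b / 4) (Y b \<omega>) \<inter> A \<noteq> {}}) \<longlongrightarrow> 0) at_top"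
proof -
  define \<sigma> where "\<sigma> = (1 + max 0 (-a)) / 2"
  have \<sigma>: "0 < \<sigma>" "-a < \<sigma>" "\<sigma> < 1" using a by (auto simp: \<sigma>_def)
  obtain C where C: "C > 0" and kb:
    "eventually (rescaled_kernel_bounds a \<sigma> C) at_top"
    using eventually_rescaled_kernel_bounds[OF a \<sigma>] by blast
  obtain X0 where X0: "X0 > 0" "\<And>x. x \<in> A \<Longrightarrow> \<bar>x\<bar> \<le> X0"
    using A(2) by (auto simp: bounded_pos)
  define Z where "Z = X0 / 4"
  have Z: "Z > 0" using X0 by (simp add: Z_def)
  define g where "g = (\<lambda>b. C * (Z powr (-\<sigma>) * negative_point_rate a b Z))"
  have g0: "((\<lambda>b. g b * X0) \<longlongrightarrow> 0) at_top"
    unfolding g_def by (intro tendsto_mult_left_zero tendsto_mult_right_zero tendsto_negative_point_rate a Z)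
  show ?thesis
  proof (rule Lim_null_comparison[OF _ g0])
    show "eventually (\<lambda>b. norm (measure (M b) {\<omega> \<in> space (M b). rescale (b / 4) (Y b \<omega>) \<inter> A \<noteq> {}}) \<le> g b * X0) at_top"
      using kb eventually_ge_at_top[of 1]
    proof eventually_elim
      case (elim b)
      have b: "b \<ge> 1" "b > 0" using elim(2) by auto
      define h where "h = b / 4"
      have h: "h > 0" using b by (simp add: h_def)
      have G: "Gamma b > 0" "Gamma (a + b + 1) > 0" using b a by (auto intro!: Gamma_real_pos)
      \<comment> \<open>The set \<open>A\<close> in the original scale.\<close>
      define B where "B = (\<lambda>x. x / h) -` A \<inter> space borel"
      have "(\<lambda>x. x / h) \<in> borel_measurable borel" by measurable
      then have B1: "B \<in> sets borel" unfolding B_def using A(1) by (rule measurable_sets)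
      have Bsub: "B \<subseteq> {0<..h * X0}"
      proof
        fix x assume "x \<in> B"
        then have x: "x / h \<in> A" by (simp add: B_def)
        then have "x / h > 0" using A(3) by auto
        moreover have "x / h \<le> X0" using X0(2)[OF x] abs_ge_self[of "x / h"] by linarith
        ultimately show "x \<in> {0<..h * X0}" using h by (simp add: zero_less_divide_iff pos_divide_le_eq mult.commute)
      qed
      have B2: "bounded B"
        by (rule bounded_subset[OF bounded_closed_interval[of 0 "h * X0"]]) (use Bsub in auto)
      have B3: "B \<subseteq> {0<..}" using Bsub by auto
      \<comment> \<open>Since \<open>b \<ge> 1 > \<sigma>\<close>, the exponent \<open>b - \<sigma>\<close> is positive.\<close>
      have rate: "x powr (-\<sigma>) * negative_point_rate a b x \<le> Z powr (-\<sigma>) * negative_point_rate a b Z"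
        if x: "0 < x" "x \<le> Z" for x
      proof -
        have eq: "y powr (-\<sigma>) * negative_point_rate a b y = exp 1 powr b * y powr (b - \<sigma>) * exp y / (Gamma b * Gamma (a + b + 1))"
          if "y > 0" for y
        proof -
          have "y powr (b - \<sigma>) = y powr b * y powr (-\<sigma>)" using that by (simp flip: powr_add)
          then show ?thesis unfolding negative_point_rate_def by (simp add: powr_mult)
        qed
        show ?thesis
          unfolding eq[OF x(1)] eq[OF Z] using x G b \<sigma>
          by (intro divide_right_mono mult_mono powr_mono2) auto
      qed
      have R: "norm (R_mm a b y y) \<le> g b / h" if "y \<in> B" for y
      proof -
        define x where "x = y / h"
        have x: "x \<in> A" using that by (simp add: x_def B_def)
        then have x0: "x > 0" "x / 4 \<le> Z" using A(3) X0(2)[OF x] by (auto simp: Z_def)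
        have y: "y = b / 4 * x" using h by (simp add: x_def h_def)
        have "norm (of_real (b / 4) * R_mm a b (b / 4 * x) (b / 4 * x)) \<le> C * ((x / 4) powr (-\<sigma>) * negative_point_rate a b (x / 4))"
          using elim(1) x0(1) unfolding rescaled_kernel_bounds_def by blast
        also have "\<dots> \<le> g b" unfolding g_def using x0 C by (intro mult_left_mono rate) auto
        finally have "norm (of_real h * R_mm a b y y) \<le> g b" unfolding y[symmetric] h_def .
        then have "h * norm (R_mm a b y y) \<le> g b" unfolding norm_mult norm_of_real using h by simp
        then show ?thesis using h by (simp add: pos_le_divide_eq mult.commute)
      qed
      have gb: "g b \<ge> 0" unfolding g_def using C G Z by (simp add: negative_point_rate_def)
      have "meijer_G_field a b (M b) (X b) (Y b)" using a b by (intro field) auto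
      then have prob: "measure (M b) {\<omega> \<in> space (M b). Y b \<omega> \<inter> B \<noteq> {}} \<le> g b / h * measure lborel B"
      proof (rule prob_minus_points_le[OF _ B1 B2 B3 R])
        show "0 \<le> g b / h" using gb h by simp
      qed
      have hX: "0 \<le> h * X0" using h X0 by simp
      have "measure lborel B \<le> measure lborel {0<..h * X0}"
        using Bsub B1 hX by (intro measure_mono_fmeasurable) (auto simp: fmeasurable_def)
      also have "\<dots> = h * X0" using hX by simp
      finally have "g b / h * measure lborel B \<le> g b / h * (h * X0)"
        using gb h by (intro mult_left_mono) auto
      with prob have le: "measure (M b) {\<omega> \<in> space (M b). Y b \<omega> \<inter> B \<noteq> {}} \<le> g b / h * (h * X0)"
        by linarith
      have "rescale (b / 4) S \<inter> A \<noteq> {} \<longleftrightarrow> S \<inter> B \<noteq> {}" for S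
        unfolding rescale_def B_def h_def by auto
      then have "measure (M b) {\<omega> \<in> space (M b). rescale (b / 4) (Y b \<omega>) \<inter> A \<noteq> {}} \<le> g b * X0"
        using le h by (simp only:) simp
      then show ?case by simp
    qed
  qed
qed

theorem theorem3p1:
  fixes a :: real
  assumes "a > -1"
  shows
    "(\<forall>r\<ge>1. \<forall>\<zeta> :: nat \<Rightarrow> real. (\<forall>i<r. \<zeta> i > 0) \<longrightarrow>
        ((\<lambda>b. of_real ((b / 4) ^ r) *
              Determinant.det (Matrix.mat r r (\<lambda>(i, j). R_pp a b (b / 4 * \<zeta> i) (b / 4 * \<zeta> j))))
          \<longlongrightarrow> of_real (Determinant.det (Matrix.mat r r (\<lambda>(i, j). bessel_kernel a (\<zeta> i) (\<zeta> j)))))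
          at_top)
     \<and>
     (\<forall>r. \<forall>s\<ge>1. \<forall>K. compact K \<and> K \<subseteq> {0<..} \<longrightarrow>
        uniform_limit {(\<zeta>, \<xi>). (\<forall>i<r. \<zeta> i \<in> K) \<and> (\<forall>j<s. \<xi> j \<in> K)}
          (\<lambda>b (\<zeta>, \<xi>). rescaled_meijer_rho a b r s \<zeta> \<xi>) (\<lambda>_. 0) at_top)
     \<and>
     (\<forall>(M :: real \<Rightarrow> 'w measure) X Y.
        (\<forall>b. b > -1 \<and> a + b > -1 \<longrightarrow> meijer_G_field a b (M b) (X b) (Y b)) \<longrightarrow>
        (\<forall>A. A \<in> sets borel \<and> bounded A \<and> A \<subseteq> {0<..} \<longrightarrow>
          ((\<lambda>b. measure (M b) {\<omega> \<in> space (M b). rescale (b / 4) (Y b \<omega>) \<inter> A \<noteq> {}})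
            \<longlongrightarrow> 0) at_top))"
proof (intro conjI allI impI)
  fix r :: nat and \<zeta> :: "nat \<Rightarrow> real"
  assume "1 \<le> r" "\<forall>i<r. 0 < \<zeta> i"
  then show "((\<lambda>b. of_real ((b / 4) ^ r) *
              Determinant.det (Matrix.mat r r (\<lambda>(i, j). R_pp a b (b / 4 * \<zeta> i) (b / 4 * \<zeta> j))))
          \<longlongrightarrow> of_real (Determinant.det (Matrix.mat r r (\<lambda>(i, j). bessel_kernel a (\<zeta> i) (\<zeta> j))))) at_top"
    using tendsto_rescaled_plus_correlation[OF assms, of r \<zeta>] by blast
next
  fix r s :: nat and K :: "real set"
  assume "1 \<le> s" "compact K \<and> K \<subseteq> {0<..}"
  then show "uniform_limit {(\<zeta>, \<xi>). (\<forall>i<r. \<zeta> i \<in> K) \<and> (\<forall>j<s. \<xi> j \<in> K)}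
          (\<lambda>b (\<zeta>, \<xi>). rescaled_meijer_rho a b r s \<zeta> \<xi>) (\<lambda>_. 0) at_top"
    by (intro uniform_limit_rescaled_meijer_rho assms) auto
next
  fix M :: "real \<Rightarrow> 'w measure" and X Y and A :: "real set"
  assume "\<forall>b. b > -1 \<and> a + b > -1 \<longrightarrow> meijer_G_field a b (M b) (X b) (Y b)"
    and "A \<in> sets borel \<and> bounded A \<and> A \<subseteq> {0<..}"
  then show "((\<lambda>b. measure (M b) {\<omega> \<in> space (M b). rescale (b / 4) (Y b \<omega>) \<inter> A \<noteq> {}}) \<longlongrightarrow> 0) at_top"
    by (intro tendsto_prob_minus_points[OF assms, where X = X]) auto
qed

end
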